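(* Let $d\ge1$, and let $L_+,L_-,L_0$ be a Conway triple of oriented classical links (diagrams identical except near one crossing, which is positive in $L_+$, negative in $L_-$ and smoothed according to orientation in $L_0$) such that the two arcs at the crossing of $L_+$ belong to different components of $L_+$. Then $$\frac{1}{\sqrt{\lambda_D}}\,\Theta_d(L_+)-\sqrt{\lambda_D}\,\Theta_d(L_-)=(q-q^{-1})\,\Theta_d(L_0),\qquad\text{where }\lambda_D=\frac{z-(q-q^{-1})E_D}{z},\ E_D=\frac1d.$$
   Context: Let $B_n$ be the braid group on $n$ strands with standard generators $\sigma_1,\dots,\sigma_{n-1}$, and let $q\in\mathbb{C}\setminus\{0\}$. The Yokonuma--Hecke algebra $Y_{d,n}(q)$ is the $\mathbb{C}$-algebra generated by $g_1,\dots,g_{n-1},t_1,\dots,t_n$ with relations: $g_ig_jg_i=g_jg_ig_j$ for $|i-j|=1$; $g_ig_j=g_jg_i$ for $|i-j|>1$; $t_it_j=t_jt_i$; $t_jg_i=g_it_{s_i(j)}$ where $s_i=(i,i+1)$; $t_j^d=1$; and $g_i^2=1+(q-q^{-1})e_ig_i$, where $e_i=\frac1d\sum_{s=0}^{d-1}t_i^st_{i+1}^{d-s}$. Set $Y_{d,0}(q)=\mathbb{C}$; there are natural inclusions $Y_{d,n}(q)\subset Y_{d,n+1}(q)$. Let $D=\mathbb{Z}/d\mathbb{Z}$ and $E_D=1/d$, and let $z$ be an indeterminate. The trace $\mathrm{tr}_{d,D}:\bigcup_{n\ge0}Y_{d,n}(q)\to\mathbb{C}[z]$ is the unique linear map with,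 for all $n$ and all $a,b\in Y_{d,n}(q)$: $\mathrm{tr}_{d,D}(ab)=\mathrm{tr}_{d,D}(ba)$; $\mathrm{tr}_{d,D}(1)=1$; $\mathrm{tr}_{d,D}(ag_n)=z\,\mathrm{tr}_{d,D}(a)$; $\mathrm{tr}_{d,D}(at_{n+1}^k)=0$ for $1\le k\le d-1$. For $\alpha\in B_n$, $\mathrm{tr}_{d,D}(\alpha)$ is the trace of the image of $\alpha$ under $\sigma_i\mapsto g_i$. Set $\Lambda_D=\frac{1}{z\sqrt{\lambda_D}}$. For $\alpha\in B_n$ with closure $\widehat\alpha$ and exponent sum $\epsilon(\alpha)$, the isotopy invariant $\Theta_d=\Theta_d(q,z)$ of oriented classical links is $$\Theta_d(\widehat\alpha)=\Lambda_D^{n-1}(\sqrt{\lambda_D})^{\epsilon(\alpha)}\,\mathrm{tr}_{d,D}(\alpha).$$ Convention: in the braid representation $L_+=\widehat{\beta\sigma_i}$, $L_-=\widehat{\beta\sigma_i^{-1}}$, $L_0=\widehat\beta$, so that $\sigma_i$ is a positive crossing. *)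

theory Defs
  imports
    "HOL-Library.Poly_Mapping"
    "HOL-Algebra.QuotRing"
    "HOL-Algebra.Algebraic_Closure_Type"
begin

section \<open>Oriented link diagrams and isotopy\<close>

text \<open>
  Oriented classical links are given by planar diagrams in general position with respect to the
  height function.  Such a diagram is cut into horizontal slices, each containing one local
  maximum, one local minimum or one crossing, and is written as the list of these slices from top
  to bottom.  The number in a slice is the number of strands to the left of it.

  A horizontal level of the diagram is described by the list of the orientations of the strands
  it meets, read from left to right; \<^term>\<open>True\<close> means downwards.

  \<^item> \<open>Cap i o\<close> is a local maximum whose left leg has orientation \<open>o\<close> (its right leg has the
    opposite one).
  \<^item> \<open>Cup i\<close> is a local minimum.
  \<^item> \<open>Cross i c\<close> is a crossing; \<open>c\<close> tells whether the strand going from top left to bottom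
    right passes over the other one.
\<close>

datatype slice = Cap nat bool | Cup nat | Cross nat bool

type_synonym diagram = "slice list"

fun slice_step :: "slice \<Rightarrow> bool list \<Rightarrow> bool list option" where
  "slice_step (Cap i o') xs =
     (if i \<le> length xs then Some (take i xs @ [o', \<not> o'] @ drop i xs) else None)"
| "slice_step (Cup i) xs =
     (if Suc i < length xs \<and> xs ! i \<noteq> xs ! Suc i
      then Some (take i xs @ drop (i + 2) xs) else None)"
| "slice_step (Cross i c) xs =
     (if Suc i < length xs
      then Some (take i xs @ [xs ! Suc i, xs ! i] @ drop (i + 2) xs) else None)"

primrec run :: "diagram \<Rightarrow> bool list \<Rightarrow> bool list option" where
  "run [] xs = Some xs"
| "run (p # w) xs = Option.bind (slice_step p xs) (run w)"

definition link_diagram :: "diagram \<Rightarrow> bool" where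
  "link_diagram w \<longleftrightarrow> run w [] = Some []"

primrec pos :: "slice \<Rightarrow> nat" where
  "pos (Cap i o') = i"
| "pos (Cup i) = i"
| "pos (Cross i c) = i"

primrec strands_above :: "slice \<Rightarrow> nat" where
  "strands_above (Cap i o') = 0"
| "strands_above (Cup i) = 2"
| "strands_above (Cross i c) = 2"

primrec strands_below :: "slice \<Rightarrow> nat" where
  "strands_below (Cap i o') = 2"
| "strands_below (Cup i) = 0"
| "strands_below (Cross i c) = 2"

primrec shift :: "nat \<Rightarrow> slice \<Rightarrow> slice" where
  "shift k (Cap i o') = Cap (k + i) o'"
| "shift k (Cup i) = Cup (k + i)"
| "shift k (Cross i c) = Cross (k + i) c"

text \<open>
  The moves: the planar isotopies \<open>far\<close>, \<open>zigzag1\<close>, \<open>zigzag2\<close>, \<open>over_cap\<close>, \<open>over_cup\<close> and the three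
  Reidemeister moves.  In \<open>R3\<close> the three crossings are those of the strands starting at
  \<open>(i, i + 1)\<close>, \<open>(i, i + 2)\<close>, \<open>(i + 1, i + 2)\<close>; the side condition says that the relation
  ``passes over'' on these three strands is not cyclic.
\<close>

inductive move :: "diagram \<Rightarrow> diagram \<Rightarrow> bool" where
  far: "move [p, shift (pos p + strands_below p) r] [shift (pos p + strands_above p) r, p]"
| zigzag1: "move [Cap i o', Cup (Suc i)] []"
| zigzag2: "move [Cap (Suc i) o', Cup i] []"
| over_cap: "move [Cap i o', Cross (Suc i) c] [Cap (Suc i) o', Cross i (\<not> c)]"
| over_cup: "move [Cross i c, Cup (Suc i)] [Cross (Suc i) (\<not> c), Cup i]"
| R1: "move [Cap (Suc i) o', Cross i c, Cup (Suc i)] []"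
| R1': "move [Cap i o', Cross (Suc i) c, Cup i] []"
| R2: "move [Cross i c, Cross i (\<not> c)] []"
| R3: "b = a \<or> b = c \<Longrightarrow>
    move [Cross i a, Cross (Suc i) b, Cross i c] [Cross (Suc i) c, Cross i b, Cross (Suc i) a]"

definition diagram_move :: "diagram \<Rightarrow> diagram \<Rightarrow> bool" where
  "diagram_move w w' \<longleftrightarrow> link_diagram w \<and> link_diagram w' \<and>
     (\<exists>x u v y. w = x @ u @ y \<and> w' = x @ v @ y \<and> move u v)"

definition isotopic :: "diagram \<Rightarrow> diagram \<Rightarrow> bool" where
  "isotopic = equivclp diagram_move"

type_synonym link = "diagram set"

definition link_of :: "diagram \<Rightarrow> link" where
  "link_of w = {w'. isotopic w w'}"


subsection \<open>Components\<close>

text \<open>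
  The point \<open>(k, j)\<close> is the point on the \<open>j\<close>-th strand from the left (counted from 0) at the
  level above the slice \<open>w ! k\<close>.  The pairs \<open>(k, j)\<close> for which \<open>j\<close> is at least the number of
  strands at level \<open>k\<close> are not points of the diagram, and \<open>strand_arc\<close> never relates them to one.
\<close>

inductive strand_arc :: "diagram \<Rightarrow> nat \<times> nat \<Rightarrow> nat \<times> nat \<Rightarrow> bool" for w :: diagram where
  left_of: "k < length w \<Longrightarrow> j < pos (w ! k) \<Longrightarrow> strand_arc w (k, j) (Suc k, j)"
| right_of: "k < length w \<Longrightarrow>
    strand_arc w (k, pos (w ! k) + strands_above (w ! k) + m)
      (Suc k, pos (w ! k) + strands_below (w ! k) + m)"
| cap: "k < length w \<Longrightarrow> w ! k = Cap i o' \<Longrightarrow> strand_arc w (Suc k, i) (Suc k, Suc i)"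
| cup: "k < length w \<Longrightarrow> w ! k = Cup i \<Longrightarrow> strand_arc w (k, i) (k, Suc i)"
| cross1: "k < length w \<Longrightarrow> w ! k = Cross i c \<Longrightarrow> strand_arc w (k, i) (Suc k, Suc i)"
| cross2: "k < length w \<Longrightarrow> w ! k = Cross i c \<Longrightarrow> strand_arc w (k, Suc i) (Suc k, i)"

definition same_component :: "diagram \<Rightarrow> nat \<times> nat \<Rightarrow> nat \<times> nat \<Rightarrow> bool" where
  "same_component w = equivclp (strand_arc w)"


subsection \<open>Conway triples\<close>

text \<open>
  Let \<open>a\<close> and \<open>b\<close> be the orientations of the strands entering \<open>Cross i c\<close> from the top left and
  from the top right.  By the right-hand rule the crossing of two strands oriented downwards is
  positive iff the strand going from top right to bottom left is the upper one, i.e. iff \<open>\<not> c\<close>.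
  Reversing one of the two strands changes the sign.
\<close>

definition positive_crossing :: "bool \<Rightarrow> bool \<Rightarrow> bool \<Rightarrow> bool" where
  "positive_crossing a b c \<longleftrightarrow> (if a = b then \<not> c else c)"

text \<open>
  The oriented smoothing consists of two vertical strands if both strands run in the same
  vertical direction, and of a minimum above a maximum otherwise.
\<close>

definition smoothing :: "nat \<Rightarrow> bool \<Rightarrow> bool \<Rightarrow> diagram" where
  "smoothing i a b = (if a = b then [] else [Cup i, Cap i b])"

text \<open>
  The three diagrams differ only in the slice following the initial part \<open>x\<close>, so in \<open>Dp\<close> the two
  strands of the distinguished crossing are those at \<open>(length x, i)\<close> and \<open>(length x, Suc i)\<close>.
\<close>

definition conway_diagrams ::
  "diagram \<Rightarrow> nat \<Rightarrow> diagram \<Rightarrow> diagram \<Rightarrow> diagram \<Rightarrow> diagram \<Rightarrow> bool" where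
  "conway_diagrams x i y Dp Dm D0 \<longleftrightarrow>
     link_diagram Dp \<and> link_diagram Dm \<and> link_diagram D0 \<and>
     (\<exists>xs c. run x [] = Some xs \<and> Suc i < length xs \<and>
        positive_crossing (xs ! i) (xs ! Suc i) c \<and>
        Dp = x @ [Cross i c] @ y \<and>
        Dm = x @ [Cross i (\<not> c)] @ y \<and>
        D0 = x @ smoothing i (xs ! i) (xs ! Suc i) @ y)"

definition conway_triple_distinct_components :: "link \<Rightarrow> link \<Rightarrow> link \<Rightarrow> bool" where
  "conway_triple_distinct_components Lp Lm L0 \<longleftrightarrow>
     (\<exists>x i y Dp Dm D0. conway_diagrams x i y Dp Dm D0 \<and>
        \<not> same_component Dp (length x, i) (length x, Suc i) \<and>
        Lp = link_of Dp \<and> Lm = link_of Dm \<and> L0 = link_of D0)"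


section \<open>Braids\<close>

text \<open>
  An element of the braid group on \<open>n\<close> strands is represented by a word in the generators
  (numbered from 1) and their inverses.
\<close>

datatype braid_letter = Sig nat | Sig_inv nat

primrec letter_index :: "braid_letter \<Rightarrow> nat" where
  "letter_index (Sig i) = i"
| "letter_index (Sig_inv i) = i"

definition braid_words :: "nat \<Rightarrow> braid_letter list set" where
  "braid_words n = {\<alpha>. \<forall>l\<in>set \<alpha>. 1 \<le> letter_index l \<and> letter_index l < n}"

primrec letter_sign :: "braid_letter \<Rightarrow> int" where
  "letter_sign (Sig i) = 1"
| "letter_sign (Sig_inv i) = - 1"

definition exponent_sum :: "braid_letter list \<Rightarrow> int" where
  "exponent_sum \<alpha> = (\<Sum>l\<leftarrow>\<alpha>. letter_sign l)"

text \<open>Braids are drawn from top to bottom with all strands oriented downwards.\<close>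

primrec letter_crossing :: "braid_letter \<Rightarrow> slice" where
  "letter_crossing (Sig i) = Cross (i - 1) False"
| "letter_crossing (Sig_inv i) = Cross (i - 1) True"

definition braid_closure :: "nat \<Rightarrow> braid_letter list \<Rightarrow> diagram" where
  "braid_closure n \<alpha> =
     map (\<lambda>i. Cap i True) [0..<n] @ map letter_crossing \<alpha> @ map Cup (rev [0..<n])"


section \<open>The Yokonuma--Hecke algebra\<close>

datatype 'a free_monoid = Word (letters: "'a list")

instantiation free_monoid :: (type) monoid_add
begin

definition zero_free_monoid :: "'a free_monoid" where
  "0 = Word []"

definition plus_free_monoid :: "'a free_monoid \<Rightarrow> 'a free_monoid \<Rightarrow> 'a free_monoid" where
  "v + w = Word (letters v @ letters w)"

instance
  by standard (simp_all add: zero_free_monoid_def plus_free_monoid_def)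

end

datatype yh_gen = G nat | T nat

text \<open>The free \<open>\<complex>\<close>-algebra as the monoid algebra of the free monoid.\<close>

type_synonym yh_free = "yh_gen free_monoid \<Rightarrow>\<^sub>0 complex"

definition scalar :: "complex \<Rightarrow> yh_free" where
  "scalar c = Poly_Mapping.single 0 c"

definition gen_g :: "nat \<Rightarrow> yh_free" where
  "gen_g i = Poly_Mapping.single (Word [G i]) 1"

definition gen_t :: "nat \<Rightarrow> yh_free" where
  "gen_t j = Poly_Mapping.single (Word [T j]) 1"

definition idem_e :: "nat \<Rightarrow> nat \<Rightarrow> yh_free" where
  "idem_e d i = scalar (1 / of_nat d) * (\<Sum>s<d. gen_t i ^ s * gen_t (Suc i) ^ (d - s))"

definition yh_gens :: "nat \<Rightarrow> yh_gen set" where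
  "yh_gens n = G ` {i. 1 \<le> i \<and> i < n} \<union> T ` {1..n}"

definition yh_free_ring :: "nat \<Rightarrow> yh_free ring" where
  "yh_free_ring n =
     \<lparr>carrier = {p. \<forall>w\<in>Poly_Mapping.keys p. set (letters w) \<subseteq> yh_gens n},
      monoid.mult = (*), one = 1, ring.zero = 0, add = (+)\<rparr>"

text \<open>The differences of the two sides of the defining relations.\<close>

inductive_set yh_relators :: "nat \<Rightarrow> complex \<Rightarrow> nat \<Rightarrow> yh_free set"
  for d :: nat and q :: complex and n :: nat where
  braid: "1 \<le> i \<Longrightarrow> i < n \<Longrightarrow> 1 \<le> j \<Longrightarrow> j < n \<Longrightarrow> \<bar>int i - int j\<bar> = 1 \<Longrightarrow>
    gen_g i * gen_g j * gen_g i - gen_g j * gen_g i * gen_g j \<in> yh_relators d q n"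
| far: "1 \<le> i \<Longrightarrow> i < n \<Longrightarrow> 1 \<le> j \<Longrightarrow> j < n \<Longrightarrow> \<bar>int i - int j\<bar> > 1 \<Longrightarrow>
    gen_g i * gen_g j - gen_g j * gen_g i \<in> yh_relators d q n"
| tt: "1 \<le> i \<Longrightarrow> i \<le> n \<Longrightarrow> 1 \<le> j \<Longrightarrow> j \<le> n \<Longrightarrow>
    gen_t i * gen_t j - gen_t j * gen_t i \<in> yh_relators d q n"
| tg: "1 \<le> i \<Longrightarrow> i < n \<Longrightarrow> 1 \<le> j \<Longrightarrow> j \<le> n \<Longrightarrow>
    gen_t j * gen_g i - gen_g i * gen_t (transpose i (Suc i) j) \<in> yh_relators d q n"
| tpower: "1 \<le> j \<Longrightarrow> j \<le> n \<Longrightarrow> gen_t j ^ d - 1 \<in> yh_relators d q n"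
| quadratic: "1 \<le> i \<Longrightarrow> i < n \<Longrightarrow>
    gen_g i * gen_g i - (1 + scalar (q - inverse q) * (idem_e d i * gen_g i)) \<in> yh_relators d q n"

definition yh_ideal :: "nat \<Rightarrow> complex \<Rightarrow> nat \<Rightarrow> yh_free set" where
  "yh_ideal d q n = Idl\<^bsub>yh_free_ring n\<^esub> (yh_relators d q n)"

definition YH :: "nat \<Rightarrow> complex \<Rightarrow> nat \<Rightarrow> yh_free set ring" where
  "YH d q n = yh_free_ring n Quot yh_ideal d q n"

definition yh_class :: "nat \<Rightarrow> complex \<Rightarrow> nat \<Rightarrow> yh_free \<Rightarrow> yh_free set" where
  "yh_class d q n p = yh_ideal d q n +>\<^bsub>yh_free_ring n\<^esub> p"

text \<open>The natural map from \<open>YH d q n\<close> to \<open>YH d q (n + 1)\<close>: the class of \<open>p\<close> goes to the class of \<open>p\<close>.\<close>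

definition yh_incl :: "nat \<Rightarrow> complex \<Rightarrow> nat \<Rightarrow> yh_free set \<Rightarrow> yh_free set" where
  "yh_incl d q n A = yh_ideal d q (Suc n) <+>\<^bsub>yh_free_ring (Suc n)\<^esub> A"

definition yh_letter :: "nat \<Rightarrow> complex \<Rightarrow> nat \<Rightarrow> braid_letter \<Rightarrow> yh_free set" where
  "yh_letter d q n l = (case l of
     Sig i \<Rightarrow> yh_class d q n (gen_g i)
   | Sig_inv i \<Rightarrow> inv\<^bsub>YH d q n\<^esub> (yh_class d q n (gen_g i)))"

definition yh_braid :: "nat \<Rightarrow> complex \<Rightarrow> nat \<Rightarrow> braid_letter list \<Rightarrow> yh_free set" where
  "yh_braid d q n \<alpha> =
     foldr (\<lambda>l A. yh_letter d q n l \<otimes>\<^bsub>YH d q n\<^esub> A) \<alpha> \<one>\<^bsub>YH d q n\<^esub>"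


section \<open>The trace and the link invariant\<close>

text \<open>
  A map on the union of the algebras \<open>YH d q n\<close> is a family of maps \<open>tr n\<close> on \<open>YH d q n\<close> compatible
  with the natural maps.  The indeterminate \<open>z\<close> of \<open>\<complex>[z]\<close> is \<^term>\<open>[:0, 1:] :: complex poly\<close>.
\<close>

definition is_trace :: "nat \<Rightarrow> complex \<Rightarrow> (nat \<Rightarrow> yh_free set \<Rightarrow> complex poly) \<Rightarrow> bool" where
  "is_trace d q tr \<longleftrightarrow>
     (\<forall>n. \<forall>a\<in>carrier (YH d q n). tr (Suc n) (yh_incl d q n a) = tr n a) \<and>
     (\<forall>n. \<forall>a\<in>carrier (YH d q n). \<forall>b\<in>carrier (YH d q n).
        tr n (a \<oplus>\<^bsub>YH d q n\<^esub> b) = tr n a + tr n b) \<and>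
     (\<forall>n. \<forall>c. \<forall>a\<in>carrier (YH d q n).
        tr n (yh_class d q n (scalar c) \<otimes>\<^bsub>YH d q n\<^esub> a) = smult c (tr n a)) \<and>
     (\<forall>n. \<forall>a\<in>carrier (YH d q n). \<forall>b\<in>carrier (YH d q n).
        tr n (a \<otimes>\<^bsub>YH d q n\<^esub> b) = tr n (b \<otimes>\<^bsub>YH d q n\<^esub> a)) \<and>
     (\<forall>n. tr n \<one>\<^bsub>YH d q n\<^esub> = 1) \<and>
     (\<forall>n\<ge>1. \<forall>a\<in>carrier (YH d q n).
        tr (Suc n) (yh_incl d q n a \<otimes>\<^bsub>YH d q (Suc n)\<^esub> yh_class d q (Suc n) (gen_g n)) =
          [:0, 1:] * tr n a) \<and>
     (\<forall>n k. \<forall>a\<in>carrier (YH d q n). 1 \<le> k \<and> k \<le> d - 1 \<longrightarrow>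
        tr (Suc n) (yh_incl d q n a \<otimes>\<^bsub>YH d q (Suc n)\<^esub> yh_class d q (Suc n) (gen_t (Suc n) ^ k)) = 0)"

text \<open>
  Since \<open>z\<close> is an indeterminate and the invariant involves a square root of an element of \<open>\<complex>(z)\<close>,
  its values are taken in an algebraic closure of \<open>\<complex>(z)\<close>.
\<close>

type_synonym coeff_field = "complex poly fract alg_closure"

definition of_poly :: "complex poly \<Rightarrow> coeff_field" where
  "of_poly p = to_ac (Fract p 1)"

definition zvar :: coeff_field where
  "zvar = of_poly [:0, 1:]"

definition E_D :: "nat \<Rightarrow> complex" where
  "E_D d = 1 / of_nat d"

definition lambda_D :: "nat \<Rightarrow> complex \<Rightarrow> coeff_field" where
  "lambda_D d q = (zvar - of_poly [:(q - inverse q) * E_D d:]) / zvar"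

text \<open>Here \<open>r\<close> is the chosen square root of \<^term>\<open>lambda_D d q\<close>.\<close>

definition Lambda_D :: "coeff_field \<Rightarrow> coeff_field" where
  "Lambda_D r = 1 / (zvar * r)"

definition is_Theta ::
  "nat \<Rightarrow> complex \<Rightarrow> (nat \<Rightarrow> yh_free set \<Rightarrow> complex poly) \<Rightarrow> coeff_field \<Rightarrow>
   (link \<Rightarrow> coeff_field) \<Rightarrow> bool" where
  "is_Theta d q tr r \<Theta> \<longleftrightarrow>
     (\<forall>n\<ge>1. \<forall>\<alpha>\<in>braid_words n.
        \<Theta> (link_of (braid_closure n \<alpha>)) =
          Lambda_D r ^ (n - 1) * r powi exponent_sum \<alpha> * of_poly (tr n (yh_braid d q n \<alpha>)))"

end

theory Submission
  imports Defs "HOL-Combinatorics.Cycles"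
begin

text \<open>
  Two facts carry the proof, one topological and one algebraic.

  Algebra.  Let \<open>L_+\<close>, \<open>L_-\<close>, \<open>L_0\<close> be the closures of \<open>\<alpha>\<sigma>\<^sub>i\<beta>\<close>, \<open>\<alpha>\<sigma>\<^sub>i\<^sup>-\<^sup>1\<beta>\<close> and \<open>\<alpha>\<beta>\<close>.  The quadratic relation gives
  \<open>g\<^sub>i - g\<^sub>i\<^sup>-\<^sup>1 = (q - q\<^sup>-\<^sup>1) e\<^sub>i\<close>, so the difference of the first two traces is \<open>q - q\<^sup>-\<^sup>1\<close> times the trace of
  \<open>\<beta>\<alpha> e\<^sub>i\<close>.  A generator \<open>t\<^sub>j\<close> can be pushed through the braid \<open>\<gamma> = \<beta>\<alpha>\<close>, which changes its index by the
  permutation of \<open>\<gamma>\<close>, and then be carried back to the other end by the trace property.  Inside the trace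
  the indices of one cycle of \<open>\<gamma>\<close> are therefore interchangeable.  If \<open>i\<close> and \<open>i + 1\<close> lie in the same cycle,
  every summand \<open>t\<^sub>i\<^sup>s t\<^sub>i\<^sub>+\<^sub>1\<^sup>d\<^sup>-\<^sup>s\<close> of \<open>e\<^sub>i\<close> acts as \<open>t\<^sub>i\<^sup>d = 1\<close>, and the idempotent disappears from the trace
  (\<open>trace_skein\<close>).  The powers of \<open>\<Lambda>\<close> and of the square root of \<open>\<lambda>\<close> do the rest.  The hypothesis on
  components enters here: the two strands of \<open>\<sigma>\<^sub>i\<close> lie in different cycles of the permutation of
  \<open>\<gamma>\<sigma>\<^sub>i\<close> exactly when \<open>i\<close> and \<open>i + 1\<close> lie in the same cycle of that of \<open>\<gamma>\<close>.

  Topology.  The invariant is given by its values on closed braids, so a Conway triple of arbitrary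
  diagrams must be turned into a triple of closed braids that differ in a single letter
  (\<open>conway_triple_braids\<close>).  This is Alexander's theorem carried out with one crossing marked.  The mark
  stands for the positive crossing, the negative crossing and the smoothing at once; every move used on
  a diagram with a mark is a valid isotopy, or changes nothing, in each of these three readings.
  Crossings not oriented downwards on both strands are first rotated.  Then the upward strands are
  combed to the right of the downward ones, passing over them, slice by slice.  What remains
  between the combed levels consists of crossings among downward strands, crossings among upward strands
  and maxima and minima joining the two groups.  Upward crossings slide through the outer maxima and
  become downward ones, and an inner maximum slides over the minima above it; so the whole diagram
  becomes a closed braid (\<open>alexander\<close>).

  To carry the hypothesis on components along, it is expressed by a colouring of the strands with two
  colours that differ at the mark.  Existence of such a colouring is unchanged by the marked moves, and on a closed
  braid it forces \<open>i\<close> and \<open>i + 1\<close> into one cycle of the unmarked braid (\<open>orbit_reaches\<close>).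
\<close>

section \<open>Marked diagrams\<close>

text \<open>
  A crossing labelled \<open>None\<close> is the mark: a place that is to be filled by a positive crossing, by a negative
  crossing, or by two parallel strands.
\<close>

datatype marked_slice = MCap nat bool | MCup nat | MCross nat "bool option"

primrec mshift :: "nat \<Rightarrow> marked_slice \<Rightarrow> marked_slice" where
  "mshift k (MCap i o') = MCap (k + i) o'"
| "mshift k (MCup i) = MCup (k + i)"
| "mshift k (MCross i s) = MCross (k + i) s"

primrec mpos :: "marked_slice \<Rightarrow> nat" where
  "mpos (MCap i o') = i"
| "mpos (MCup i) = i"
| "mpos (MCross i s) = i"

primrec mabove :: "marked_slice \<Rightarrow> nat" where
  "mabove (MCap i o') = 0"
| "mabove (MCup i) = 2"
| "mabove (MCross i s) = 2"

primrec mbelow :: "marked_slice \<Rightarrow> nat" where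
  "mbelow (MCap i o') = 2"
| "mbelow (MCup i) = 0"
| "mbelow (MCross i s) = 2"

text \<open>
  A mark exchanges two strands that run in the same direction.  Its boundary is then the same whether it
  is filled by a crossing or by parallel strands.
\<close>

primrec mstep :: "marked_slice \<Rightarrow> bool list \<Rightarrow> bool list option" where
  "mstep (MCap i o') xs = slice_step (Cap i o') xs"
| "mstep (MCup i) xs = slice_step (Cup i) xs"
| "mstep (MCross i s) xs =
     (if s = None \<and> xs ! i \<noteq> xs ! Suc i then None else slice_step (Cross i True) xs)"

primrec mrun :: "marked_slice list \<Rightarrow> bool list \<Rightarrow> bool list option" where
  "mrun [] xs = Some xs"
| "mrun (p # w) xs = Option.bind (mstep p xs) (mrun w)"

lemma mrun_append: "mrun (u @ v) xs = Option.bind (mrun u xs) (mrun v)"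
  by (induction u arbitrary: xs) (auto simp: bind_assoc split: Option.bind_splits)

lemma mrun_appendI: "mrun u xs = Some ys \<Longrightarrow> mrun v ys = zs \<Longrightarrow> mrun (u @ v) xs = zs"
  by (simp add: mrun_append)

lemma mshift_mshift: "mshift k (mshift l p) = mshift (k + l) p"
  by (cases p) auto

lemma mshift_0 [simp]: "mshift 0 p = p"
  by (cases p) auto

lemma map_mshift_0 [simp]: "map (mshift 0) w = w"
  by (simp add: map_idI)

lemma mpos_mshift [simp]: "mpos (mshift k p) = k + mpos p" "mabove (mshift k p) = mabove p" "mbelow (mshift k p) = mbelow p"
  by (cases p; simp)+

lemma mstep_left: "mstep (mshift (length l) p) (l @ xs) = map_option ((@) l) (mstep p xs)"
  by (cases p) (auto simp: nth_append)

lemma mstep_right: "mstep p xs = Some ys \<Longrightarrow> mstep p (xs @ zs) = Some (ys @ zs)"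
  by (cases p) (auto simp: nth_append split: if_splits)

lemma mrun_left: "mrun (map (mshift (length l)) w) (l @ xs) = map_option ((@) l) (mrun w xs)"
proof (induction w arbitrary: xs)
  case (Cons p w)
  then show ?case by (cases "mstep p xs") (auto simp: mstep_left)
qed auto

lemma mrun_right: "mrun w xs = Some ys \<Longrightarrow> mrun w (xs @ zs) = Some (ys @ zs)"
proof (induction w arbitrary: xs)
  case (Cons p w)
  then show ?case by (cases "mstep p xs") (auto simp: mstep_right)
qed auto

lemma mstep_length:
  "mstep p xs = Some ys \<Longrightarrow> mpos p + mabove p \<le> length xs \<and>
     length ys + mabove p = length xs + mbelow p"
  by (cases p) (auto split: if_splits)

text \<open>
  In \<open>slide\<close> the strand that passes over the crossing or mark \<open>s\<close> has the same label \<open>c\<close> at both of its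
  crossings.  Hence the move is a third Reidemeister move if \<open>s\<close> is a crossing, whatever its sign, and an
  identity if \<open>s\<close> is replaced by parallel strands.
\<close>

inductive marked_move :: "marked_slice list \<Rightarrow> marked_slice list \<Rightarrow> bool" where
  far: "marked_move [p, mshift (mpos p + mbelow p) r] [mshift (mpos p + mabove p) r, p]"
| zigzag1: "marked_move [MCap i o', MCup (Suc i)] []"
| zigzag2: "marked_move [MCap (Suc i) o', MCup i] []"
| over_cap: "marked_move [MCap i o', MCross (Suc i) (Some c)] [MCap (Suc i) o', MCross i (Some (\<not> c))]"
| over_cup: "marked_move [MCross i (Some c), MCup (Suc i)] [MCross (Suc i) (Some (\<not> c)), MCup i]"
| curl: "marked_move [MCap (Suc i) o', MCross i (Some c), MCup (Suc i)] []"
| cancel: "marked_move [MCross i (Some c), MCross i (Some (\<not> c))] []"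
| slide: "marked_move [MCross i s, MCross (Suc i) (Some c), MCross i (Some c)]
            [MCross (Suc i) (Some c), MCross i (Some c), MCross (Suc i) s]"

text \<open>
  Isotopy of tangles with fixed boundary.  Both boundary levels are recorded so that every word that
  occurs is well oriented; read from right to left, a move such as \<open>zigzag1\<close> would otherwise create a
  maximum of the wrong orientation.
\<close>

inductive tangle_eq :: "bool list \<Rightarrow> marked_slice list \<Rightarrow> marked_slice list \<Rightarrow> bool list \<Rightarrow> bool" where
  identity: "mrun u xs = Some ys \<Longrightarrow> tangle_eq xs u u ys"
| move: "marked_move u v \<Longrightarrow> mrun u xs = Some ys \<Longrightarrow> mrun v xs = Some ys \<Longrightarrow> tangle_eq xs u v ys"
| inverse: "tangle_eq xs u v ys \<Longrightarrow> tangle_eq xs v u ys"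
| chain: "tangle_eq xs u v ys \<Longrightarrow> tangle_eq xs v w ys \<Longrightarrow> tangle_eq xs u w ys"
| compose: "tangle_eq xs u v ys \<Longrightarrow> tangle_eq ys u' v' zs \<Longrightarrow> tangle_eq xs (u @ u') (v @ v') zs"

lemma tangle_eq_mrun: "tangle_eq xs u v ys \<Longrightarrow> mrun u xs = Some ys \<and> mrun v xs = Some ys"
  by (induction rule: tangle_eq.induct) (auto simp: mrun_append)

lemma marked_move_mshift: "marked_move u v \<Longrightarrow> marked_move (map (mshift k) u) (map (mshift k) v)"
proof (induction rule: marked_move.induct)
  case (far p r)
  show ?case using marked_move.far[of "mshift k p" r] by (simp add: mshift_mshift add.assoc)
qed (auto intro: marked_move.intros)

lemma tangle_eq_left: "tangle_eq xs u v ys \<Longrightarrow> tangle_eq (l @ xs) (map (mshift (length l)) u) (map (mshift (length l)) v) (l @ ys)"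
proof (induction rule: tangle_eq.induct)
  case (move u v xs ys)
  then show ?case by (intro tangle_eq.move marked_move_mshift) (auto simp: mrun_left)
next
  case (compose xs u v ys u' v' zs)
  then show ?case by (auto intro: tangle_eq.compose)
qed (auto intro: tangle_eq.intros simp: mrun_left)

lemma tangle_eq_right: "tangle_eq xs u v ys \<Longrightarrow> tangle_eq (xs @ zs) u v (ys @ zs)"
proof (induction rule: tangle_eq.induct)
  case (move u v xs ys)
  then show ?case by (intro tangle_eq.move) (auto simp: mrun_right)
qed (auto intro: tangle_eq.intros simp: mrun_right)

lemma tangle_eq_context:
  "tangle_eq xs u v ys \<Longrightarrow> length l = k \<Longrightarrow>
     tangle_eq (l @ xs @ r) (map (mshift k) u) (map (mshift k) v) (l @ ys @ r)"
  using tangle_eq_left[OF tangle_eq_right[of xs u v ys r], of l] by simp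

lemma tangle_eq_app_left: "tangle_eq ys u v zs \<Longrightarrow> mrun w xs = Some ys \<Longrightarrow> tangle_eq xs (w @ u) (w @ v) zs"
  by (intro tangle_eq.compose tangle_eq.identity)

lemma tangle_eq_app_right: "tangle_eq xs u v ys \<Longrightarrow> mrun w ys = Some zs \<Longrightarrow> tangle_eq xs (u @ w) (v @ w) zs"
  by (intro tangle_eq.compose tangle_eq.identity)

lemma interchange1:
  assumes "mstep p xs = Some xs'" "mstep r ys = Some ys'"
  shows "tangle_eq (xs @ ys) [p, mshift (length xs') r] [mshift (length xs) r, p] (xs' @ ys')"
proof -
  define m where "m = length xs - (mpos p + mabove p)"
  have l: "length xs = mpos p + mabove p + m" "length xs' = mpos p + mbelow p + m"
    using mstep_length[OF assms(1)] by (auto simp: m_def)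
  have "marked_move [p, mshift (length xs') r] [mshift (length xs) r, p]"
    using marked_move.far[of p "mshift m r"] by (simp add: mshift_mshift l)
  then show ?thesis
    by (rule tangle_eq.move) (use assms in \<open>auto simp: mstep_right mstep_left\<close>)
qed

lemma interchange_word1:
  assumes "mstep p xs = Some xs'" "mrun v ys = Some ys'"
  shows "tangle_eq (xs @ ys) (p # map (mshift (length xs')) v) (map (mshift (length xs)) v @ [p]) (xs' @ ys')"
  using assms(2)
proof (induction v arbitrary: ys)
  case Nil
  then show ?case by (auto intro!: tangle_eq.identity simp: mstep_right assms)
next
  case (Cons r v)
  then obtain zs where z: "mstep r ys = Some zs" "mrun v zs = Some ys'"
    by (cases "mstep r ys") auto
  have "tangle_eq (xs @ ys) ([p, mshift (length xs') r] @ map (mshift (length xs')) v)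
          ([mshift (length xs) r, p] @ map (mshift (length xs')) v) (xs' @ ys')"
    by (rule tangle_eq_app_right[OF interchange1[OF assms(1) z(1)]]) (simp add: mrun_left z)
  moreover have "tangle_eq (xs @ ys) ([mshift (length xs) r] @ p # map (mshift (length xs')) v)
          ([mshift (length xs) r] @ map (mshift (length xs)) v @ [p]) (xs' @ ys')"
    by (rule tangle_eq_app_left[OF Cons.IH[OF z(2)]]) (simp add: mstep_left z)
  ultimately show ?case by (auto intro: tangle_eq.chain)
qed

text \<open>
  Tangles standing side by side can be moved vertically past each other.  Together with the context rules
  this is used wherever distant slices commute.
\<close>

lemma interchange:
  assumes "mrun u xs = Some xs'" "mrun v ys = Some ys'"
  shows "tangle_eq (xs @ ys) (u @ map (mshift (length xs')) v) (map (mshift (length xs)) v @ u) (xs' @ ys')"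
  using assms(1)
proof (induction u arbitrary: xs)
  case Nil
  then show ?case by (auto intro!: tangle_eq.identity simp: mrun_left assms)
next
  case (Cons p u)
  then obtain zs where z: "mstep p xs = Some zs" "mrun u zs = Some xs'"
    by (cases "mstep p xs") auto
  have "tangle_eq (xs @ ys) ([p] @ u @ map (mshift (length xs')) v)
          ([p] @ map (mshift (length zs)) v @ u) (xs' @ ys')"
    by (rule tangle_eq_app_left[OF Cons.IH[OF z(2)]]) (simp add: mstep_right z)
  moreover have "tangle_eq (xs @ ys) ((p # map (mshift (length zs)) v) @ u)
          ((map (mshift (length xs)) v @ [p]) @ u) (xs' @ ys')"
    by (rule tangle_eq_app_right[OF interchange_word1[OF z(1) assms(2)]]) (simp add: mrun_right z)
  ultimately show ?case by (auto intro: tangle_eq.chain)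
qed

text \<open>
  The form in which a single move is applied inside a longer word: the levels \<open>a\<close> and \<open>b\<close> are computed from
  \<open>p\<close> and \<open>u\<close> when the side conditions are discharged in order.
\<close>

lemma tangle_eq_at:
  assumes "marked_move u v" "mrun p xs = Some a" "mrun u a = Some b" "mrun v a = Some b" "mrun s b = Some ys"
    and "w = p @ u @ s" "w' = p @ v @ s"
  shows "tangle_eq xs w w' ys"
  unfolding assms(6,7)
  by (rule tangle_eq_app_left[OF tangle_eq_app_right[OF tangle_eq.move] assms(2)]) (use assms in auto)

lemma tangle_eq_at_rev:
  assumes "marked_move v u" "mrun p xs = Some a" "mrun u a = Some b" "mrun v a = Some b" "mrun s b = Some ys"
    and "w = p @ u @ s" "w' = p @ v @ s"
  shows "tangle_eq xs w w' ys"
  using tangle_eq_at[OF assms(1,2,4,3,5,7,6)] by (rule tangle_eq.inverse)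

lemma interchange_at:
  assumes "mrun p as = Some (xs @ ys)" "mrun u xs = Some xs'" "mrun v ys = Some ys'"
    and "mrun s (xs' @ ys') = Some zs"
    and "w = p @ u @ map (mshift (length xs')) v @ s" "w' = p @ map (mshift (length xs)) v @ u @ s"
  shows "tangle_eq as w w' zs"
  using tangle_eq_app_left[OF tangle_eq_app_right[OF interchange[OF assms(2,3)] assms(4)] assms(1)]
  by (simp add: assms(5,6))

section \<open>Curls and rotated crossings\<close>

abbreviation (input) crossing where "crossing i c \<equiv> MCross i (Some c)"

lemma zigzag_curl_cup: "tangle_eq [a] [MCap 0 a, crossing 1 c, MCup 1] [] [a]"
proof -
  have "tangle_eq [a] [MCap 0 a, crossing 1 c, MCup 1] [MCap 1 a, crossing 0 (\<not> c), MCup 1] [a]"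
    by (rule tangle_eq_at[OF marked_move.over_cap[of 0 a c], where p="[]" and s="[MCup 1]"]) simp+
  moreover have "tangle_eq [a] [MCap 1 a, crossing 0 (\<not> c), MCup 1] [] [a]"
    by (rule tangle_eq_at[OF marked_move.curl[of 0 a "\<not> c"], where p="[]" and s="[]"]) simp+
  ultimately show ?thesis by (rule tangle_eq.chain)
qed

text \<open>
  The curl next to a minimum is not literally a first Reidemeister move, which removes a curl from a
  vertical strand.  A zigzag is inserted in the left leg and the curled minimum is moved above the minimum
  of the zigzag.  Together with the maximum of the zigzag it then is a curled vertical strand, to which
  \<open>zigzag_curl_cup\<close> applies.
\<close>

lemma curl_cup: "tangle_eq [a, \<not> a] [crossing 0 c, MCup 0] [MCup 0] []"
proof -
  have "tangle_eq [a, \<not> a] [crossing 0 c, MCup 0] [MCap 1 (\<not> a), MCup 0, crossing 0 c, MCup 0] []"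
    by (rule tangle_eq_at_rev[OF marked_move.zigzag2[of 0 "\<not> a"], where p="[]" and s="[crossing 0 c, MCup 0]"]) simp+
  moreover have "tangle_eq [a, \<not> a] [MCap 1 (\<not> a), MCup 0, crossing 0 c, MCup 0]
      [MCap 1 (\<not> a), crossing 2 c, MCup 2, MCup 0] []"
    by (rule interchange_at[of "[MCap 1 (\<not> a)]" _ "[a, \<not> a]" "[a, \<not> a]" "[MCup 0]" "[]" "[crossing 0 c, MCup 0]" "[]" "[]"]) simp+
  moreover have "tangle_eq [a, \<not> a] [MCap 1 (\<not> a), crossing 2 c, MCup 2, MCup 0] [MCup 0] []"
    using tangle_eq_app_right[OF tangle_eq_context[OF zigzag_curl_cup[of "\<not> a" c], of "[a]" 1 "[]"], of "[MCup 0]" "[]"]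
    by (simp add: numeral_2_eq_2)
  ultimately show ?thesis by (blast intro: tangle_eq.chain)
qed

text \<open>
  The proof of \<open>curl_cup\<close> upside down.
\<close>

lemma curl_cap: "tangle_eq [] [MCap 0 a, crossing 0 c] [MCap 0 (\<not> a)] [\<not> a, a]"
proof -
  have "tangle_eq [] [MCap 0 a, crossing 0 c] [MCap 0 a, crossing 0 c, MCap 0 (\<not> a), MCup 1] [\<not> a, a]"
    by (rule tangle_eq_at_rev[OF marked_move.zigzag1[of 0 "\<not> a"], where s="[]" and p="[MCap 0 a, crossing 0 c]"]) simp+
  moreover have "tangle_eq [] [MCap 0 a, crossing 0 c, MCap 0 (\<not> a), MCup 1]
       [MCap 0 (\<not> a), MCap 2 a, crossing 2 c, MCup 1] [\<not> a, a]"
    by (rule tangle_eq.inverse, rule interchange_at[of "[]" _ "[]" "[]" "[MCap 0 (\<not> a)]" _ "[MCap 0 a, crossing 0 c]" _ "[MCup 1]"]) simp+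
  moreover have "tangle_eq [] [MCap 0 (\<not> a), MCap 2 a, crossing 2 c, MCup 1]
       [MCap 0 (\<not> a), MCap 2 a, crossing 1 (\<not> c), MCup 2]  [\<not> a, a]"
    by (rule tangle_eq_at_rev[OF marked_move.over_cup[of 1 "\<not> c"], where s="[]" and p="[MCap 0 (\<not> a), MCap 2 a]"]) simp+
  moreover have "tangle_eq [] [MCap 0 (\<not> a), MCap 2 a, crossing 1 (\<not> c), MCup 2] [MCap 0 (\<not> a)]  [\<not> a, a]"
    by (rule tangle_eq_at[OF marked_move.curl[of 1 a "\<not> c"], where s="[]" and p="[MCap 0 (\<not> a)]"]) simp+
  ultimately show ?thesis by (blast intro: tangle_eq.chain)
qed

text \<open>
  A crossing of antiparallel strands is a crossing of two downward strands turned by a quarter: one strand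
  is extended by a zigzag and the other one is pulled over or under its minimum.
\<close>

lemma rotate_crossing_TF:
  "tangle_eq [True, False] [crossing 0 c] [MCap 0 False, crossing 1 (\<not> c), MCup 2] [False, True]"
proof -
  have "tangle_eq [True, False] [MCap 0 False, crossing 1 (\<not> c), MCup 2] [MCap 0 False, crossing 2 c, MCup 1] [False, True]"
    by (rule tangle_eq_at[OF marked_move.over_cup[of 1 "\<not> c"], where p="[MCap 0 False]" and s="[]"]) simp+
  moreover have "tangle_eq [True, False] [crossing 0 c, MCap 0 False, MCup 1] [MCap 0 False, crossing 2 c, MCup 1] [False, True]"
    by (rule tangle_eq.inverse, rule interchange_at[of "[]" _ "[]" "[True, False]" "[MCap 0 False]" _ "[crossing 0 c]" _ "[MCup 1]"]) simp+
  moreover have "tangle_eq [True, False] [crossing 0 c, MCap 0 False, MCup 1] [crossing 0 c] [False, True]"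
    by (rule tangle_eq_at[OF marked_move.zigzag1[of 0 False], where p="[crossing 0 c]" and s="[]"]) simp+
  ultimately show ?thesis by (blast intro: tangle_eq.chain tangle_eq.inverse)
qed

lemma rotate_crossing_FT:
  "tangle_eq [False, True] [crossing 0 c] [MCap 2 True, crossing 1 (\<not> c), MCup 0] [True, False]"
proof -
  have "tangle_eq [False, True] [MCap 2 True, crossing 1 (\<not> c), MCup 0] [MCap 2 True, crossing 0 c, MCup 1] [True, False]"
    by (rule tangle_eq_at_rev[OF marked_move.over_cup[of 0 c], where p="[MCap 2 True]" and s="[]"]) simp+
  moreover have "tangle_eq [False, True] [crossing 0 c, MCap 2 True, MCup 1] [MCap 2 True, crossing 0 c, MCup 1] [True, False]"
    by (rule interchange_at[of "[]" _ "[False, True]" "[]" "[crossing 0 c]" _ "[MCap 0 True]" _ "[MCup 1]"]) simp+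
  moreover have "tangle_eq [False, True] [crossing 0 c, MCap 2 True, MCup 1] [crossing 0 c] [True, False]"
    by (rule tangle_eq_at[OF marked_move.zigzag2[of 1 True], where p="[crossing 0 c]" and s="[]"]) simp+
  ultimately show ?thesis by (blast intro: tangle_eq.chain tangle_eq.inverse)
qed

text \<open>
  A crossing of two upward strands is rotated by two quarter turns, the second of which is
  \<open>rotate_crossing_TF\<close>.
\<close>

lemma rotate_crossing_FF:
  "tangle_eq [False, False] [crossing 0 c] [MCap 0 False, MCap 1 False, crossing 2 c, MCup 3, MCup 2] [False, False]"
proof -
  have "tangle_eq [False, False] [MCap 0 False, MCap 1 False, crossing 2 c, MCup 3, MCup 2]
      [MCap 0 False, crossing 1 (\<not> c), MCup 2] [False, False]"
    using tangle_eq_app_left[of _ _ _ _ "[MCap 0 False]" "[False, False]", OF tangle_eq_app_right[OF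
       tangle_eq_context[OF tangle_eq.inverse[OF rotate_crossing_TF[of "\<not> c"]], of "[False]" 1 "[False]"], of "[MCup 2]" "[False, False]"]]
    by (simp add: eval_nat_numeral)
  moreover have "tangle_eq [False, False] [MCap 0 False, crossing 1 (\<not> c), MCup 2] [MCap 0 False, crossing 2 c, MCup 1] [False, False]"
    by (rule tangle_eq_at[OF marked_move.over_cup[of 1 "\<not> c"], where p="[MCap 0 False]" and s="[]"]) simp+
  moreover have "tangle_eq [False, False] [crossing 0 c, MCap 0 False, MCup 1] [MCap 0 False, crossing 2 c, MCup 1] [False, False]"
    by (rule tangle_eq.inverse, rule interchange_at[of "[]" _ "[]" "[False, False]" "[MCap 0 False]" _ "[crossing 0 c]" _ "[MCup 1]"]) simp+
  moreover have "tangle_eq [False, False] [crossing 0 c, MCap 0 False, MCup 1] [crossing 0 c] [False, False]"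
    by (rule tangle_eq_at[OF marked_move.zigzag1[of 0 False], where p="[crossing 0 c]" and s="[]"]) simp+
  ultimately show ?thesis by (blast intro: tangle_eq.chain tangle_eq.inverse)
qed

section \<open>Sorting the strands of a level\<close>

abbreviation "num_down xs \<equiv> count_list xs True"
abbreviation "num_up xs \<equiv> count_list xs False"
abbreviation "downs n \<equiv> replicate n True"
abbreviation "ups n \<equiv> replicate n False"

text \<open>
  The strand at the right end of \<open>a + 1\<close> strands passes over the others to the left end; by the
  convention on crossings the label is \<open>False\<close>.
\<close>

primrec pass :: "nat \<Rightarrow> marked_slice list" where
  "pass 0 = []"
| "pass (Suc a) = crossing a False # pass a"

lemma mrun_pass: "length xs = a \<Longrightarrow> mrun (pass a) (xs @ [x]) = Some (x # xs)"
proof (induction a arbitrary: xs x)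
  case (Suc a)
  then obtain ys y where xs: "xs = ys @ [y]" "length ys = a"
    by (metis length_Suc_conv_rev)
  have "mrun (pass a) ((ys @ [x]) @ [y]) = Some ((x # ys) @ [y])"
    by (rule mrun_right, rule Suc.IH) (use xs in auto)
  then show ?case using xs(2) by (simp add: xs nth_append)
qed auto

lemma mrun_pass': "length xs = a \<Longrightarrow> mrun (pass a) (xs @ x # ys) = Some (x # xs @ ys)"
  using mrun_right[OF mrun_pass, of xs a x ys] by simp

lemma pass_snoc: "pass (Suc a) = map (mshift 1) (pass a) @ [crossing 0 False]"
proof (induction a)
  case (Suc a)
  have "pass (Suc (Suc a)) = crossing (Suc a) False # pass (Suc a)" by simp
  also have "\<dots> = map (mshift 1) (pass (Suc a)) @ [crossing 0 False]" by (subst Suc.IH) simp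
  finally show ?case .
qed simp

lemma mstep_cross_replicate: "Suc i < a \<Longrightarrow> mstep (MCross i s) (replicate a x) = Some (replicate a x)"
proof -
  assume "Suc i < a"
  then obtain m where "a = i + (2 + m)" by (metis add_2_eq_Suc' add.commute less_iff_Suc_add add_Suc_right)
  then have "replicate a x = replicate i x @ [x,x] @ replicate m x" by (simp only: replicate_add numeral_2_eq_2) simp
  then show ?thesis by (simp add: nth_append)
qed

lemma mstep_T: "Suc i < a \<Longrightarrow> mstep (MCross i s) (downs a @ r) = Some (downs a @ r)"
  by (rule mstep_right[OF mstep_cross_replicate])

lemma mstep_F: "Suc j < b \<Longrightarrow> mstep (MCross (a + j) s) (downs a @ ups b) = Some (downs a @ ups b)"
  using mstep_left[of "downs a" "MCross j s" "ups b"] mstep_cross_replicate by simp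

lemma mstep_Cap: "mstep (MCap a True) (downs a @ r) = Some (downs (Suc a) @ False # r)"
  by (simp flip: replicate_append_same)

lemma mstep_Cup: "mstep (MCup a) (downs (Suc a) @ False # r) = Some (downs a @ r)"
  by (simp add: nth_append flip: replicate_append_same)

text \<open>
  The passing strand is above everything, so a crossing or mark below it can be moved from one side of it
  to the other.  The proof moves it through the two crossings involved by \<open>slide\<close> and past the remaining ones by
  commutation.
\<close>

lemma pass_slide:
  assumes "Suc k < a"
  shows "tangle_eq (downs a @ [x]) (pass a @ [MCross (Suc k) s]) (MCross k s # pass a) (x # downs a)"
  using assms
proof (induction a arbitrary: k)
  case (Suc a)
  note rep = replicate_append_same[symmetric]
  show ?case
  proof (cases "Suc k < a")
    case True
    then obtain m where m: "a = k + 2 + m" by (metis add_2_eq_Suc' add.commute less_iff_Suc_add add_Suc_right)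
    have 1: "tangle_eq (downs (Suc a) @ [x]) ([crossing a False] @ pass a @ [MCross (Suc k) s])
       ([crossing a False] @ MCross k s # pass a) (x # downs (Suc a))"
      using tangle_eq_right[OF Suc.IH[OF True], of "[True]"]
      by (intro tangle_eq_app_left) (auto simp: rep nth_append)
    have 2: "tangle_eq (downs (Suc a) @ [x]) (MCross k s # pass (Suc a)) ([crossing a False] @ MCross k s # pass a)  (x # downs (Suc a))"
    proof (rule interchange_at[where p="[]"])
      show "mrun [] (downs (Suc a) @ [x]) = Some (downs (k + 2) @ downs m @ [True, x])"
      proof -
        have "downs (Suc a) = downs (k + 2) @ downs (Suc m)" unfolding m replicate_add[symmetric] by simp
        then have "downs (Suc a) = downs (k + 2) @ downs m @ [True]" unfolding replicate_append_same by (simp only: replicate_Suc)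
        then show ?thesis by (simp only: mrun.simps append_assoc append.simps)
      qed
      show "mrun [MCross k s] (downs (k + 2)) = Some (downs (k + 2))"
        using mstep_cross_replicate[of k "k + 2" s True] by simp
      show "mrun [crossing m False] (downs m @ [True, x]) = Some (downs m @ [x, True])"
        by (simp add: nth_append)
      show "mrun (pass a) (downs (k + 2) @ downs m @ [x, True]) = Some (x # downs (Suc a))"
      proof -
        have "downs a = downs (k + 2) @ downs m" unfolding m replicate_add[symmetric] by (rule HOL.refl)
        then have "downs (k + 2) @ downs m @ [x, True] = downs a @ x # [True]" by (metis append_assoc)
        moreover have "x # downs (Suc a) = x # downs a @ [True]" unfolding replicate_append_same by (simp only: replicate_Suc)
        ultimately show ?thesis using mrun_pass'[of "downs a" a x "[True]"] by (metis length_replicate)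
      qed
    qed (simp_all add: m)
    show ?thesis using tangle_eq.chain[OF 1 tangle_eq.inverse[OF 2]] by simp
  next
    case False
    then have a: "a = Suc k" using Suc.prems by simp
    have e: "downs (Suc a) @ [x] = downs k @ [True, True, x]" "downs k @ [x, True, True] = (downs k @ [x]) @ [True, True]"
      by (simp_all add: a replicate_app_Cons_same)
    have m: "mrun (pass k) (downs k @ [x, True, True]) = Some (x # downs (Suc a))"
      using mrun_pass'[of "downs k" k x "[True, True]"] by (simp add: a replicate_app_Cons_same)
    have 1: "tangle_eq (downs (Suc a) @ [x]) (pass (Suc a) @ [MCross (Suc k) s])
       ([crossing (Suc k) False, crossing k False, MCross (Suc k) s] @ pass k) (x # downs (Suc a))"
    proof (rule interchange_at[where s="[]"])
      show "mrun [crossing (Suc k) False, crossing k False] (downs (Suc a) @ [x]) = Some ((downs k @ [x]) @ [True, True])"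
        unfolding e by (simp add: nth_append)
      show "mrun (pass k) (downs k @ [x]) = Some (x # downs k)"
        by (rule mrun_pass) simp
      show "mrun [MCross 0 s] [True, True] = Some [True, True]" by simp
      show "mrun [] ((x # downs k) @ [True, True]) = Some (x # downs (Suc a))" by (simp add: a replicate_app_Cons_same)
    qed (simp_all add: a)
    have 2: "tangle_eq (downs (Suc a) @ [x]) ([crossing (Suc k) False, crossing k False, MCross (Suc k) s] @ pass k)
       (MCross k s # pass (Suc a)) (x # downs (Suc a))"
    proof (rule tangle_eq_at_rev[OF marked_move.slide[of k s False], where p="[]" and s="pass k"])
      show "mrun [] (downs (Suc a) @ [x]) = Some (downs k @ [True, True, x])" unfolding e by simp
    qed (use m in \<open>simp_all add: a nth_append\<close>)
    show ?thesis by (rule tangle_eq.chain[OF 1 2])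
  qed
qed auto

text \<open>
  The braid from the sorted level, all downward strands to the left of all upward ones, to the level \<open>xs\<close>.
  Upward strands pass over downward ones and strands of equal direction do not cross.
\<close>

primrec sorting :: "bool list \<Rightarrow> marked_slice list" where
  "sorting [] = []"
| "sorting (x # xs) = (if x then [] else pass (num_down xs)) @ map (mshift 1) (sorting xs)"

lemma mrun_sorting: "mrun (sorting xs) (downs (num_down xs) @ ups (num_up xs)) = Some xs"
proof (induction xs)
  case (Cons x xs)
  have "mrun (map (mshift 1) (sorting xs)) (x # downs (num_down xs) @ ups (num_up xs)) = Some (x # xs)"
    using mrun_left[of "[x]" "sorting xs"] Cons by simp
  moreover have "\<not> x \<Longrightarrow> mrun (pass (num_down xs)) (downs (num_down xs) @ False # ups (num_up xs)) = Some (False # downs (num_down xs) @ ups (num_up xs))"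
    by (rule mrun_pass') simp
  ultimately show ?case by (cases x) (auto simp: mrun_append)
qed auto

text \<open>
  Words on sorted levels with \<open>a\<close> downward and \<open>b\<close> upward strands, in which the two groups interact only
  through maxima and minima joining the innermost strands.  Marks are allowed among downward strands only.
\<close>

inductive core_word :: "nat \<Rightarrow> nat \<Rightarrow> marked_slice list \<Rightarrow> nat \<Rightarrow> nat \<Rightarrow> bool" where
  Nil: "core_word a b [] a b"
| T: "Suc i < a \<Longrightarrow> core_word a b w a' b' \<Longrightarrow> core_word a b (MCross i s # w) a' b'"
| F: "Suc j < b \<Longrightarrow> core_word a b w a' b' \<Longrightarrow> core_word a b (crossing (a + j) c # w) a' b'"
| Cap: "core_word (Suc a) (Suc b) w a' b' \<Longrightarrow> core_word a b (MCap a True # w) a' b'"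
| Cup: "core_word a b w a' b' \<Longrightarrow> core_word (Suc a) (Suc b) (MCup a # w) a' b'"

lemma core_word_append: "core_word a b w a' b' \<Longrightarrow> core_word a' b' w' a'' b'' \<Longrightarrow> core_word a b (w @ w') a'' b''"
  by (induction rule: core_word.induct) (auto intro: core_word.intros)

lemma core_word_mshift: "core_word a b w a' b' \<Longrightarrow> core_word (Suc a) b (map (mshift 1) w) (Suc a') b'"
proof (induction rule: core_word.induct)
  case (F j b a w a' b' c)
  then show ?case using core_word.F[of j b "Suc a"] by auto
qed (auto intro: core_word.intros)

lemma mrun_core_word: "core_word a b w a' b' \<Longrightarrow> mrun w (downs a @ ups b) = Some (downs a' @ ups b')"
  by (induction rule: core_word.induct) (simp_all del: mstep.simps replicate.simps add: mstep_T mstep_F mstep_Cap mstep_Cup replicate.simps(2)[of _ False])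

text \<open>
  An upward strand passes over \<open>a\<close> downward strands in order to meet the leftmost one in a minimum.  The
  minimum is pulled back to the right by \<open>over_cup\<close>, one strand at a time, so that it is the leftmost
  strand instead that crosses the others.
\<close>

lemma cup_pull:
  "tangle_eq (True # downs a @ [False]) (map (mshift 1) (pass a) @ [MCup 0])
     (map (\<lambda>i. crossing i True) [0..<a] @ [MCup a]) (downs a)"
proof (induction a)
  case 0
  show ?case by (auto intro: tangle_eq.identity)
next
  case (Suc a)
  have e: "True # downs (Suc a) @ [False] = downs a @ [True, True, False]"
      "True # downs a @ [False, True] = downs a @ [True, False, True]" "downs a @ [True] = downs (Suc a)"
    by (simp_all add: replicate_app_Cons_same)
  have word: "mrun (map (\<lambda>i. crossing i True) [0..<a']) (downs (Suc a)) = Some (downs (Suc a))" if "a' \<le> a" for a'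
    using that by (induction a') (simp_all add: mrun_append mstep_cross_replicate del: mstep.simps replicate.simps)
  have sw: "mstep (crossing (Suc a) False) (True # downs (Suc a) @ [False]) = Some (True # downs a @ [False, True])"
    unfolding e by (simp add: nth_append)
  have 1: "tangle_eq (True # downs (Suc a) @ [False]) ([crossing (Suc a) False] @ (map (mshift 1) (pass a) @ [MCup 0]))
     ([crossing (Suc a) False] @ (map (\<lambda>i. crossing i True) [0..<a] @ [MCup a])) (downs (Suc a))"
    using tangle_eq_right[OF Suc.IH, of "[True]"] sw by (intro tangle_eq_app_left) (simp_all del: mstep.simps replicate.simps add: e)
  have 2: "tangle_eq (True # downs (Suc a) @ [False]) (map (\<lambda>i. crossing i True) [0..<a] @ [crossing (Suc a) False, MCup a])
     ([crossing (Suc a) False] @ (map (\<lambda>i. crossing i True) [0..<a] @ [MCup a])) (downs (Suc a))"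
  proof (rule interchange_at[where p="[]" and s="[MCup a]"])
    show "mrun [] (True # downs (Suc a) @ [False]) = Some (downs (Suc a) @ [True, False])"
      by (simp add: replicate_app_Cons_same)
    show "mrun (map (\<lambda>i. crossing i True) [0..<a]) (downs (Suc a)) = Some (downs (Suc a))" by (rule word) simp
    show "mrun [crossing 0 False] [True, False] = Some [False, True]" by simp
    show "mrun [MCup a] (downs (Suc a) @ [False, True]) = Some (downs (Suc a))"
      by (simp add: mstep_Cup e(3) del: mstep.simps replicate.simps)
  qed simp_all
  have 3: "tangle_eq (True # downs (Suc a) @ [False]) (map (\<lambda>i. crossing i True) [0..<a] @ [crossing (Suc a) False, MCup a])
      (map (\<lambda>i. crossing i True) [0..<a] @ [crossing a True, MCup (Suc a)]) (downs (Suc a))"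
  proof (rule tangle_eq_at_rev[OF marked_move.over_cup[of a True], where p="map (\<lambda>i. crossing i True) [0..<a]" and s="[]"])
    show "mrun (map (\<lambda>i. crossing i True) [0..<a]) (True # downs (Suc a) @ [False]) = Some (downs (Suc a) @ [True, False])"
      using mrun_right[OF word[of a], of "[True, False]"] by (simp add: replicate_app_Cons_same)
    show "mrun [crossing (Suc a) (\<not> True), MCup a] (downs (Suc a) @ [True, False]) = Some (downs (Suc a))"
      using mrun_left[of "downs a" "[crossing 1 False, MCup 0]" "[True, True, False]"]
      by (simp add: replicate_app_Cons_same replicate_append_same)
    show "mrun [crossing a True, MCup (Suc a)] (downs (Suc a) @ [True, False]) = Some (downs (Suc a))"
      using mstep_T[of a "Suc (Suc a)" "Some True" "[False]"] mstep_Cup[of "Suc a" "[]"]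
      by (simp add: replicate_app_Cons_same del: mstep.simps)
  qed simp_all
  show ?case using tangle_eq.chain[OF 1 tangle_eq.chain[OF tangle_eq.inverse[OF 2] 3]] by (simp add: comp_def)
qed

text \<open>
  A maximum is moved over a strand: its right leg is pushed across the strand by a second Reidemeister
  move, after which the strand can slide over to the left leg.
\<close>

lemma cap_pass: "tangle_eq [x] [MCap 0 o'] [MCap 1 o', crossing 0 False, crossing 1 False] [o', \<not> o', x]"
proof -
  have "tangle_eq [x] [MCap 0 o'] [MCap 0 o', crossing 1 True, crossing 1 False] [o', \<not> o', x]"
    by (rule tangle_eq_at_rev[OF marked_move.cancel[of 1 True], where p="[MCap 0 o']" and s="[]"]) simp+
  moreover have "tangle_eq [x] [MCap 0 o', crossing 1 True, crossing 1 False] [MCap 1 o', crossing 0 False, crossing 1 False] [o', \<not> o', x]"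
    by (rule tangle_eq_at[OF marked_move.over_cap[of 0 o' True], where p="[]" and s="[crossing 1 False]"]) simp+
  ultimately show ?thesis by (rule tangle_eq.chain)
qed

text \<open>
  The maximum on the far left is created in the middle instead, and its two legs are brought into place by
  crossings: the downward leg among downward strands, the upward leg over them.
\<close>

lemma cap_pull:
  "tangle_eq (downs a) [MCap 0 True] (MCap a True # pass a @ map (mshift 1) (pass a)) (True # False # downs a)"
proof (induction a)
  case 0
  show ?case by (auto intro: tangle_eq.identity)
next
  case (Suc a)
  have s: "downs (Suc a) = downs a @ [True]" unfolding replicate_append_same by simp
  have o: "mrun (pass a) (downs (Suc a)) = Some (downs (Suc a))"
    using mrun_pass[of "downs a" a True] by (simp add: s[symmetric] del: replicate_Suc) simp
  have u: "mrun (map (mshift 1) (pass a)) (downs (Suc a) @ [False, True]) = Some (True # False # downs (Suc a))"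
    using mrun_left[of "[True]" "pass a" "downs a @ [False, True]"] mrun_pass'[of "downs a" a False "[True]"]
    by (simp add: s replicate_append_same)
  have 1: "tangle_eq (downs (Suc a)) [MCap 0 True] (MCap a True # pass a @ map (mshift 1) (pass a)) (True # False # downs (Suc a))"
    using tangle_eq_right[OF Suc.IH, of "[True]"] by (simp add: replicate_append_same)
  have 2: "tangle_eq (downs (Suc a)) ([MCap a True] @ pass a @ map (mshift 1) (pass a))
     ([MCap (Suc a) True, crossing a False, crossing (Suc a) False] @ pass a @ map (mshift 1) (pass a)) (True # False # downs (Suc a))"
  proof (rule tangle_eq_app_right)
    show "tangle_eq (downs (Suc a)) [MCap a True] [MCap (Suc a) True, crossing a False, crossing (Suc a) False] (downs (Suc a) @ [False, True])"
      using tangle_eq_context[OF cap_pass[of True True], of "downs a" a "[]"]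
      by (simp add: replicate_append_same replicate_app_Cons_same)
    show "mrun (pass a @ map (mshift 1) (pass a)) (downs (Suc a) @ [False, True]) = Some (True # False # downs (Suc a))"
      by (rule mrun_appendI[OF mrun_right[OF o] u])
  qed
  have 3: "tangle_eq (downs (Suc a)) ([MCap (Suc a) True, crossing a False] @ pass a @ [crossing (Suc a) False] @ map (mshift 1) (pass a))
     ([MCap (Suc a) True, crossing a False] @ [crossing (Suc a) False] @ pass a @ map (mshift 1) (pass a)) (True # False # downs (Suc a))"
  proof (rule interchange_at)
    show "mrun [MCap (Suc a) True, crossing a False] (downs (Suc a)) = Some (downs (Suc a) @ [True, False])"
      using mstep_Cap[of "Suc a" "[]"] mstep_T[of a "Suc (Suc a)" "Some False" "[False]"]
      by (simp add: replicate_app_Cons_same del: mstep.simps)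
    show "mrun [crossing 0 False] [True, False] = Some [False, True]" by simp
    show "mrun (pass a) (downs (Suc a)) = Some (downs (Suc a))" by (rule o)
    show "mrun (map (mshift 1) (pass a)) (downs (Suc a) @ [False, True]) = Some (True # False # downs (Suc a))" by (rule u)
  qed simp_all
  show ?case using tangle_eq.chain[OF 1 tangle_eq.chain[OF 2[simplified append.simps append_assoc] tangle_eq.inverse[OF 3[simplified append.simps append_assoc]]]] by simp
qed

lemma mrun_pass_down_up: "mrun (pass a) (downs a @ ups (Suc b)) = Some (False # downs a @ ups b)"
  using mrun_pass'[of "downs a" a False "ups b"] by simp

text \<open>
  The inductive step common to all cases of \<open>pass_core_word\<close>: a first letter has been moved to the other side of
  the passing strand at the cost of a core word \<open>\<beta>\<close>.
\<close>

lemma pass_core_step: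
  assumes "mrun w (False # downs a1 @ ups b1) = Some zs"
    and "core_word a (Suc b) \<beta> a1 (Suc b1)"
    and "tangle_eq (downs a @ ups (Suc b)) (pass a @ [p]) (\<beta> @ pass a1) (False # downs a1 @ ups b1)"
    and "core_word a1 (Suc b1) \<alpha> a' (Suc b')"
    and "tangle_eq (downs a1 @ ups (Suc b1)) (pass a1 @ w) (\<alpha> @ pass a') (False # downs a' @ ups b')"
  shows "\<exists>\<alpha>. core_word a (Suc b) \<alpha> a' (Suc b') \<and>
     tangle_eq (downs a @ ups (Suc b)) (pass a @ p # w) (\<alpha> @ pass a') (False # downs a' @ ups b')"
proof (intro exI conjI)
  show "core_word a (Suc b) (\<beta> @ \<alpha>) a' (Suc b')" by (rule core_word_append[OF assms(2,4)])
  have z: "zs = False # downs a' @ ups b'"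
    using tangle_eq_mrun[OF assms(5)] assms(1) mrun_pass_down_up[of a1 b1] by (simp add: mrun_append)
  have 1: "tangle_eq (downs a @ ups (Suc b)) ((pass a @ [p]) @ w) ((\<beta> @ pass a1) @ w) zs"
    by (rule tangle_eq_app_right[OF assms(3,1)])
  have 2: "tangle_eq (downs a @ ups (Suc b)) (\<beta> @ (pass a1 @ w)) (\<beta> @ (\<alpha> @ pass a')) zs"
    unfolding z by (rule tangle_eq_app_left[OF assms(5) mrun_core_word[OF assms(2)]])
  show "tangle_eq (downs a @ ups (Suc b)) (pass a @ p # w) ((\<beta> @ \<alpha>) @ pass a') (False # downs a' @ ups b')"
    using tangle_eq.chain[OF 1 2[folded append_assoc]] by (simp add: z)
qed

text \<open>
  A core word beside an upward strand on its far left can be replaced by a core word performed before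
  that strand passes to the left.  Crossings slide from one side of the passing strand to the other.  A
  maximum or minimum in the middle causes an extra crossing of that strand with the upward leg, which is
  a crossing among upward strands.
\<close>

lemma pass_core_word:
  assumes "core_word a b \<alpha> a' b'"
  shows "\<exists>\<alpha>'. core_word a (Suc b) \<alpha>' a' (Suc b') \<and>
     tangle_eq (downs a @ ups (Suc b)) (pass a @ map (mshift 1) \<alpha>) (\<alpha>' @ pass a') (False # downs a' @ ups b')"
  using assms
proof (induction rule: core_word.induct)
  case (Nil a b)
  show ?case by (rule exI[of _ "[]"]) (auto intro!: core_word.Nil tangle_eq.identity simp: mrun_pass_down_up[simplified])
next
  case (T i a b w a' b' s)
  then obtain \<alpha> where IH: "core_word a (Suc b) \<alpha> a' (Suc b')"
     "tangle_eq (downs a @ ups (Suc b)) (pass a @ map (mshift 1) w) (\<alpha> @ pass a') (False # downs a' @ ups b')" by blast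
  have r: "mrun (map (mshift 1) w) (False # downs a @ ups b) = Some (False # downs a' @ ups b')"
    using mrun_left[of "[False]" w] mrun_core_word[OF T.hyps(2)] by simp
  show ?case unfolding list.map
  proof (rule pass_core_step[OF r _ _ IH])
    show "core_word a (Suc b) [MCross i s] a (Suc b)" using T by (intro core_word.intros)
    show "tangle_eq (downs a @ ups (Suc b)) (pass a @ [mshift 1 (MCross i s)]) ([MCross i s] @ pass a) (False # downs a @ ups b)"
      using tangle_eq_right[OF pass_slide[OF T.hyps(1), of False s], of "ups b"] by simp
  qed
next
  case (F j b a w a' b' c)
  then obtain \<alpha> where IH: "core_word a (Suc b) \<alpha> a' (Suc b')"
     "tangle_eq (downs a @ ups (Suc b)) (pass a @ map (mshift 1) w) (\<alpha> @ pass a') (False # downs a' @ ups b')" by blast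
  have r: "mrun (map (mshift 1) w) (False # downs a @ ups b) = Some (False # downs a' @ ups b')"
    using mrun_left[of "[False]" w] mrun_core_word[OF F.hyps(2)] by simp
  show ?case unfolding list.map
  proof (rule pass_core_step[OF r _ _ IH])
    show "core_word a (Suc b) [crossing (a + Suc j) c] a (Suc b)" using F by (intro core_word.intros) auto
    show "tangle_eq (downs a @ ups (Suc b)) (pass a @ [mshift 1 (crossing (a + j) c)]) ([crossing (a + Suc j) c] @ pass a) (False # downs a @ ups b)"
    proof (rule interchange_at[where p="[]" and s="[]"])
      show "mrun [] (downs a @ ups (Suc b)) = Some ((downs a @ [False]) @ ups b)" by simp
      show "mrun (pass a) (downs a @ [False]) = Some (False # downs a)" by (rule mrun_pass) simp
      show "mrun [crossing j c] (ups b) = Some (ups b)" using mstep_cross_replicate[OF F.hyps(1)] by (simp del: mstep.simps)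
    qed simp_all
  qed
next
  case (Cap a b w a' b')
  then obtain \<alpha> where IH: "core_word (Suc a) (Suc (Suc b)) \<alpha> a' (Suc b')"
     "tangle_eq (downs (Suc a) @ ups (Suc (Suc b))) (pass (Suc a) @ map (mshift 1) w) (\<alpha> @ pass a') (False # downs a' @ ups b')" by blast
  have r: "mrun (map (mshift 1) w) (False # downs (Suc a) @ ups (Suc b)) = Some (False # downs a' @ ups b')"
    using mrun_left[of "[False]" w] mrun_core_word[OF Cap.hyps(1)] by simp
  show ?case unfolding list.map
  proof (rule pass_core_step[OF r _ _ IH])
    \<comment> \<open>The summand 0 is the index of the crossing among the upward strands.\<close>
    show "core_word a (Suc b) [MCap a True, crossing (Suc a + 0) False] (Suc a) (Suc (Suc b))" by (intro core_word.intros) auto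
    have 1: "tangle_eq (downs a @ ups (Suc b)) (pass a @ [MCap (Suc a) True]) ([MCap (Suc a) True] @ pass a) (False # downs (Suc a) @ ups (Suc b))"
    proof (rule interchange_at[where p="[]" and s="[]"])
      show "mrun [] (downs a @ ups (Suc b)) = Some ((downs a @ [False]) @ ups b)" by simp
      show "mrun (pass a) (downs a @ [False]) = Some (False # downs a)" by (rule mrun_pass) simp
      show "mrun [MCap 0 True] (ups b) = Some (True # False # ups b)" by simp
    qed (simp_all add: replicate_app_Cons_same)
    have l: "tangle_eq [False] [MCap 1 True] [MCap 0 True, crossing 1 False, crossing 0 False] [False, True, False]"
    proof (rule tangle_eq.chain)
      show "tangle_eq [False] [MCap 1 True] [MCap 1 True, crossing 0 True, crossing 0 False] [False, True, False]"
        by (rule tangle_eq_at_rev[OF marked_move.cancel[of 0 True], where p="[MCap 1 True]" and s="[]"]) simp+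
      show "tangle_eq [False] [MCap 1 True, crossing 0 True, crossing 0 False] [MCap 0 True, crossing 1 False, crossing 0 False] [False, True, False]"
        by (rule tangle_eq_at_rev[OF marked_move.over_cap[of 0 True False], where p="[]" and s="[crossing 0 False]"]) simp+
    qed
    have 2: "tangle_eq (downs a @ ups (Suc b)) ([MCap (Suc a) True] @ pass a)
        ([MCap a True, crossing (Suc a) False, crossing a False] @ pass a) (False # downs (Suc a) @ ups (Suc b))"
    proof (rule tangle_eq_app_right)
      show "tangle_eq (downs a @ ups (Suc b)) [MCap (Suc a) True] [MCap a True, crossing (Suc a) False, crossing a False] (downs a @ [False, True, False] @ ups b)"
        using tangle_eq_context[OF l, of "downs a" a "ups b"] by simp
      show "mrun (pass a) (downs a @ [False, True, False] @ ups b) = Some (False # downs (Suc a) @ ups (Suc b))"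
        using mrun_pass'[of "downs a" a False "True # False # ups b"] by (simp add: replicate_app_Cons_same)
    qed
    show "tangle_eq (downs a @ ups (Suc b)) (pass a @ [mshift 1 (MCap a True)]) ([MCap a True, crossing (Suc a + 0) False] @ pass (Suc a)) (False # downs (Suc a) @ ups (Suc b))"
      using tangle_eq.chain[OF 1 2] by simp
  qed
next
  case (Cup a b w a' b')
  then obtain \<alpha> where IH: "core_word a (Suc b) \<alpha> a' (Suc b')"
     "tangle_eq (downs a @ ups (Suc b)) (pass a @ map (mshift 1) w) (\<alpha> @ pass a') (False # downs a' @ ups b')" by blast
  have r: "mrun (map (mshift 1) w) (False # downs a @ ups b) = Some (False # downs a' @ ups b')"
    using mrun_left[of "[False]" w] mrun_core_word[OF Cup.hyps(1)] by simp
  show ?case unfolding list.map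
  proof (rule pass_core_step[OF r _ _ IH])
    show "core_word (Suc a) (Suc (Suc b)) [crossing (Suc a + 0) True, MCup a] a (Suc b)" by (intro core_word.intros) auto
    have sw: "mrun [crossing a False] (downs (Suc a) @ ups (Suc (Suc b))) = Some ((downs a @ [False]) @ [True, False] @ ups b)"
      by (simp add: nth_append flip: replicate_append_same)
    have 1: "tangle_eq (downs (Suc a) @ ups (Suc (Suc b))) (pass (Suc a) @ [MCup (Suc a)]) ([crossing a False, MCup (Suc a)] @ pass a) (False # downs a @ ups b)"
    proof (rule interchange_at[where p="[crossing a False]" and s="[]"])
      show "mrun [crossing a False] (downs (Suc a) @ ups (Suc (Suc b))) = Some ((downs a @ [False]) @ [True, False] @ ups b)"
        by (rule sw)
      show "mrun (pass a) (downs a @ [False]) = Some (False # downs a)" by (rule mrun_pass) simp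
      show "mrun [MCup 0] ([True, False] @ ups b) = Some (ups b)" by simp
    qed simp_all
    have l: "tangle_eq [True, False, False] [crossing 0 False, MCup 1] [crossing 1 True, MCup 0] [False]"
      by (rule tangle_eq_at[OF marked_move.over_cup[of 0 False], where p="[]" and s="[]"]) simp+
    have 2: "tangle_eq (downs (Suc a) @ ups (Suc (Suc b))) ([crossing a False, MCup (Suc a)] @ pass a)
        ([crossing (Suc a) True, MCup a] @ pass a) (False # downs a @ ups b)"
    proof (rule tangle_eq_app_right)
      show "tangle_eq (downs (Suc a) @ ups (Suc (Suc b))) [crossing a False, MCup (Suc a)] [crossing (Suc a) True, MCup a] (downs a @ ups (Suc b))"
        using tangle_eq_context[OF l, of "downs a" a "ups b"] by (simp add: replicate_app_Cons_same)
    qed (rule mrun_pass_down_up)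
    show "tangle_eq (downs (Suc a) @ ups (Suc (Suc b))) (pass (Suc a) @ [mshift 1 (MCup a)]) ([crossing (Suc a + 0) True, MCup a] @ pass a) (False # downs a @ ups b)"
      using tangle_eq.chain[OF 1 2] by simp
  qed
qed

abbreviation "sort_strands xs \<equiv> downs (num_down xs) @ ups (num_up xs)"

section \<open>Absorbing a slice into the sorted part\<close>

text \<open>
  A word \<open>u\<close> after a sorting braid can be traded for a core word before one.  This is the invariant by which a
  diagram is normalised from top to bottom.
\<close>

definition absorbs :: "bool list \<Rightarrow> marked_slice list \<Rightarrow> bool list \<Rightarrow> bool" where
  "absorbs xs u ys \<longleftrightarrow> (\<exists>\<alpha>. core_word (num_down xs) (num_up xs) \<alpha> (num_down ys) (num_up ys) \<and>
     tangle_eq (sort_strands xs) (sorting xs @ u) (\<alpha> @ sorting ys) ys)"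

lemma absorbsI: "core_word (num_down xs) (num_up xs) \<alpha> (num_down ys) (num_up ys) \<Longrightarrow>
     tangle_eq (sort_strands xs) (sorting xs @ u) (\<alpha> @ sorting ys) ys \<Longrightarrow> absorbs xs u ys"
  by (auto simp: absorbs_def)

lemma absorbs_mrun: "absorbs xs u ys \<Longrightarrow> mrun u xs = Some ys"
  unfolding absorbs_def by (metis tangle_eq_mrun mrun_append mrun_sorting bind.bind_lunit)

lemma absorbs_append:
  assumes "absorbs xs u ys" "absorbs ys v zs"
  shows "absorbs xs (u @ v) zs"
proof -
  obtain \<alpha> where a: "core_word (num_down xs) (num_up xs) \<alpha> (num_down ys) (num_up ys)" "tangle_eq (sort_strands xs) (sorting xs @ u) (\<alpha> @ sorting ys) ys"
    using assms(1) by (auto simp: absorbs_def)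
  obtain \<beta> where b: "core_word (num_down ys) (num_up ys) \<beta> (num_down zs) (num_up zs)" "tangle_eq (sort_strands ys) (sorting ys @ v) (\<beta> @ sorting zs) zs"
    using assms(2) by (auto simp: absorbs_def)
  show ?thesis
  proof (rule absorbsI)
    show "core_word (num_down xs) (num_up xs) (\<alpha> @ \<beta>) (num_down zs) (num_up zs)" by (rule core_word_append[OF a(1) b(1)])
    show "tangle_eq (sort_strands xs) (sorting xs @ u @ v) ((\<alpha> @ \<beta>) @ sorting zs) zs"
      using tangle_eq.chain[OF tangle_eq_app_right[OF a(2) absorbs_mrun[OF assms(2)], simplified append_assoc]
          tangle_eq_app_left[OF b(2) mrun_core_word[OF a(1)]]] by simp
  qed
qed

lemma absorbs_tangle_eq: "tangle_eq xs u v ys \<Longrightarrow> absorbs xs v ys \<Longrightarrow> absorbs xs u ys"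
  unfolding absorbs_def by (meson tangle_eq.chain tangle_eq_app_left mrun_sorting)

text \<open>
  A further strand on the left of \<open>xs\<close> is, if it is downward, an outermost strand of the sorted level and does not interfere;
  if it is upward, it first passes over all downward strands and \<open>pass_core_word\<close> applies.  By this lemma
  only slices at the left end of a level need to be considered.
\<close>

lemma absorbs_Cons:
  assumes "absorbs xs u ys"
  shows "absorbs (x # xs) (map (mshift 1) u) (x # ys)"
proof -
  obtain \<alpha> where a: "core_word (num_down xs) (num_up xs) \<alpha> (num_down ys) (num_up ys)" "tangle_eq (sort_strands xs) (sorting xs @ u) (\<alpha> @ sorting ys) ys"
    using assms(1) by (auto simp: absorbs_def)
  have t: "tangle_eq (x # sort_strands xs) (map (mshift 1) (sorting xs) @ map (mshift 1) u) (map (mshift 1) \<alpha> @ map (mshift 1) (sorting ys)) (x # ys)"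
    using tangle_eq_context[OF a(2), of "[x]" 1 "[]"] by simp
  show ?thesis
  proof (cases x)
    case True
    then show ?thesis using t core_word_mshift[OF a(1)] by (intro absorbsI[of _ "map (mshift 1) \<alpha>"]) simp_all
  next
    case False
    obtain \<beta> where b: "core_word (num_down xs) (Suc (num_up xs)) \<beta> (num_down ys) (Suc (num_up ys))"
       "tangle_eq (downs (num_down xs) @ ups (Suc (num_up xs))) (pass (num_down xs) @ map (mshift 1) \<alpha>) (\<beta> @ pass (num_down ys)) (False # sort_strands ys)"
      using pass_core_word[OF a(1)] by blast
    have 1: "tangle_eq (downs (num_down xs) @ ups (Suc (num_up xs))) (pass (num_down xs) @ map (mshift 1) (sorting xs) @ map (mshift 1) u)
        (pass (num_down xs) @ map (mshift 1) \<alpha> @ map (mshift 1) (sorting ys)) (x # ys)"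
      using mrun_pass_down_up[of "num_down xs" "num_up xs"] by (intro tangle_eq_app_left[OF t]) (simp add: False)
    have 2: "tangle_eq (downs (num_down xs) @ ups (Suc (num_up xs))) ((pass (num_down xs) @ map (mshift 1) \<alpha>) @ map (mshift 1) (sorting ys))
        ((\<beta> @ pass (num_down ys)) @ map (mshift 1) (sorting ys)) (x # ys)"
      using mrun_left[of "[False]" "sorting ys" "sort_strands ys"] by (intro tangle_eq_app_right[OF b(2)]) (simp add: False mrun_sorting)
    show ?thesis using b(1) tangle_eq.chain[OF 1 2[simplified append_assoc]] False
      by (intro absorbsI[of _ \<beta>]) simp_all
  qed
qed

lemma absorbs_left: "absorbs xs u ys \<Longrightarrow> absorbs (l @ xs) (map (mshift (length l)) u) (l @ ys)"
proof (induction l)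
  case (Cons x l)
  then have "absorbs (l @ xs) (map (mshift (length l)) u) (l @ ys)" by blast
  from absorbs_Cons[OF this, of x] show ?case by (simp add: mshift_mshift comp_def)
qed simp

lemma absorbs_cross: "absorbs (True # True # v) [MCross 0 s] (True # True # v)"
proof (rule absorbsI)
  show "core_word (num_down (True # True # v)) (num_up (True # True # v)) [MCross 0 s] (num_down (True # True # v)) (num_up (True # True # v))"
    by (intro core_word.intros) auto
  show "tangle_eq (sort_strands (True # True # v)) (sorting (True # True # v) @ [MCross 0 s]) ([MCross 0 s] @ sorting (True # True # v)) (True # True # v)"
  proof (rule interchange_at[where p="[]" and s="[]", THEN tangle_eq.inverse])
    show "mrun [] (sort_strands (True # True # v)) = Some ([True, True] @ sort_strands v)" by simp
    show "mrun (sorting v) (sort_strands v) = Some v" by (rule mrun_sorting)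
    show "mrun [MCross 0 s] [True, True] = Some [True, True]" by simp
  qed (simp_all add: mshift_mshift comp_def numeral_2_eq_2)
qed

text \<open>
  By the choice of upward over downward, a crossing of this kind below a sorting braid yields a sorting braid.
\<close>

lemma sorting_swap: "tangle_eq (sort_strands (True # False # v)) (sorting (True # False # v) @ [crossing 0 False]) (sorting (False # True # v)) (False # True # v)"
proof (rule tangle_eq.inverse, rule interchange_at[where s="[]"])
  show "mrun (map (mshift 1) (pass (num_down v))) (sort_strands (True # False # v)) = Some ([True, False] @ sort_strands v)"
    using mrun_pass'[of "downs (num_down v)" "num_down v" False "ups (num_up v)"] mrun_left[of "[True]"] by simp
  show "mrun [crossing 0 False] [True, False] = Some [False, True]" by simp
  show "mrun (sorting v) (sort_strands v) = Some v" by (rule mrun_sorting)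
qed (auto simp: mshift_mshift eval_nat_numeral o_def pass_snoc simp del: pass.simps)

lemma absorbs_swap: "absorbs (True # False # v) [crossing 0 False] (False # True # v)"
  using sorting_swap by (intro absorbsI[of _ "[]"]) (auto intro: core_word.intros)

lemma absorbs_swap_back: "absorbs (False # True # v) [crossing 0 True] (True # False # v)"
proof (rule absorbsI[of _ "[]"])
  have 1: "tangle_eq (sort_strands (False # True # v)) ((sorting (True # False # v) @ [crossing 0 False]) @ [crossing 0 True])
     (sorting (False # True # v) @ [crossing 0 True]) (True # False # v)"
    using tangle_eq_app_right[OF sorting_swap[of v], of "[crossing 0 True]" "True # False # v"] by simp
  have 2: "tangle_eq (True # False # v) [crossing 0 False, crossing 0 True] [] (True # False # v)"
    by (rule tangle_eq.move) (use marked_move.cancel[of 0 False] in auto)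
  have 3: "tangle_eq (sort_strands (False # True # v)) (sorting (True # False # v) @ [crossing 0 False, crossing 0 True])
     (sorting (True # False # v) @ []) (True # False # v)"
    using mrun_sorting[of "True # False # v"] by (intro tangle_eq_app_left[OF 2]) simp
  show "tangle_eq (sort_strands (False # True # v)) (sorting (False # True # v) @ [crossing 0 True]) ([] @ sorting (True # False # v)) (True # False # v)"
    using tangle_eq.chain[OF tangle_eq.inverse[OF 1[simplified append_assoc append.simps]] 3] by (simp only: append_Nil append_Nil2)
qed (auto intro: core_word.intros)

lemma core_word_pass: "k < a \<Longrightarrow> core_word a b (pass k) a b"
  by (induction k) (auto intro: core_word.intros)

lemma core_word_upto: "k < a \<Longrightarrow> core_word a b (map (\<lambda>i. crossing i c) [0..<k]) a b"
  by (induction k) (auto intro!: core_word.intros core_word_append)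

lemma absorbs_cap: "absorbs v [MCap 0 True] (True # False # v)"
proof (rule absorbsI)
  let ?a = "num_down v"
  show "core_word (num_down v) (num_up v) (MCap ?a True # pass ?a) (num_down (True # False # v)) (num_up (True # False # v))"
    by (auto intro!: core_word.intros core_word_pass)
  have 1: "tangle_eq (sort_strands v) (sorting v @ [MCap 0 True]) ([MCap 0 True] @ map (mshift 2) (sorting v)) (True # False # v)"
  proof (rule interchange_at[where p="[]" and s="[]", THEN tangle_eq.inverse])
    show "mrun [] (sort_strands v) = Some ([] @ sort_strands v)" by simp
    show "mrun (sorting v) (sort_strands v) = Some v" by (rule mrun_sorting)
    show "mrun [MCap 0 True] [] = Some [True, False]" by simp
  qed (simp_all add: numeral_2_eq_2)
  have 2: "tangle_eq (sort_strands v) ([MCap 0 True] @ map (mshift 2) (sorting v)) ((MCap ?a True # pass ?a @ map (mshift 1) (pass ?a)) @ map (mshift 2) (sorting v)) (True # False # v)"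
    using mrun_left[of "[True, False]" "sorting v" "sort_strands v"] mrun_sorting[of v] tangle_eq_right[OF cap_pull[of ?a], of "ups (num_up v)"]
    by (intro tangle_eq_app_right) (auto simp: numeral_2_eq_2)
  show "tangle_eq (sort_strands v) (sorting v @ [MCap 0 True]) ((MCap ?a True # pass ?a) @ sorting (True # False # v)) (True # False # v)"
    using tangle_eq.chain[OF 1 2] by (simp add: mshift_mshift comp_def numeral_2_eq_2)
qed

lemma absorbs_cup: "absorbs (True # False # v) [MCup 0] v"
proof (rule absorbsI)
  let ?a = "num_down v" and ?w = "True # False # v"
  let ?u = "map (\<lambda>i. crossing i True) [0..<?a] @ [MCup ?a]"
  show "core_word (num_down ?w) (num_up ?w) ?u (num_down v) (num_up v)"
    by (auto intro!: core_word.intros core_word_append[OF core_word_upto])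
  have m: "mrun (map (mshift 1) (pass ?a)) (sort_strands ?w) = Some ([True, False] @ sort_strands v)"
    using mrun_pass'[of "downs (num_down v)" "num_down v" False "ups (num_up v)"] mrun_left[of "[True]"] by simp
  have 1: "tangle_eq (sort_strands ?w) (sorting ?w @ [MCup 0]) ((map (mshift 1) (pass ?a) @ [MCup 0]) @ sorting v) v"
  proof (rule interchange_at[where s="[]", THEN tangle_eq.inverse])
    show "mrun (map (mshift 1) (pass ?a)) (sort_strands ?w) = Some ([True, False] @ sort_strands v)" by (rule m)
    show "mrun (sorting v) (sort_strands v) = Some v" by (rule mrun_sorting)
    show "mrun [MCup 0] [True, False] = Some []" by simp
  qed (simp_all add: mshift_mshift comp_def numeral_2_eq_2)
  have 2: "tangle_eq (sort_strands ?w) ((map (mshift 1) (pass ?a) @ [MCup 0]) @ sorting v) (?u @ sorting v) v"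
    using mrun_sorting[of v] tangle_eq_right[OF cup_pull[of ?a], of "ups (num_up v)"]
    by (intro tangle_eq_app_right) auto
  show "tangle_eq (sort_strands ?w) (sorting ?w @ [MCup 0]) (?u @ sorting v) v"
    by (rule tangle_eq.chain[OF 1 2])
qed

text \<open>
  A maximum of the other orientation is a curled one, and the added crossing can be chosen as in the
  sorting braids.
\<close>

lemma absorbs_cap': "absorbs v [MCap 0 x] (x # (\<not> x) # v)"
proof (cases x)
  case False
  have "tangle_eq v [MCap 0 False] ([MCap 0 True] @ [crossing 0 False]) (False # True # v)"
    using tangle_eq_right[OF tangle_eq.inverse[OF curl_cap[of True False]], of v] by simp
  then show ?thesis using absorbs_append[OF absorbs_cap absorbs_swap] absorbs_tangle_eq False by auto
qed (simp add: absorbs_cap)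

lemma absorbs_cup': "absorbs (x # (\<not> x) # v) [MCup 0] v"
proof (cases x)
  case False
  have "tangle_eq (False # True # v) [MCup 0] ([crossing 0 True] @ [MCup 0]) v"
    using tangle_eq_right[OF tangle_eq.inverse[OF curl_cup[of False True]], of v] by simp
  then show ?thesis using absorbs_append[OF absorbs_swap_back absorbs_cup] absorbs_tangle_eq False by auto
qed (simp add: absorbs_cup)

text \<open>
  For words whose letters are absorbed one after the other, each with its own strands \<open>l\<close> on the left.
\<close>

lemma absorbs_at:
  assumes "absorbs xs u ys" "a = l @ xs" "b = l @ ys" "w = map (mshift (length l)) u" "absorbs b v zs"
  shows "absorbs a (w @ v) zs"
  using absorbs_append[OF absorbs_left[OF assms(1), of l]] assms by simp

lemma absorbs_Nil: "absorbs xs [] xs"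
  by (rule absorbsI[of _ "[]"]) (auto intro: core_word.intros tangle_eq.identity mrun_sorting)

text \<open>
  A crossing in which the downward strand passes over the other one does not occur in sorting braids.  In
  its rotated form, the only crossing is one of downward strands, which is absorbed as a core word.
\<close>

lemma absorbs_cross_TF: "absorbs (True # False # v) [crossing 0 c] (False # True # v)"
proof -
  have "absorbs (True # False # v) ([MCap 0 False] @ [crossing 1 (\<not> c)] @ [MCup 2] @ []) (False # True # v)"
    by (rule absorbs_at[OF absorbs_cap'[of "True # False # v" False], where l = "[]"], simp, simp, simp,
        rule absorbs_at[OF absorbs_cross[of "False # v"], where l = "[False]"], simp, simp, simp,
        rule absorbs_at[OF absorbs_cup'[of True v], where l = "[False, True]"], simp, simp, simp, rule absorbs_Nil)
  then show ?thesis
    using absorbs_tangle_eq[OF tangle_eq_right[OF rotate_crossing_TF[of c], of v]] by simp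
qed

lemma absorbs_cross_FT: "absorbs (False # True # v) [crossing 0 c] (True # False # v)"
proof -
  have "absorbs (False # True # v) ([MCap 2 True] @ [crossing 1 (\<not> c)] @ [MCup 0] @ []) (True # False # v)"
    by (rule absorbs_at[OF absorbs_cap'[of v True], where l = "[False, True]"], simp, simp, simp,
        rule absorbs_at[OF absorbs_cross[of "False # v"], where l = "[False]"], simp, simp, simp,
        rule absorbs_at[OF absorbs_cup'[of False "True # False # v"], where l = "[]"], simp, simp, simp, rule absorbs_Nil)
  then show ?thesis
    using absorbs_tangle_eq[OF tangle_eq_right[OF rotate_crossing_FT[of c], of v]] by simp
qed

lemma absorbs_cross_FF: "absorbs (False # False # v) [crossing 0 c] (False # False # v)"
proof -
  have "absorbs (False # False # v) ([MCap 0 False] @ [MCap 1 False] @ [crossing 2 c] @ [MCup 3] @ [MCup 2] @ []) (False # False # v)"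
    by (rule absorbs_at[OF absorbs_cap'[of "False # False # v" False], where l = "[]"], simp, simp, simp,
        rule absorbs_at[OF absorbs_cap'[of "True # False # False # v" False], where l = "[False]"], simp, simp, simp,
        rule absorbs_at[OF absorbs_cross[of "False # False # v"], where l = "[False, False]"], simp, simp, simp,
        rule absorbs_at[OF absorbs_cup'[of True "False # v"], where l = "[False, False, True]"], simp, simp, simp,
        rule absorbs_at[OF absorbs_cup'[of True v], where l = "[False, False]"], simp, simp, simp, rule absorbs_Nil)
  then show ?thesis
    using absorbs_tangle_eq[OF tangle_eq_right[OF rotate_crossing_FF[of c], of v]] by simp
qed

lemma absorbs_crossing: "s = None \<longrightarrow> a \<and> b \<Longrightarrow> absorbs (a # b # v) [MCross 0 s] (b # a # v)"
  by (cases a; cases b; cases s) (simp_all add: absorbs_cross absorbs_cross_TF absorbs_cross_FT absorbs_cross_FF)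

lemma absorbs_slice:
  assumes "mstep p xs = Some ys" and "\<And>i. p = MCross i None \<Longrightarrow> xs ! i"
  shows "absorbs xs [p] ys"
proof (cases p)
  case (MCap i x)
  then have i: "i \<le> length xs" and y: "ys = take i xs @ x # (\<not> x) # drop i xs"
    using assms(1) by (auto split: if_splits)
  show ?thesis using absorbs_left[OF absorbs_cap'[of "drop i xs" x], of "take i xs"] i by (simp add: y MCap)
next
  case (MCup i)
  then have i: "Suc i < length xs" "xs ! i \<noteq> xs ! Suc i" and y: "ys = take i xs @ drop (i + 2) xs"
    using assms(1) by (auto split: if_splits)
  then have "xs = take i xs @ (xs ! i) # (\<not> xs ! i) # drop (i + 2) xs"
    using id_take_nth_drop[of i xs] Cons_nth_drop_Suc[of "Suc i" xs] by auto
  then show ?thesis using absorbs_left[OF absorbs_cup'[of "xs ! i" "drop (i + 2) xs"], of "take i xs"] i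
    by (simp add: y MCup)
next
  case (MCross i s)
  then have i: "Suc i < length xs" and y: "ys = take i xs @ xs ! Suc i # xs ! i # drop (i + 2) xs"
     and s: "s = None \<longrightarrow> xs ! i \<and> xs ! Suc i"
    using assms by (auto split: if_splits)
  then have "xs = take i xs @ (xs ! i) # (xs ! Suc i) # drop (i + 2) xs"
    using id_take_nth_drop[of i xs] Cons_nth_drop_Suc[of "Suc i" xs] by auto
  then show ?thesis using absorbs_left[OF absorbs_crossing[OF s, of "drop (i + 2) xs"], of "take i xs"] i
    by (simp add: y MCross)
qed

section \<open>Alexander's theorem\<close>

definition braid_slices :: "nat \<Rightarrow> marked_slice list \<Rightarrow> bool" where
  "braid_slices n \<beta> \<longleftrightarrow> (\<forall>p\<in>set \<beta>. \<exists>i s. p = MCross i s \<and> Suc i < n)"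

definition nested_caps :: "nat \<Rightarrow> marked_slice list" where
  "nested_caps n = map (\<lambda>i. MCap i True) [0..<n]"

definition nested_cups :: "nat \<Rightarrow> nat \<Rightarrow> marked_slice list" where
  "nested_cups n m = map MCup (rev [m..<n])"

lemma nested_caps_Suc: "nested_caps (Suc n) = nested_caps n @ [MCap n True]"
  by (simp add: nested_caps_def)

lemma nested_cups_mshift: "nested_cups (m + k) m = map (mshift m) (nested_cups k 0)"
proof (induction k)
  case (Suc k)
  then show ?case by (simp add: nested_cups_def)
qed (simp add: nested_cups_def)

lemma nested_cups_Suc: "m < n \<Longrightarrow> nested_cups n m = nested_cups n (Suc m) @ [MCup m]"
  by (simp add: nested_cups_def upt_conv_Cons)

lemma mrun_nested_caps: "mrun (nested_caps n) [] = Some (downs n @ ups n)"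
proof (induction n)
  case (Suc n)
  show ?case using mstep_Cap[of n "ups n"]
    by (simp add: nested_caps_Suc mrun_append Suc del: mstep.simps)
qed (simp add: nested_caps_def)

lemma mrun_braid_slices: "braid_slices n \<beta> \<Longrightarrow> mrun \<beta> (downs n @ r) = Some (downs n @ r)"
  by (induction \<beta>) (auto simp: braid_slices_def mstep_T simp del: mstep.simps)

lemma mrun_nested_cups: "mrun (nested_cups k 0) (downs k @ ups k @ r) = Some r"
proof (induction k)
  case (Suc k)
  have "mrun (MCup k # nested_cups k 0) (downs (Suc k) @ False # ups k @ r) = Some r"
    using mstep_Cup[of k "ups k @ r"] Suc by (simp del: mstep.simps replicate.simps)
  then show ?case by (simp add: nested_cups_def)
qed (simp add: nested_cups_def)

lemma mrun_nested_cups_inner: "mrun (nested_cups (m + k) m) (downs (m + k) @ ups k @ r) = Some (downs m @ r)"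
  using mrun_left[of "downs m" "nested_cups k 0" "downs k @ ups k @ r"] mrun_nested_cups[of k r]
  by (simp add: nested_cups_mshift replicate_add)

text \<open>
  The crossing slides over both tops by \<open>over_cap\<close>, and the two changes of its label cancel.
\<close>

lemma nested_caps_cross: "tangle_eq [] [MCap 0 True, MCap 1 True, crossing 2 c] [MCap 0 True, MCap 1 True, crossing 0 c] [True, True, False, False]"
proof -
  have 1: "tangle_eq [] [MCap 0 True, MCap 1 True, crossing 2 c] [MCap 0 True, MCap 2 True, crossing 1 (\<not> c)] [True, True, False, False]"
    by (rule tangle_eq_at[OF marked_move.over_cap[of 1 True c], where p="[MCap 0 True]" and s="[]"]) simp+
  have 2: "tangle_eq [] [MCap 0 True, MCap 2 True, crossing 1 (\<not> c)] [MCap 0 True, MCap 0 True, crossing 1 (\<not> c)] [True, True, False, False]"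
    by (rule interchange_at[of "[]" _ "[]" "[]" "[MCap 0 True]" "[True, False]" "[MCap 0 True]" "[True, False]" "[crossing 1 (\<not> c)]"]) simp+
  have 3: "tangle_eq [] [MCap 0 True, MCap 0 True, crossing 1 (\<not> c)] [MCap 0 True, MCap 1 True, crossing 0 c] [True, True, False, False]"
    by (rule tangle_eq_at[OF marked_move.over_cap[of 0 True "\<not> c"], where p="[MCap 0 True]" and s="[]"]) simp+
  show ?thesis by (rule tangle_eq.chain[OF 1 tangle_eq.chain[OF 2 3]])
qed

lemma up_crossing_to_down: "tangle_eq [] (nested_caps (i + 2 + t) @ [crossing (i + 2 + t + t) c]) (nested_caps (i + 2 + t) @ [crossing i c])
   (downs (i + 2 + t) @ ups (i + 2 + t))"
proof (induction t)
  case 0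
  have "tangle_eq (downs i @ ups i) [MCap i True, MCap (Suc i) True, crossing (i + 2) c] [MCap i True, MCap (Suc i) True, crossing i c]
     (downs (i + 2 + 0) @ ups (i + 2 + 0))"
    using tangle_eq_context[OF nested_caps_cross[of c], of "downs i" i "ups i"]
    by (simp add: replicate_app_Cons_same)
  from tangle_eq_app_left[OF this mrun_nested_caps]
  show ?case by (simp add: nested_caps_Suc)
next
  case (Suc t)
  define n where "n = i + 2 + t"
  have m: "mrun [crossing i c] (downs n) = Some (downs n)" "mrun [crossing t c] (ups n) = Some (ups n)"
    using mstep_cross_replicate[of i n "Some c" True] mstep_cross_replicate[of t n "Some c" False]
    by (simp_all add: n_def del: mstep.simps)
  have c: "mrun [MCap n True] (downs n) = Some (downs (Suc n) @ [False])"
    using mstep_Cap[of n "[]"] by (simp del: mstep.simps)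
  have 1: "tangle_eq [] (nested_caps (Suc n) @ [crossing (Suc n + Suc t) c]) (nested_caps n @ [crossing (n + t) c] @ [MCap n True]) (downs (Suc n) @ ups (Suc n))"
    by (rule interchange_at[where s="[]", OF mrun_nested_caps c m(2)]) (simp_all add: nested_caps_Suc)
  have 2: "tangle_eq [] ((nested_caps n @ [crossing (n + t) c]) @ [MCap n True]) ((nested_caps n @ [crossing i c]) @ [MCap n True]) (downs (Suc n) @ ups (Suc n))"
    using mstep_Cap[of n "ups n"] by (intro tangle_eq_app_right[OF Suc.IH[folded n_def]]) (simp del: mstep.simps)
  have 3: "tangle_eq [] (nested_caps n @ [crossing i c] @ [MCap n True]) (nested_caps (Suc n) @ [crossing i c]) (downs (Suc n) @ ups (Suc n))"
  proof (rule interchange_at[where s="[]", OF mrun_nested_caps m(1)])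
    show "mrun [MCap 0 True] (ups n) = Some (True # False # ups n)" by simp
  qed (simp_all add: nested_caps_Suc replicate_app_Cons_same)
  show ?case using tangle_eq.chain[OF 1 tangle_eq.chain[OF 2[simplified append_assoc] 3]] by (simp add: n_def)
qed

text \<open>
  The tangle is a braid on \<open>m + k\<close> strands below nested maxima of which the \<open>k\<close> inner strands have
  already been closed up on the right.
\<close>

definition partial_closure :: "nat \<Rightarrow> marked_slice list \<Rightarrow> bool" where
  "partial_closure m w \<longleftrightarrow> (\<exists>k \<beta>. braid_slices (m + k) \<beta> \<and>
     tangle_eq [] w (nested_caps (m + k) @ \<beta> @ nested_cups (m + k) m) (downs m @ ups m))"

lemma partial_closure_tangle_eq: "tangle_eq [] w w' (downs m @ ups m) \<Longrightarrow> partial_closure m w' \<Longrightarrow> partial_closure m w"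
  unfolding partial_closure_def by (blast intro: tangle_eq.chain)

lemma mrun_caps_braid_slices: "braid_slices n \<beta> \<Longrightarrow> mrun (nested_caps n @ \<beta>) [] = Some (downs n @ ups n)"
  by (rule mrun_appendI[OF mrun_nested_caps mrun_braid_slices])

lemma partial_closure_T:
  assumes "partial_closure m w" "Suc i < m"
  shows "partial_closure m (w @ [MCross i s])"
proof -
  obtain k \<beta> where b: "braid_slices (m + k) \<beta>" "tangle_eq [] w (nested_caps (m + k) @ \<beta> @ nested_cups (m + k) m) (downs m @ ups m)"
    using assms(1) by (auto simp: partial_closure_def)
  have 1: "tangle_eq [] (w @ [MCross i s]) ((nested_caps (m + k) @ \<beta> @ nested_cups (m + k) m) @ [MCross i s]) (downs m @ ups m)"
    using mstep_T[OF assms(2)] by (intro tangle_eq_app_right[OF b(2)]) (simp del: mstep.simps)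
  have 2: "tangle_eq [] ((nested_caps (m + k) @ \<beta>) @ [MCross i s] @ nested_cups (m + k) m) ((nested_caps (m + k) @ \<beta>) @ nested_cups (m + k) m @ [MCross i s]) (downs m @ ups m)"
  proof (rule interchange_at[where s="[]"])
    show "mrun (nested_caps (m + k) @ \<beta>) [] = Some (downs m @ downs k @ ups k @ ups m)"
      using mrun_caps_braid_slices[OF b(1)] by (simp add: replicate_add flip: append_replicate_commute)
    show "mrun [MCross i s] (downs m) = Some (downs m)"
      using mstep_cross_replicate[OF assms(2)] by (simp del: mstep.simps)
    show "mrun (nested_cups k 0) (downs k @ ups k @ ups m) = Some (ups m)" by (rule mrun_nested_cups)
  qed (simp_all add: nested_cups_mshift)
  have "braid_slices (m + k) (\<beta> @ [MCross i s])" using b(1) assms(2) by (auto simp: braid_slices_def)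
  moreover have "tangle_eq [] (w @ [MCross i s]) (nested_caps (m + k) @ (\<beta> @ [MCross i s]) @ nested_cups (m + k) m) (downs m @ ups m)"
    using tangle_eq.chain[OF 1[simplified append_assoc] tangle_eq.inverse[OF 2, simplified append_assoc append.simps]]
    by simp
  ultimately show ?thesis unfolding partial_closure_def by blast
qed

text \<open>
  A crossing of upward strands commutes with the minima and with the braid, both lying to its left; at the
  top it slides over the maxima by \<open>up_crossing_to_down\<close> and becomes the first letter of the braid.
\<close>

lemma partial_closure_F:
  assumes "partial_closure m w" "Suc j < m"
  shows "partial_closure m (w @ [crossing (m + j) c])"
proof -
  obtain k \<beta> where b: "braid_slices (m + k) \<beta>" "tangle_eq [] w (nested_caps (m + k) @ \<beta> @ nested_cups (m + k) m) (downs m @ ups m)"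
    using assms(1) by (auto simp: partial_closure_def)
  define n where "n = m + k"
  \<comment> \<open>Nesting reverses the order: the right legs \<open>k + j\<close> and \<open>k + j + 1\<close> belong to the maxima \<open>i + 1\<close> and \<open>i\<close>.\<close>
  define i where "i = m - 2 - j"
  have i: "n = i + 2 + (k + j)" using assms(2) by (simp add: i_def n_def)
  note b = b[folded n_def]
  have e: "ups n = ups k @ ups m" unfolding n_def replicate_add[symmetric] by (simp add: add.commute)
  have 1: "tangle_eq [] (w @ [crossing (m + j) c]) ((nested_caps n @ \<beta> @ nested_cups n m) @ [crossing (m + j) c]) (downs m @ ups m)"
    using mstep_F[OF assms(2)] by (intro tangle_eq_app_right[OF b(2)]) (simp del: mstep.simps)
  have 2: "tangle_eq [] ((nested_caps n @ \<beta>) @ nested_cups n m @ [crossing (m + j) c]) ((nested_caps n @ \<beta>) @ [crossing (n + (k + j)) c] @ nested_cups n m) (downs m @ ups m)"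
  proof (rule interchange_at[where s="[]"])
    show "mrun (nested_caps n @ \<beta>) [] = Some ((downs n @ ups k) @ ups m)"
      using mrun_caps_braid_slices[OF b(1)] by (simp add: e)
    show "mrun (nested_cups n m) (downs n @ ups k) = Some (downs m)"
      using mrun_nested_cups_inner[of m k "[]"] by (simp add: n_def)
    show "mrun [crossing j c] (ups m) = Some (ups m)"
      using mstep_cross_replicate[OF assms(2)] by (simp del: mstep.simps)
  qed simp_all
  have r: "mrun (nested_cups n m) (downs n @ ups n) = Some (downs m @ ups m)"
    using mrun_nested_cups_inner[of m k "ups m"] by (simp only: e n_def[symmetric])
  have 3: "tangle_eq [] (nested_caps n @ \<beta> @ [crossing (n + (k + j)) c] @ nested_cups n m) (nested_caps n @ [crossing (n + (k + j)) c] @ \<beta> @ nested_cups n m) (downs m @ ups m)"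
  proof (rule interchange_at[OF mrun_nested_caps])
    show "mrun \<beta> (downs n) = Some (downs n)" using mrun_braid_slices[OF b(1), of "[]"] by simp
    show "mrun [crossing (k + j) c] (ups n) = Some (ups n)"
      using mstep_cross_replicate[of "k + j" n] i by (simp del: mstep.simps)
    show "mrun (nested_cups n m) (downs n @ ups n) = Some (downs m @ ups m)" by (rule r)
  qed simp_all
  have 4: "tangle_eq [] ((nested_caps n @ [crossing (n + (k + j)) c]) @ (\<beta> @ nested_cups n m)) ((nested_caps n @ [crossing i c]) @ (\<beta> @ nested_cups n m)) (downs m @ ups m)"
    by (rule tangle_eq_app_right[OF up_crossing_to_down[of i "k + j" c, folded i] mrun_appendI[OF mrun_braid_slices[OF b(1)] r]])
  have "tangle_eq [] (w @ [crossing (m + j) c]) (nested_caps n @ (crossing i c # \<beta>) @ nested_cups n m) (downs m @ ups m)"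
    using tangle_eq.chain[OF 1[simplified append_assoc] tangle_eq.chain[OF 2[simplified append_assoc] tangle_eq.chain[OF 3 4[simplified append_assoc]]]]
    by simp
  moreover have "braid_slices n (crossing i c # \<beta>)" using b(1) i by (auto simp: braid_slices_def)
  ultimately show ?thesis unfolding partial_closure_def n_def by blast
qed

lemma partial_closure_cup:
  assumes "partial_closure (Suc m) w" shows "partial_closure m (w @ [MCup m])"
proof -
  obtain k \<beta> where b: "braid_slices (Suc m + k) \<beta>" "tangle_eq [] w (nested_caps (Suc m + k) @ \<beta> @ nested_cups (Suc m + k) (Suc m)) (downs (Suc m) @ ups (Suc m))"
    using assms(1) by (auto simp: partial_closure_def)
  have "tangle_eq [] (w @ [MCup m]) (nested_caps (m + Suc k) @ \<beta> @ nested_cups (m + Suc k) m) (downs m @ ups m)"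
    using tangle_eq_app_right[OF b(2), of "[MCup m]" "downs m @ ups m"] mstep_Cup[of m "ups m"]
    by (simp add: nested_cups_Suc[of m] del: mstep.simps)
  then show ?thesis using b(1) unfolding partial_closure_def by (metis add_Suc_shift)
qed

text \<open>
  A maximum below a minimum is not planar isotopic to nested arcs.  The maximum is moved over the
  minimum, so that each of its legs crosses one strand of the minimum; afterwards the maximum comes first.
\<close>

lemma saddle: "tangle_eq [True, False] [MCup 0, MCap 0 True] [MCap 1 True, crossing 0 False, crossing 2 True, MCup 1] [True, False]"
proof -
  have 1: "tangle_eq [True, False] [MCap 0 True, MCup 2] [MCup 0, MCap 0 True] [True, False]"
    by (rule interchange_at[of "[]" _ "[]" "[True, False]" "[MCap 0 True]" "[True, False]" "[MCup 0]" "[]" "[]"]) simp+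
  have 2: "tangle_eq [True, False] [MCap 0 True, MCup 2] [MCap 0 True, crossing 1 True, crossing 1 False, MCup 2] [True, False]"
    by (rule tangle_eq_at_rev[OF marked_move.cancel[of 1 True], where p="[MCap 0 True]" and s="[MCup 2]"]) simp+
  have 3: "tangle_eq [True, False] [MCap 0 True, crossing 1 True, crossing 1 False, MCup 2] [MCap 0 True, crossing 1 True, crossing 2 True, MCup 1] [True, False]"
    by (rule tangle_eq_at[OF marked_move.over_cup[of 1 False], where p="[MCap 0 True, crossing 1 True]" and s="[]"]) simp+
  have 4: "tangle_eq [True, False] [MCap 0 True, crossing 1 True, crossing 2 True, MCup 1] [MCap 1 True, crossing 0 False, crossing 2 True, MCup 1] [True, False]"
    by (rule tangle_eq_at[OF marked_move.over_cap[of 0 True True], where p="[]" and s="[crossing 2 True, MCup 1]"]) simp+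
  show ?thesis by (rule tangle_eq.chain[OF tangle_eq.inverse[OF 1] tangle_eq.chain[OF 2 tangle_eq.chain[OF 3 4]]])
qed

text \<open>
  By \<open>saddle\<close> the new maximum climbs over the \<open>k\<close> minima one by one, leaving behind a crossing of downward
  and a crossing of upward strands each time.  Above all minima it commutes with the braid and extends the
  system of nested maxima.
\<close>

lemma partial_closure_cap_aux:
  "braid_slices (m + k) \<beta> \<Longrightarrow> partial_closure (Suc m) (nested_caps (m + k) @ \<beta> @ nested_cups (m + k) m @ [MCap m True])"
proof (induction k arbitrary: m)
  case 0
  then have c: "braid_slices m \<beta>" by simp
  have "tangle_eq [] (nested_caps m @ \<beta> @ [MCap m True]) (nested_caps m @ [MCap m True] @ \<beta>) (downs (Suc m) @ ups (Suc m))"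
  proof (rule interchange_at[OF mrun_nested_caps, where s="[]"])
    show "mrun \<beta> (downs m) = Some (downs m)" using mrun_braid_slices[OF c, of "[]"] by simp
    show "mrun [MCap 0 True] (ups m) = Some (True # False # ups m)" by simp
  qed (simp_all add: replicate_app_Cons_same)
  moreover have "braid_slices (Suc m) \<beta>" using c unfolding braid_slices_def by (meson less_SucI)
  ultimately show ?case unfolding partial_closure_def
    by (intro exI[of _ 0] exI[of _ \<beta>]) (simp add: nested_cups_def nested_caps_Suc)
next
  case (Suc k)
  let ?n = "m + Suc k"
  let ?W = "nested_caps ?n @ \<beta> @ nested_cups ?n (Suc m)"
  have c: "braid_slices (Suc m + k) \<beta>" using Suc.prems by simp
  have 1: "partial_closure (Suc (Suc m)) (?W @ [MCap (Suc m) True])"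
    using Suc.IH[OF c] by simp
  have 2: "partial_closure (Suc m) ((((?W @ [MCap (Suc m) True]) @ [crossing m False]) @ [crossing (Suc (Suc m) + 0) True]) @ [MCup (Suc m)])"
    by (rule partial_closure_cup, rule partial_closure_F, rule partial_closure_T, rule 1) auto
  have e: "ups ?n = ups k @ ups (Suc m)" unfolding replicate_add[symmetric] by (simp add: add.commute)
  have r: "mrun ?W [] = Some (downs (Suc m) @ ups (Suc m))"
    using mrun_nested_cups_inner[of "Suc m" k "ups (Suc m)"]
    by (intro mrun_appendI[OF mrun_nested_caps] mrun_appendI[OF mrun_braid_slices[OF Suc.prems]])
       (simp only: e add_Suc_shift)
  have 3: "tangle_eq (downs (Suc m) @ ups (Suc m)) [MCup m, MCap m True] [MCap (Suc m) True, crossing m False, crossing (Suc (Suc m)) True, MCup (Suc m)] (downs (Suc m) @ ups (Suc m))"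
    using tangle_eq_context[OF saddle, of "downs m" m "ups m"] by (simp add: replicate_app_Cons_same)
  show ?case
    using partial_closure_tangle_eq[OF tangle_eq_app_left[OF 3 r]] 2 by (simp add: nested_cups_Suc[of m])
qed

lemma partial_closure_cap:
  assumes "partial_closure m w" shows "partial_closure (Suc m) (w @ [MCap m True])"
proof -
  obtain k \<beta> where b: "braid_slices (m + k) \<beta>" "tangle_eq [] w (nested_caps (m + k) @ \<beta> @ nested_cups (m + k) m) (downs m @ ups m)"
    using assms(1) by (auto simp: partial_closure_def)
  have "tangle_eq [] (w @ [MCap m True]) (nested_caps (m + k) @ \<beta> @ nested_cups (m + k) m @ [MCap m True]) (downs (Suc m) @ ups (Suc m))"
    using tangle_eq_app_right[OF b(2), of "[MCap m True]" "downs (Suc m) @ ups (Suc m)"] mstep_Cap[of m "ups m"]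
    by (simp del: mstep.simps)
  then show ?thesis using partial_closure_tangle_eq partial_closure_cap_aux[OF b(1)] by blast
qed

text \<open>
  Core words preserve the difference of the numbers of downward and upward strands, so that starting from
  a partial closure the level remains balanced.
\<close>

lemma partial_closure_core_word: "core_word a b \<alpha> a' b' \<Longrightarrow> a = b \<Longrightarrow> partial_closure a w \<Longrightarrow> a' = b' \<and> partial_closure a' (w @ \<alpha>)"
proof (induction arbitrary: w rule: core_word.induct)
  case (T i a b v a' b' s)
  then show ?case using partial_closure_T[OF T.prems(2) T.hyps(1)] by fastforce
next
  case (F j b a v a' b' c)
  then show ?case using partial_closure_F[of a w j c] by fastforce
next
  case (Cap a b v a' b')
  then show ?case using partial_closure_cap[of a w] by fastforce
next
  case (Cup a b v a' b')
  then show ?case using partial_closure_cup[of a w] by fastforce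
qed auto

definition braided :: "marked_slice list \<Rightarrow> bool list \<Rightarrow> bool" where
  "braided w xs \<longleftrightarrow> num_down xs = num_up xs \<and> (\<exists>v. partial_closure (num_down xs) v \<and> tangle_eq [] w (v @ sorting xs) xs)"

lemma braided_absorb:
  assumes "braided w xs" "absorbs xs u ys"
  shows "braided (w @ u) ys"
proof -
  obtain v where v: "num_down xs = num_up xs" "partial_closure (num_down xs) v" "tangle_eq [] w (v @ sorting xs) xs"
    using assms(1) by (auto simp: braided_def)
  obtain \<alpha> where a: "core_word (num_down xs) (num_up xs) \<alpha> (num_down ys) (num_up ys)" "tangle_eq (sort_strands xs) (sorting xs @ u) (\<alpha> @ sorting ys) ys"
    using assms(2) by (auto simp: absorbs_def)
  have r: "mrun v [] = Some (sort_strands xs)"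
    using v(1,2) by (auto simp: partial_closure_def dest: tangle_eq_mrun)
  have "tangle_eq [] (w @ u) ((v @ sorting xs) @ u) ys"
    by (rule tangle_eq_app_right[OF v(3) absorbs_mrun[OF assms(2)]])
  moreover have "tangle_eq [] (v @ (sorting xs @ u)) (v @ (\<alpha> @ sorting ys)) ys"
    by (rule tangle_eq_app_left[OF a(2) r])
  ultimately have "tangle_eq [] (w @ u) ((v @ \<alpha>) @ sorting ys) ys" by (auto intro: tangle_eq.chain)
  then show ?thesis using partial_closure_core_word[OF a(1) v(1,2)] unfolding braided_def by blast
qed

text \<open>
  Marks may be combed along with the downward strands only.
\<close>

primrec marks_down :: "marked_slice list \<Rightarrow> bool list \<Rightarrow> bool" where
  "marks_down [] xs \<longleftrightarrow> True"
| "marks_down (p # w) xs \<longleftrightarrow> (\<forall>i. p = MCross i None \<longrightarrow> xs ! i) \<and> marks_down w (the (mstep p xs))"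

lemma braided_run:
  "braided w xs \<Longrightarrow> mrun u xs = Some ys \<Longrightarrow> marks_down u xs \<Longrightarrow> braided (w @ u) ys"
proof (induction u arbitrary: w xs)
  case (Cons p u)
  then obtain zs where z: "mstep p xs = Some zs" "mrun u zs = Some ys" by (cases "mstep p xs") auto
  have "absorbs xs [p] zs" by (rule absorbs_slice[OF z(1)]) (use Cons.prems in auto)
  from Cons.IH[OF braided_absorb[OF Cons.prems(1) this] z(2)] Cons.prems(3) z(1) show ?case by simp
qed auto

text \<open>
  At the bottom there are no strands left to sort, and the partial closure is complete.
\<close>

theorem alexander:
  assumes "mrun w [] = Some []" "marks_down w []"
  obtains n \<beta> where "braid_slices n \<beta>" "tangle_eq [] w (nested_caps n @ \<beta> @ nested_cups n 0) []"
proof -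
  have "partial_closure 0 []" unfolding partial_closure_def
    by (intro exI[of _ 0] exI[of _ "[]"]) (auto simp: braid_slices_def nested_caps_def nested_cups_def intro: tangle_eq.identity)
  then have "braided [] []" unfolding braided_def by (auto intro!: exI[of _ "[]"] tangle_eq.identity)
  from braided_run[OF this assms] have "braided w []" by simp
  then show ?thesis using that unfolding braided_def partial_closure_def by (auto intro: tangle_eq.chain)
qed

section \<open>From marked diagrams to links\<close>

text \<open>
  \<open>Some False\<close> and \<open>Some True\<close> fill the mark by a crossing, \<open>None\<close> by parallel strands.  On downward
  strands \<open>Some False\<close> is the positive crossing.
\<close>

primrec resolve :: "bool option \<Rightarrow> marked_slice \<Rightarrow> diagram" where
  "resolve m (MCap i o') = [Cap i o']"
| "resolve m (MCup i) = [Cup i]"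
| "resolve m (MCross i s) = (case s of Some c \<Rightarrow> [Cross i c]
     | None \<Rightarrow> (case m of Some c \<Rightarrow> [Cross i c] | None \<Rightarrow> []))"

abbreviation resolution :: "bool option \<Rightarrow> marked_slice list \<Rightarrow> diagram" where
  "resolution m w \<equiv> concat (map (resolve m) w)"

lemma run_append: "run (u @ v) xs = Option.bind (run u xs) (run v)"
  by (induction u arbitrary: xs) (auto simp: bind_assoc split: Option.bind_splits)

lemma swap_equal_entries: "Suc i < length xs \<Longrightarrow> xs ! i = b \<Longrightarrow> xs ! Suc i = b \<Longrightarrow>
   take i xs @ b # b # drop (Suc (Suc i)) xs = xs"
  using id_take_nth_drop[of i xs] Cons_nth_drop_Suc[of "Suc i" xs] by auto

lemma run_resolve: "mstep p xs = Some ys \<Longrightarrow> run (resolve m p) xs = Some ys"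
  by (cases p) (auto split: if_splits option.splits simp: swap_equal_entries)

lemma run_resolution: "mrun w xs = Some ys \<Longrightarrow> run (resolution m w) xs = Some ys"
proof (induction w arbitrary: xs)
  case (Cons p w)
  then obtain zs where z: "mstep p xs = Some zs" "mrun w zs = Some ys" by (cases "mstep p xs") auto
  then show ?case using Cons.IH[OF z(2)] run_resolve[OF z(1), of m] by (simp add: run_append)
qed auto

lemma resolve_cases:
  obtains (slice) p' where "\<And>k. resolve m (mshift k p) = [shift k p']" "resolve m p = [p']" "pos p' = mpos p"
    "strands_above p' = mabove p" "strands_below p' = mbelow p"
  | (none) "\<And>k. resolve m (mshift k p) = []" "resolve m p = []" "mabove p = mbelow p"
  by (cases p; cases m) (fastforce split: option.splits)+

text \<open>
  If the mark is filled by parallel strands, a move that involves it becomes trivial, which is why equality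
  is allowed.
\<close>

lemma resolution_marked_move:
  "marked_move u v \<Longrightarrow> resolution m u = resolution m v \<or> move (resolution m u) (resolution m v)"
proof (induction rule: marked_move.induct)
  case (far p r)
  then show ?case
  proof (cases m p rule: resolve_cases)
    case (slice p')
    then show ?thesis
      using move.far[of p'] by (cases m r rule: resolve_cases) auto
  next
    case none
    then show ?thesis by simp
  qed
next
  case (slide i s c)
  show ?case using move.R3[of c _ c i] by (auto split: option.splits)
qed (auto intro: move.intros)

lemma isotopic_refl [simp]: "isotopic w w"
  by (simp add: isotopic_def)

lemma isotopic_sym: "isotopic w w' \<Longrightarrow> isotopic w' w"
  unfolding isotopic_def by (rule equivclp_sym)

lemma isotopic_trans: "isotopic w w' \<Longrightarrow> isotopic w' w'' \<Longrightarrow> isotopic w w''"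
  unfolding isotopic_def by (rule equivclp_trans)

lemma isotopic_resolution:
  "tangle_eq xs u v ys \<Longrightarrow> run p [] = Some xs \<Longrightarrow> run s ys = Some [] \<Longrightarrow>
     isotopic (p @ resolution m u @ s) (p @ resolution m v @ s)"
proof (induction arbitrary: p s rule: tangle_eq.induct)
  case (move u v xs ys)
  have "link_diagram (p @ resolution m u @ s)" "link_diagram (p @ resolution m v @ s)"
    using move run_resolution[of u xs ys m] run_resolution[of v xs ys m]
    by (auto simp: link_diagram_def run_append)
  moreover have "resolution m u = resolution m v \<or> move (resolution m u) (resolution m v)"
    by (rule resolution_marked_move[OF move.hyps(1)])
  ultimately have "p @ resolution m u @ s = p @ resolution m v @ s \<or>
      diagram_move (p @ resolution m u @ s) (p @ resolution m v @ s)"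
    unfolding diagram_move_def by blast
  then show ?case unfolding isotopic_def by (auto intro: r_into_equivclp)
next
  case (compose xs u v ys u' v' zs)
  have "run (resolution m u') ys = Some zs" "run (resolution m v) xs = Some ys"
    using compose.hyps tangle_eq_mrun run_resolution by blast+
  then have "isotopic (p @ resolution m u @ (resolution m u' @ s)) (p @ resolution m v @ (resolution m u' @ s))"
    "isotopic ((p @ resolution m v) @ resolution m u' @ s) ((p @ resolution m v) @ resolution m v' @ s)"
    by (intro compose; simp add: compose.prems run_append)+
  then show ?case by (auto intro: isotopic_trans)
qed (auto intro: isotopic_sym, blast intro: isotopic_trans)

lemma link_of_eq: "isotopic w w' \<Longrightarrow> link_of w = link_of w'"
  unfolding link_of_def by (blast intro: isotopic_sym isotopic_trans)

section \<open>Colourings\<close>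

text \<open>
  Strands are coloured independently of their orientations: a maximum chooses a colour, a minimum requires
  equal colours, and a mark requires different ones.  The predicate \<open>f\<close> says which colourings of the lower level
  are accepted.
\<close>

primrec cstep :: "marked_slice \<Rightarrow> (bool list \<Rightarrow> bool) \<Rightarrow> bool list \<Rightarrow> bool" where
  "cstep (MCap i o') f cs \<longleftrightarrow> (\<exists>b. f (take i cs @ [b, b] @ drop i cs))"
| "cstep (MCup i) f cs \<longleftrightarrow> cs ! i = cs ! Suc i \<and> f (take i cs @ drop (i + 2) cs)"
| "cstep (MCross i s) f cs \<longleftrightarrow> (s = None \<longrightarrow> cs ! i \<noteq> cs ! Suc i) \<and>
     f (take i cs @ [cs ! Suc i, cs ! i] @ drop (i + 2) cs)"

primrec colourable :: "marked_slice list \<Rightarrow> (bool list \<Rightarrow> bool) \<Rightarrow> bool list \<Rightarrow> bool" where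
  "colourable [] f = f"
| "colourable (p # w) f = cstep p (colourable w f)"

lemma colourable_append: "colourable (u @ v) f = colourable u (colourable v f)"
  by (induction u) auto

lemma cstep_left: "cstep (mshift (length l) p) f (l @ cs) = cstep p (\<lambda>z. f (l @ z)) cs"
  by (cases p) (auto simp: nth_append)

lemma colourable_left:
  "colourable (map (mshift (length l)) w) f (l @ cs) = colourable w (\<lambda>z. f (l @ z)) cs"
proof (induction w arbitrary: cs)
  case (Cons p w)
  then show ?case by (simp add: cstep_left)
qed simp

lemma cstep_right: "mpos p + mabove p \<le> length cs \<Longrightarrow> cstep p f (cs @ r) = cstep p (\<lambda>z. f (z @ r)) cs"
  by (cases p) (auto simp: nth_append)

lemma cstep_cong:
  assumes "mpos p + mabove p \<le> length cs"
    and "\<And>z. length z + mabove p = length cs + mbelow p \<Longrightarrow> f z = g z"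
  shows "cstep p f cs = cstep p g cs"
  using assms(1) by (cases p) (auto simp: assms(2))

lemma colourable_cong:
  "mrun w xs = Some ys \<Longrightarrow> length cs = length xs \<Longrightarrow> (\<And>z. length z = length ys \<Longrightarrow> f z = g z) \<Longrightarrow>
    colourable w f cs = colourable w g cs"
proof (induction w arbitrary: xs cs)
  case (Cons p w)
  then obtain zs where z: "mstep p xs = Some zs" "mrun w zs = Some ys" by (cases "mstep p xs") auto
  show ?case using mstep_length[OF z(1)] Cons.prems(2,3)
    by (auto intro!: cstep_cong Cons.IH[OF z(2)])
qed auto

text \<open>
  The colourings of two slices acting on disjoint groups of strands are chosen independently.
\<close>

lemma cstep_commute:
  "cstep p (\<lambda>a. cstep r (\<lambda>b. f a b) y) x = cstep r (\<lambda>b. cstep p (\<lambda>a. f a b) x) y"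
  by (cases p; cases r) auto

lemma split_cs:
  assumes "i + k \<le> length cs"
  shows "\<exists>l m r. cs = l @ m @ r \<and> length l = i \<and> length m = k"
proof (intro exI conjI)
  show "cs = take i cs @ take k (drop i cs) @ drop k (drop i cs)" by (simp only: append_take_drop_id)
qed (use assms in auto)

text \<open>
  Each move connects the same boundary points by strands, and a mark is passed only together with its two
  strands.
\<close>

lemma colourable_marked_move:
  assumes "marked_move u v" "mrun u xs = Some ys" "length cs = length xs"
  shows "colourable u f cs = colourable v f cs"
  using assms(1)
proof (cases rule: marked_move.cases)
  case (far p r)
  let ?k = "mpos p + mabove p" and ?k' = "mpos p + mbelow p"
  obtain zs where "mstep p xs = Some zs" using far assms by (cases "mstep p xs") auto
  then have "?k \<le> length cs" using mstep_length assms(3) by metis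
  then obtain l c where c: "cs = l @ c" "length l = ?k" by (metis append_take_drop_id length_take min.absorb2)
  have "cstep p (cstep (mshift ?k' r) f) (l @ c) = cstep p (\<lambda>z. cstep (mshift ?k' r) f (z @ c)) l"
    using c by (simp add: cstep_right)
  also have "\<dots> = cstep p (\<lambda>z. cstep r (\<lambda>z'. f (z @ z')) c) l"
  proof (rule cstep_cong)
    fix z :: "bool list" assume "length z + mabove p = length l + mbelow p"
    then have "length z = ?k'" using c by simp
    then show "cstep (mshift ?k' r) f (z @ c) = cstep r (\<lambda>z'. f (z @ z')) c"
      using cstep_left[of z] by simp
  qed (simp add: c)
  also have "\<dots> = cstep r (\<lambda>z'. cstep p (\<lambda>z. f (z @ z')) l) c" by (rule cstep_commute)
  also have "\<dots> = cstep r (\<lambda>z'. cstep p f (l @ z')) c" using c by (simp add: cstep_right)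
  also have "\<dots> = cstep (mshift ?k r) (cstep p f) (l @ c)" using cstep_left[of l] c by simp
  finally show ?thesis using far c assms by simp
next
  case (zigzag1 i o')
  then obtain l a r where c: "cs = l @ a # r" "length l = i"
    using assms split_cs[of i 1 cs] by (auto split: if_splits simp: length_Suc_conv)
  show ?thesis using zigzag1 c assms by (auto simp: nth_append)
next
  case (zigzag2 i o')
  then obtain l a r where c: "cs = l @ a # r" "length l = i"
    using assms split_cs[of i 1 cs] by (auto split: if_splits simp: length_Suc_conv)
  show ?thesis using zigzag2 c assms by (auto simp: nth_append)
next
  case (over_cap i o' b)
  then obtain l a r where c: "cs = l @ a # r" "length l = i"
    using assms split_cs[of i 1 cs] by (auto split: if_splits simp: length_Suc_conv)
  show ?thesis using over_cap c assms by (auto simp: nth_append)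
next
  case (over_cup i b)
  have "i + 3 \<le> length cs" using over_cup assms by (auto split: if_splits)
  then obtain l a1 a2 a3 r where c: "cs = l @ a1 # a2 # a3 # r" "length l = i"
    using split_cs[of i 3 cs] by (auto simp: length_Suc_conv eval_nat_numeral)
  show ?thesis using over_cup c assms by (auto simp: nth_append)
next
  case (curl i o' b)
  then obtain l a r where c: "cs = l @ a # r" "length l = i"
    using assms split_cs[of i 1 cs] by (auto split: if_splits simp: length_Suc_conv)
  show ?thesis using curl c assms by (auto simp: nth_append)
next
  case (cancel i b)
  then obtain l a1 a2 r where c: "cs = l @ a1 # a2 # r" "length l = i"
    using assms split_cs[of i 2 cs] by (auto split: if_splits simp: length_Suc_conv eval_nat_numeral)
  show ?thesis using cancel c assms by (auto simp: nth_append)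
next
  case (slide i s b)
  have "i + 3 \<le> length cs" using slide assms by (auto split: if_splits)
  then obtain l a1 a2 a3 r where c: "cs = l @ a1 # a2 # a3 # r" "length l = i"
    using split_cs[of i 3 cs] by (auto simp: length_Suc_conv eval_nat_numeral)
  show ?thesis using slide c assms by (auto simp: nth_append)
qed

lemma colourable_tangle_eq:
  "tangle_eq xs u v ys \<Longrightarrow> length cs = length xs \<Longrightarrow> colourable u f cs = colourable v f cs"
proof (induction arbitrary: f cs rule: tangle_eq.induct)
  case (move u v xs ys)
  then show ?case using colourable_marked_move by blast
next
  case (compose xs u v ys u' v' zs)
  have "colourable u (colourable u' f) cs = colourable u (colourable v' f) cs"
    by (rule colourable_cong) (use tangle_eq_mrun[OF compose.hyps(1)] compose in auto)
  then show ?case using compose by (simp add: colourable_append)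
qed auto

definition marks :: "marked_slice list \<Rightarrow> nat" where
  "marks w = length (filter (\<lambda>p. \<exists>i. p = MCross i None) w)"

lemma marks_append [simp]: "marks (u @ v) = marks u + marks v"
  by (simp add: marks_def)

lemma marks_marked_move: "marked_move u v \<Longrightarrow> marks u = marks v"
proof (induction rule: marked_move.induct)
  case (far p r)
  have "(\<exists>i. mshift k r = MCross i None) \<longleftrightarrow> (\<exists>i. r = MCross i None)" for k by (cases r) auto
  then show ?case by (auto simp: marks_def)
qed (auto simp: marks_def)

lemma marks_tangle_eq: "tangle_eq xs u v ys \<Longrightarrow> marks u = marks v"
  by (induction rule: tangle_eq.induct) (auto simp: marks_marked_move)

primrec embed :: "slice \<Rightarrow> marked_slice" where
  "embed (Cap i o') = MCap i o'"
| "embed (Cup i) = MCup i"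
| "embed (Cross i c) = MCross i (Some c)"

lemma mrun_embed: "mrun (map embed w) xs = run w xs"
proof (induction w arbitrary: xs)
  case (Cons p w)
  have "mstep (embed p) xs = slice_step p xs" by (cases p) auto
  then show ?case using Cons by (simp cong: Option.bind_cong)
qed auto

lemma resolution_embed: "resolution m (map embed w) = w"
proof (induction w)
  case (Cons p w)
  then show ?case by (cases p) auto
qed auto

lemma embed_no_mark: "embed p \<noteq> MCross i None"
  by (cases p) auto

lemma marks_embed: "marks (map embed w) = 0"
  by (auto simp: marks_def embed_no_mark filter_empty_conv)

lemma marks_down_append: "mrun u xs = Some ys \<Longrightarrow> marks_down (u @ v) xs \<longleftrightarrow> marks_down u xs \<and> marks_down v ys"
proof (induction u arbitrary: xs)
  case (Cons p u)
  then show ?case by (cases "mstep p xs") auto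
qed auto

lemma marks_down_embed: "marks_down (map embed w) xs"
  by (induction w arbitrary: xs) (auto simp: embed_no_mark)

section \<open>Conway triples as closed braids\<close>

text \<open>
  The rotated forms of a crossing of strands with orientations \<open>a\<close> and \<open>b\<close>, as found in the previous sections.  The label
  \<open>s\<close>, which may be the mark, always sits between two downward strands.
\<close>

definition rotated :: "bool \<Rightarrow> bool \<Rightarrow> bool option \<Rightarrow> marked_slice list" where
  "rotated a b s = (if a then if b then [MCross 0 s] else [MCap 0 False, MCross 1 s, MCup 2]
     else if b then [MCap 2 True, MCross 1 s, MCup 0]
     else [MCap 0 False, MCap 1 False, MCross 2 s, MCup 3, MCup 2])"

text \<open>
  A quarter turn exchanges the two labels of a crossing; in this normalisation the label \<open>False\<close> is the
  positive crossing for all orientations.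
\<close>

lemma rotated_crossing:
  "tangle_eq [a, b] [crossing 0 (if a = b then c else \<not> c)] (rotated a b (Some c)) [b, a]"
  using rotate_crossing_TF[of "\<not> c"] rotate_crossing_FT[of "\<not> c"] rotate_crossing_FF[of c]
  by (cases a; cases b) (auto simp: rotated_def intro: tangle_eq.identity)

text \<open>
  Removing the crossing from its rotated form leaves, up to zigzags, the oriented smoothing.
\<close>

lemma rotated_smoothing:
  "tangle_eq [a, b] (map embed (smoothing 0 a b)) (map embed (resolution None (rotated a b None))) [b, a]"
proof (cases a; cases b)
  assume "a" "b"
  then show ?thesis by (auto simp: rotated_def smoothing_def intro: tangle_eq.identity)
next
  assume [simp]: "a" "\<not> b"
  have "tangle_eq [True, False] [MCap 0 False, MCup 2] [MCup 0, MCap 0 False] [False, True]"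
    by (rule interchange_at[of "[]" _ "[]" "[True, False]" "[MCap 0 False]" "[False, True]" "[MCup 0]" "[]" "[]"]) simp+
  then show ?thesis by (auto simp: rotated_def smoothing_def intro: tangle_eq.inverse)
next
  assume [simp]: "\<not> a" "b"
  have "tangle_eq [False, True] [MCup 0, MCap 0 True] [MCap 2 True, MCup 0] [True, False]"
    by (rule interchange_at[of "[]" _ "[False, True]" "[]" "[MCup 0]" "[]" "[MCap 0 True]" "[True, False]" "[]"]) simp+
  then show ?thesis by (auto simp: rotated_def smoothing_def)
next
  assume [simp]: "\<not> a" "\<not> b"
  have 1: "tangle_eq [False, False] [MCap 0 False, MCap 1 False, MCup 3, MCup 2] [MCap 0 False, MCup 1, MCap 1 False, MCup 2] [False, False]"
    by (rule interchange_at[of "[MCap 0 False]" _ "[False]" "[True, False, False]" "[MCap 1 False]" "[False, False, True]" "[MCup 0]" "[False]" "[MCup 2]"]) simp+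
  have 2: "tangle_eq [False, False] [MCap 0 False, MCup 1, MCap 1 False, MCup 2] [MCap 1 False, MCup 2] [False, False]"
    by (rule tangle_eq_at[OF marked_move.zigzag1[of 0 False], where p="[]" and s="[MCap 1 False, MCup 2]"]) simp+
  have 3: "tangle_eq [False, False] [MCap 1 False, MCup 2] [] [False, False]"
    by (rule tangle_eq_at[OF marked_move.zigzag1[of 1 False], where p="[]" and s="[]"]) simp+
  show ?thesis using tangle_eq.inverse[OF tangle_eq.chain[OF 1 tangle_eq.chain[OF 2 3]]] by (simp add: rotated_def smoothing_def)
qed

lemma rotated_run: "mrun (rotated a b None) [a, b] = Some [b, a]"
  by (simp add: rotated_def)

lemma rotated_marks: "marks (map (mshift i) (rotated a b None)) = 1"
  by (simp add: rotated_def marks_def)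

lemma rotated_marks_down: "length l = i \<Longrightarrow> marks_down (map (mshift i) (rotated a b None)) (l @ a # b # r)"
  by (auto simp: rotated_def nth_append)

lemma rotated_colourable: "colourable (rotated a b None) f (x # y # cs) \<longleftrightarrow> x \<noteq> y \<and> f (y # x # cs)"
  by (auto simp: rotated_def)

lemma rotated_resolution: "resolution m (map (mshift i) (rotated a b None)) =
    (case m of None \<Rightarrow> map (shift i) (resolution None (rotated a b None)) | Some c \<Rightarrow> resolution None (map (mshift i) (rotated a b (Some c))))"
  by (auto simp: rotated_def split: option.splits)

lemma embed_shift: "map (mshift i) (map embed w) = map embed (map (shift i) w)"
proof (induction w)
  case (Cons p w)
  then show ?case by (cases p) auto
qed auto

definition level_colour :: "diagram \<Rightarrow> nat \<times> nat \<Rightarrow> nat \<Rightarrow> nat \<Rightarrow> bool list" where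
  "level_colour w P k n = map (\<lambda>j. same_component w P (k, j)) [0..<n]"

lemma same_component_arc: "strand_arc w Q R \<Longrightarrow> same_component w P Q = same_component w P R"
  unfolding same_component_def by (meson equivclp_sym equivclp_trans r_into_equivclp)

lemma upt_insert2: "i \<le> n \<Longrightarrow> [0..<Suc (Suc n)] = [0..<i] @ [i, Suc i] @ map (\<lambda>j. j + 2) [i..<n]"
proof -
  assume "i \<le> n"
  then have "[0..<Suc (Suc n)] = [0..<i] @ [i..<n + 2]"
    using upt_add_eq_append[of 0 i "n + 2 - i"] by (simp del: upt_Suc)
  also have "[i..<n + 2] = [i, Suc i] @ [i + 2..<n + 2]"
    using \<open>i \<le> n\<close> by (simp add: upt_conv_Cons)
  finally show ?thesis by (simp add: comp_def del: upt_Suc flip: map_Suc_upt)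
qed

lemma cstep_level_colour:
  assumes k: "k < length w" and X: "slice_step (w ! k) xs = Some ys"
    and f: "f (level_colour w P (Suc k) (length ys))"
  shows "cstep (embed (w ! k)) f (level_colour w P k (length xs))"
proof -
  let ?c = "\<lambda>k j. same_component w P (k, j)"
  have l: "?c k j = ?c (Suc k) j" if "j < pos (w ! k)" for j
    by (rule same_component_arc[OF strand_arc.left_of[OF k that]])
  have r: "?c k (pos (w ! k) + strands_above (w ! k) + m) = ?c (Suc k) (pos (w ! k) + strands_below (w ! k) + m)" for m
    by (rule same_component_arc[OF strand_arc.right_of[OF k]])
  show ?thesis
  proof (cases "w ! k")
    case (Cap i o')
    let ?cs = "level_colour w P k (length xs)" and ?b = "?c (Suc k) i"
    have i: "i \<le> length xs" "length ys = length xs + 2" using X Cap by (auto split: if_splits)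
    have "?c (Suc k) i = ?c (Suc k) (Suc i)"
      by (rule same_component_arc[OF strand_arc.cap[OF k Cap]])
    moreover have "?c k j = ?c (Suc k) (j + 2)" if "\<not> j < i" for j
      using r[of "j - i"] that Cap by (simp add: add.commute)
    ultimately have e: "take i ?cs @ [?b, ?b] @ drop i ?cs = level_colour w P (Suc k) (length ys)"
      using i(1) l Cap
      by (simp add: level_colour_def upt_insert2[OF i(1)] i(2) take_map drop_map del: upt_Suc)
    show ?thesis unfolding Cap embed.simps cstep.simps
      by (rule exI[of _ ?b]) (use f e in simp)
  next
    case (Cup i)
    let ?cs = "level_colour w P k (length xs)"
    have i: "Suc i < length xs" "length ys = length xs - 2" using X Cup by (auto split: if_splits)
    then have n: "i \<le> length ys" "length xs = Suc (Suc (length ys))" by auto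
    have "?c k i = ?c k (Suc i)"
      by (rule same_component_arc[OF strand_arc.cup[OF k Cup]])
    moreover have "?c k (j + 2) = ?c (Suc k) j" if "\<not> j < i" for j
      using r[of "j - i"] that Cup by (simp add: add.commute)
    ultimately have "take i ?cs @ drop (i + 2) ?cs = level_colour w P (Suc k) (length ys)"
      using l Cup upt_add_eq_append[of 0 i "length ys - i"] n
      by (simp add: level_colour_def upt_insert2[of i "length ys"] take_map drop_map del: upt_Suc)
    then show ?thesis using f \<open>?c k i = ?c k (Suc i)\<close> i by (auto simp: Cup level_colour_def)
  next
    case (Cross i b)
    let ?cs = "level_colour w P k (length xs)"
    have i: "Suc i < length xs" "length ys = length xs" using X Cross by (auto split: if_splits)
    define n where "n = length xs - 2"
    have n: "i \<le> n" "length xs = Suc (Suc n)" using i by (auto simp: n_def)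
    have "?c k i = ?c (Suc k) (Suc i)" "?c k (Suc i) = ?c (Suc k) i"
      by (rule same_component_arc[OF strand_arc.cross1[OF k Cross]] same_component_arc[OF strand_arc.cross2[OF k Cross]])+
    moreover have "?c k (j + 2) = ?c (Suc k) (j + 2)" if "\<not> j < i" for j
      using r[of "j - i"] that Cross by (simp add: add.commute)
    ultimately have "take i ?cs @ [?cs ! Suc i, ?cs ! i] @ drop (i + 2) ?cs = level_colour w P (Suc k) (length ys)"
      using l Cross i(2)
      by (simp add: level_colour_def n(2) upt_insert2[OF n(1)] nth_append del: upt_Suc)
    then show ?thesis using f by (auto simp: Cross)
  qed
qed

lemma colourable_level_colour:
  "w = p @ u @ s \<Longrightarrow> run p [] = Some xs \<Longrightarrow> run u xs = Some ys \<Longrightarrow>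
     f (level_colour w P (length (p @ u)) (length ys)) \<Longrightarrow>
     colourable (map embed u) f (level_colour w P (length p) (length xs))"
proof (induction u arbitrary: p xs)
  case (Cons q u)
  then obtain zs where z: "slice_step q xs = Some zs" "run u zs = Some ys" by (cases "slice_step q xs") auto
  have "colourable (map embed u) f (level_colour w P (length (p @ [q])) (length zs))"
    by (rule Cons.IH[of "p @ [q]"]) (use Cons.prems z in \<open>auto simp: run_append\<close>)
  then show ?case using cstep_level_colour[of "length p" w xs zs "colourable (map embed u) f" P] Cons.prems(1) z(1)
    by simp
qed simp

lemma split_at_crossing:
  assumes "Suc i < length xs"
  shows "xs = take i xs @ [xs ! i, xs ! Suc i] @ drop (i + 2) xs"
proof -
  have "drop i xs = xs ! i # drop (Suc i) xs" "drop (Suc i) xs = xs ! Suc i # drop (Suc (Suc i)) xs"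
    using assms by (simp_all add: Cons_nth_drop_Suc)
  then have "take i xs @ drop i xs = take i xs @ [xs ! i, xs ! Suc i] @ drop (i + 2) xs" by simp
  then show ?thesis unfolding append_take_drop_id .
qed

lemma isotopic_locally:
  assumes "tangle_eq xs u v ys" "run p [] = Some as" "as = l @ xs @ r" "length l = i"
    and "run s (l @ ys @ r) = Some []"
  shows "isotopic (p @ resolution m (map (mshift i) u) @ s) (p @ resolution m (map (mshift i) v) @ s)"
  using isotopic_resolution[OF tangle_eq_context[OF assms(1,4), of r] _ assms(5)] assms(2,3) by simp

text \<open>
  The crossing is replaced by its rotated form with a mark.  The colouring is that by the component of the left
  strand of the crossing: by hypothesis the right strand is coloured differently.
\<close>

lemma conway_marked:
  assumes "conway_diagrams x i y Dp Dm D0"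
    and "\<not> same_component Dp (length x, i) (length x, Suc i)"
  obtains w where "mrun w [] = Some []" "marks_down w []" "marks w = 1"
    "colourable w (\<lambda>_. True) []"
    "isotopic Dp (resolution (Some False) w)" "isotopic Dm (resolution (Some True) w)"
    "isotopic D0 (resolution None w)"
proof -
  obtain xs c where xs: "run x [] = Some xs" "Suc i < length xs"
    and pos: "positive_crossing (xs ! i) (xs ! Suc i) c"
    and D: "Dp = x @ [Cross i c] @ y" "Dm = x @ [Cross i (\<not> c)] @ y"
      "D0 = x @ smoothing i (xs ! i) (xs ! Suc i) @ y"
    and Dp: "link_diagram Dp"
    using assms(1) by (auto simp: conway_diagrams_def)
  define a b l r where "a = xs ! i" and "b = xs ! Suc i" and "l = take i xs" and "r = drop (i + 2) xs"
  have l: "length l = i" using xs(2) by (simp add: l_def)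
  have xs': "xs = l @ [a, b] @ r"
    unfolding l_def a_def b_def r_def by (rule split_at_crossing[OF xs(2)])
  have c: "crossing 0 (if a = b then s else \<not> s) = crossing 0 (if s then \<not> c else c)" for s
    using pos unfolding positive_crossing_def a_def[symmetric] b_def[symmetric]
    by (cases "a = b"; cases s) simp_all
  have y: "run y (l @ [b, a] @ r) = Some []"
  proof -
    have "slice_step (Cross i c) xs = Some (l @ [b, a] @ r)"
      using xs(2) by (simp add: a_def b_def l_def r_def)
    then show ?thesis using Dp by (simp add: link_diagram_def D run_append xs(1))
  qed
  let ?g = "map (mshift i) (rotated a b None)"
  let ?w = "map embed x @ ?g @ map embed y"
  have res: "resolution m ?w = x @ resolution m ?g @ y" for m
    using resolution_embed[of m x] resolution_embed[of m y] by simp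
  have g: "mrun ?g xs = Some (l @ [b, a] @ r)"
    using mrun_left[of l "rotated a b None" "[a, b] @ r"] mrun_right[OF rotated_run[of a b], of r] l by (simp add: xs')
  have 1: "mrun ?w [] = Some []" by (simp add: mrun_append mrun_embed xs(1) g) (use y in simp)
  have 2: "marks_down ?w []"
    using xs(1) g rotated_marks_down[OF l, of a b r]
    by (simp add: marks_down_append[of _ _ xs] mrun_embed marks_down_embed marks_down_append[OF g]) (simp add: xs')
  have 3: "marks ?w = 1" by (simp add: marks_embed rotated_marks)
  have 4: "isotopic (x @ [Cross i (if s then \<not> c else c)] @ y) (resolution (Some s) ?w)" for s
    using isotopic_locally[OF rotated_crossing[of a b s, unfolded c] xs(1) xs' l y, of None]
    unfolding res rotated_resolution[of "Some s"] by simp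
  have "isotopic (x @ smoothing i a b @ y) (resolution None ?w)"
    using isotopic_locally[OF rotated_smoothing[of a b] xs(1) xs' l y, of None]
    unfolding embed_shift resolution_embed res rotated_resolution by (simp add: smoothing_def split: if_splits)
  then have 5: "isotopic D0 (resolution None ?w)" by (simp add: D a_def b_def)
  have 6: "colourable ?w (\<lambda>_. True) []"
  proof -
    let ?P = "(length x, i)"
    define L where "L k = level_colour Dp ?P k" for k
    have len: "length xs = length (l @ [b, a] @ r)" by (simp add: xs')
    let ?f = "colourable (map embed y) (\<lambda>_. True)"
    have s: "slice_step (Cross i c) xs = Some (l @ [b, a] @ r)"
      using xs(2) by (simp add: a_def b_def l_def r_def)
    have f: "?f (L (Suc (length x)) (length xs))"
      using colourable_level_colour[of Dp "x @ [Cross i c]" y "[]" "l @ [b, a] @ r" "[]" "\<lambda>_. True" ?P] y xs(1) s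
      by (simp add: D run_append L_def len)
    let ?cs = "L (length x) (length xs)"
    have "cstep (embed (Dp ! length x)) (\<lambda>z. z = L (Suc (length x)) (length xs)) ?cs"
      unfolding L_def
      by (rule cstep_level_colour[where ys="l @ [b, a] @ r"]) (use s len in \<open>simp_all add: D\<close>)
    then have e: "take i ?cs @ [?cs ! Suc i, ?cs ! i] @ drop (i + 2) ?cs = L (Suc (length x)) (length xs)"
      by (simp add: D)
    have n: "?cs ! i \<noteq> ?cs ! Suc i"
      using assms(2) xs(2) by (simp add: L_def level_colour_def) (simp add: same_component_def)
    have lc: "length ?cs = length xs" by (simp add: L_def level_colour_def)
    have cs: "?cs = take i ?cs @ [?cs ! i, ?cs ! Suc i] @ drop (i + 2) ?cs"
      by (rule split_at_crossing) (simp add: lc xs(2))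
    have li: "length (take i ?cs) = i" using xs(2) lc by simp
    have "colourable ?g ?f (take i ?cs @ ?cs ! i # ?cs ! Suc i # drop (i + 2) ?cs)"
      unfolding colourable_left[of "take i ?cs", unfolded li] rotated_colourable using n f e by simp
    then have "colourable ?g ?f ?cs" using cs by (simp only: append.simps)
    then show ?thesis
      using colourable_level_colour[of Dp "[]" x "[Cross i c] @ y" "[]" xs "colourable ?g ?f" ?P] xs(1)
      by (simp add: D L_def colourable_append level_colour_def)
  qed
  show ?thesis using that[OF 1 2 3 6 _ _ 5] 4[of False] 4[of True] by (simp add: D)
qed

primrec letter_of :: "marked_slice \<Rightarrow> braid_letter" where
  "letter_of (MCross i s) = (if s = Some True then Sig_inv (Suc i) else Sig (Suc i))"
| "letter_of (MCap i o') = Sig i"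
| "letter_of (MCup i) = Sig i"

text \<open>
  The position at the bottom of the strand that starts at position \<open>k\<close> at the top.
\<close>

fun braid_perm :: "braid_letter list \<Rightarrow> nat \<Rightarrow> nat" where
  "braid_perm [] k = k"
| "braid_perm (l # \<alpha>) k = braid_perm \<alpha> (transpose (letter_index l) (Suc (letter_index l)) k)"

lemma braid_perm_append: "braid_perm (\<alpha> @ \<beta>) k = braid_perm \<beta> (braid_perm \<alpha> k)"
  by (induction \<alpha> arbitrary: k) auto

lemma braid_perm_permutes: "\<alpha> \<in> braid_words n \<Longrightarrow> braid_perm \<alpha> permutes {1..n}"
proof (induction \<alpha>)
  case Nil
  have "braid_perm [] = id" by auto
  then show ?case by (simp only: permutes_id)
next
  case (Cons l \<alpha>)
  have e: "braid_perm (l # \<alpha>) = braid_perm \<alpha> \<circ> transpose (letter_index l) (Suc (letter_index l))" by auto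
  have "transpose (letter_index l) (Suc (letter_index l)) permutes {1..n}"
    using Cons.prems by (intro permutes_swap_id) (auto simp: braid_words_def)
  moreover have "braid_perm \<alpha> permutes {1..n}" using Cons by (auto simp: braid_words_def)
  ultimately show ?case unfolding e by (rule permutes_compose)
qed

lemma letters_in_braid_words: "braid_slices n \<beta> \<Longrightarrow> map letter_of \<beta> \<in> braid_words n"
  by (fastforce simp: braid_slices_def braid_words_def)

lemma resolution_braid_slices:
  "braid_slices n \<beta> \<Longrightarrow> marks \<beta> = 0 \<Longrightarrow> resolution m \<beta> = map letter_crossing (map letter_of \<beta>)"
  by (induction \<beta>) (auto simp: braid_slices_def marks_def split: if_splits option.splits)

lemma resolution_closure:
  "resolution m (nested_caps n @ \<beta> @ nested_cups n 0) = map (\<lambda>i. Cap i True) [0..<n] @ resolution m \<beta> @ map Cup (rev [0..<n])"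
proof -
  have "resolution m (map MCup xs) = map Cup xs" "resolution m (map (\<lambda>i. MCap i True) xs) = map (\<lambda>i. Cap i True) xs" for xs
    by (induction xs) auto
  then show ?thesis by (simp add: nested_caps_def nested_cups_def del: map_map)
qed

lemma single_mark:
  "marks w = 1 \<Longrightarrow> \<exists>u j v. w = u @ MCross j None # v \<and> marks u = 0 \<and> marks v = 0"
proof (induction w)
  case (Cons p w)
  show ?case
  proof (cases "\<exists>j. p = MCross j None")
    case True
    then have "marks w = 0" using Cons.prems by (auto simp: marks_def)
    then show ?thesis using True by (intro exI[of _ "[]"]) (auto simp: marks_def)
  next
    case False
    then have "marks w = 1" using Cons.prems by (auto simp: marks_def)
    then obtain u j v where "w = u @ MCross j None # v" "marks u = 0" "marks v = 0" using Cons.IH by blast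
    then show ?thesis using False by (intro exI[of _ "p # u"]) (auto simp: marks_def)
  qed
qed (simp add: marks_def)

lemma colourable_nested_caps: "colourable (nested_caps n @ w) f [] \<Longrightarrow> \<exists>cs. length cs = n \<and> colourable w f (cs @ rev cs)"
proof (induction n arbitrary: w)
  case (Suc n)
  then obtain cs where "length cs = n" "colourable (MCap n True # w) f (cs @ rev cs)"
    by (fastforce simp: nested_caps_Suc)
  then obtain b where "length (cs @ [b]) = Suc n" "colourable w f ((cs @ [b]) @ rev (cs @ [b]))" by auto
  then show ?case by blast
qed (simp add: nested_caps_def)

lemma colourable_nested_cups: "length ds = length cs \<Longrightarrow> colourable (nested_cups (length cs) 0) f (ds @ rev cs) \<Longrightarrow> ds = cs"
proof (induction cs arbitrary: ds rule: rev_induct)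
  case (snoc c cs)
  obtain es e where ds: "ds = es @ [e]" "length es = length cs"
    using snoc.prems(1) by (metis length_Suc_conv_rev length_append_singleton)
  then show ?case using snoc by (auto simp: nested_cups_def nth_append)
qed simp

lemma nth_swap:
  assumes "Suc i < length cs" "m < length cs"
  shows "(take i cs @ [cs ! Suc i, cs ! i] @ drop (i + 2) cs) ! transpose i (Suc i) m = cs ! m"
proof -
  obtain l a b r where c: "cs = l @ [a, b] @ r" "length l = i"
    using split_at_crossing[OF assms(1)] assms(1) by (metis length_take min.absorb4 Suc_lessD)
  consider "m < i" | "m = i" | "m = Suc i" | t where "m = Suc (Suc i) + t"
    by (metis less_iff_Suc_add linorder_neqE_nat add_Suc not_less_eq)
  then show ?thesis by cases (simp_all add: c nth_append transpose_def)
qed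

lemma colourable_braid_slices:
  "braid_slices n \<beta> \<Longrightarrow> marks \<beta> = 0 \<Longrightarrow> length cs = n \<Longrightarrow> colourable \<beta> f (cs @ r) \<Longrightarrow>
    \<exists>ds. length ds = n \<and> f (ds @ r) \<and>
      (\<forall>k. 1 \<le> k \<and> k \<le> n \<longrightarrow> ds ! (braid_perm (map letter_of \<beta>) k - 1) = cs ! (k - 1))"
proof (induction \<beta> arbitrary: cs)
  case (Cons p \<beta>)
  obtain i s where p: "p = MCross i s" "Suc i < n" using Cons.prems(1) by (auto simp: braid_slices_def)
  let ?cs = "take i cs @ [cs ! Suc i, cs ! i] @ drop (i + 2) cs"
  have len: "length ?cs = n" using Cons.prems(3) p by simp
  have "colourable \<beta> f (?cs @ r)" using Cons.prems(3,4) p by (simp add: nth_append)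
  then obtain ds where ds: "length ds = n" "f (ds @ r)"
    "\<And>k. 1 \<le> k \<Longrightarrow> k \<le> n \<Longrightarrow> ds ! (braid_perm (map letter_of \<beta>) k - 1) = ?cs ! (k - 1)"
    using Cons.IH[OF _ _ len] Cons.prems by (auto simp: braid_slices_def marks_def split: if_splits)
  let ?t = "transpose (Suc i) (Suc (Suc i))"
  have "ds ! (braid_perm (map letter_of \<beta>) (?t k) - 1) = cs ! (k - 1)" if "1 \<le> k" "k \<le> n" for k
  proof -
    have "ds ! (braid_perm (map letter_of \<beta>) (?t k) - 1) = ?cs ! (?t k - 1)"
      using that p(2) by (intro ds) (auto simp: transpose_def)
    also have "?t k - 1 = transpose i (Suc i) (k - 1)"
      using that by (auto simp: transpose_def)
    also have "?cs ! transpose i (Suc i) (k - 1) = cs ! (k - 1)"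
      using that p(2) Cons.prems(3) by (intro nth_swap) auto
    finally show ?thesis .
  qed
  then show ?case using ds(1,2) p by (intro exI[of _ ds]) auto
qed auto

text \<open>
  The colour is constant along the orbit of \<open>x\<close> under \<open>p\<close>, except that the first step goes to the colour of \<open>y\<close>.  If the
  orbit did not meet \<open>y\<close>, it would come back to \<open>x\<close> with the colour of \<open>y\<close>.
\<close>

lemma orbit_reaches:
  assumes "p permutes A" "finite A" "x \<in> A"
    and "\<And>k. k \<in> A \<Longrightarrow> c (p k) = c (transpose x y k)" and "c x \<noteq> c y"
  shows "\<exists>r. (p ^^ r) x = y"
proof (rule ccontr)
  assume no: "\<not> ?thesis"
  have "permutation p" using assms(1,2) by (auto simp: permutation_permutes)
  then have ret: "\<exists>r>0. (p ^^ r) x = x"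
    using least_power_of_permutation[of p x] by blast
  define r where "r = (LEAST r. r > 0 \<and> (p ^^ r) x = x)"
  have r: "r > 0" "(p ^^ r) x = x" using LeastI_ex[OF ret] by (auto simp: r_def)
  have least: "(p ^^ s) x \<noteq> x" if "0 < s" "s < r" for s
    using not_less_Least[of s "\<lambda>r. r > 0 \<and> (p ^^ r) x = x"] that by (auto simp: r_def)
  have A: "(p ^^ s) x \<in> A" for s
    by (induction s) (use assms(3) permutes_in_image[OF assms(1)] in auto)
  have "c ((p ^^ Suc s) x) = c y" if "s < r" for s
    using that
  proof (induction s)
    case 0
    then show ?case using assms(4)[OF assms(3)] by simp
  next
    case (Suc s)
    have "(p ^^ Suc s) x \<noteq> x" "(p ^^ Suc s) x \<noteq> y" using least[of "Suc s"] Suc.prems no by (simp, blast)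
    then show ?case using assms(4)[OF A[of "Suc s"]] Suc by (simp add: transpose_def)
  qed
  from this[of "r - 1"] r assms(5) show False by simp
qed

text \<open>
  The colours are read off at the level just above the mark.  Going once around the closure, they are
  permuted by the mark and by the braid \<open>v @ u\<close>, which gives the assumption of \<open>orbit_reaches\<close>.
\<close>

lemma closure_colouring:
  assumes \<beta>: "braid_slices n (u @ MCross j None # v)" "marks u = 0" "marks v = 0"
    and col: "colourable (nested_caps n @ (u @ MCross j None # v) @ nested_cups n 0) (\<lambda>_. True) []"
  shows "\<exists>r. (braid_perm (map letter_of (v @ u)) ^^ r) (Suc j) = Suc (Suc j)"
proof -
  have u: "braid_slices n u" and v: "braid_slices n v" and j: "Suc j < n" using \<beta>(1) by (auto simp: braid_slices_def)
  obtain cs where cs: "length cs = n" "colourable (u @ MCross j None # v @ nested_cups n 0) (\<lambda>_. True) (cs @ rev cs)"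
    using colourable_nested_caps[OF col] by auto
  let ?pu = "braid_perm (map letter_of u)" and ?pv = "braid_perm (map letter_of v)"
  obtain ds where ds: "length ds = n" "colourable (MCross j None # v @ nested_cups n 0) (\<lambda>_. True) (ds @ rev cs)"
      "\<And>k. 1 \<le> k \<Longrightarrow> k \<le> n \<Longrightarrow> ds ! (?pu k - 1) = cs ! (k - 1)"
    using colourable_braid_slices[OF u \<beta>(2) cs(1) cs(2)[unfolded colourable_append]] by blast
  let ?ds = "take j ds @ [ds ! Suc j, ds ! j] @ drop (j + 2) ds"
  have "colourable (v @ nested_cups n 0) (\<lambda>_. True) (?ds @ rev cs)" and ne: "ds ! j \<noteq> ds ! Suc j"
    using ds(1) ds(2)[unfolded colourable.simps cstep.simps] j by (auto simp: nth_append)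
  moreover have "length ?ds = n" using ds(1) j by simp
  ultimately obtain es where es: "length es = n" "colourable (nested_cups n 0) (\<lambda>_. True) (es @ rev cs)"
      "\<And>k. 1 \<le> k \<Longrightarrow> k \<le> n \<Longrightarrow> es ! (?pv k - 1) = ?ds ! (k - 1)"
    using colourable_braid_slices[OF v \<beta>(3) _ _] unfolding colourable_append by blast
  have "es = cs" using colourable_nested_cups[of es cs] es(1,2) cs(1) by simp
  let ?c = "\<lambda>k. ds ! (k - 1)" and ?p = "braid_perm (map letter_of (v @ u))"
  have "braid_slices n (v @ u)" using u v by (auto simp: braid_slices_def)
  then have p: "?p permutes {1..n}" by (rule braid_perm_permutes[OF letters_in_braid_words])
  have pv: "?pv permutes {1..n}" by (rule braid_perm_permutes[OF letters_in_braid_words[OF v]])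
  have "?c (?p k) = ?c (transpose (Suc j) (Suc (Suc j)) k)" if k: "k \<in> {1..n}" for k
  proof -
    have "?pv k \<in> {1..n}" using pv k by (simp only: permutes_in_image)
    then have "?c (?p k) = cs ! (?pv k - 1)" using ds(3) by (simp add: braid_perm_append)
    also have "\<dots> = ?ds ! (k - 1)" using es(3) k \<open>es = cs\<close> by simp
    also have "\<dots> = ?ds ! transpose j (Suc j) (transpose j (Suc j) (k - 1))" by simp
    also have "\<dots> = ds ! transpose j (Suc j) (k - 1)"
      using k j ds(1) by (intro nth_swap) (auto simp: transpose_def)
    also have "transpose j (Suc j) (k - 1) = transpose (Suc j) (Suc (Suc j)) k - 1"
      using k by (auto simp: transpose_def)
    finally show ?thesis .
  qed
  then show ?thesis
    using ne j by (intro orbit_reaches[OF p, of _ ?c]) auto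
qed

text \<open>
  The moves preserve the number of marks.  Hence the braid obtained from a diagram with one mark still has
  exactly one, and the three fillings of it are the three closed braids.
\<close>

theorem conway_triple_braids:
  assumes "conway_triple_distinct_components Lp Lm L0"
  obtains n i \<alpha> \<beta> where "1 \<le> i" "i < n" "\<alpha> \<in> braid_words n" "\<beta> \<in> braid_words n"
    "\<exists>r. (braid_perm (\<beta> @ \<alpha>) ^^ r) i = Suc i"
    "Lp = link_of (braid_closure n (\<alpha> @ Sig i # \<beta>))"
    "Lm = link_of (braid_closure n (\<alpha> @ Sig_inv i # \<beta>))"
    "L0 = link_of (braid_closure n (\<alpha> @ \<beta>))"
proof -
  obtain x i y Dp Dm D0 where D: "conway_diagrams x i y Dp Dm D0"
      "\<not> same_component Dp (length x, i) (length x, Suc i)"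
    and L: "Lp = link_of Dp" "Lm = link_of Dm" "L0 = link_of D0"
    using assms by (auto simp: conway_triple_distinct_components_def)
  obtain w where w: "mrun w [] = Some []" "marks_down w []" "marks w = 1" "colourable w (\<lambda>_. True) []"
    "isotopic Dp (resolution (Some False) w)" "isotopic Dm (resolution (Some True) w)"
    "isotopic D0 (resolution None w)"
    using conway_marked[OF D] by blast
  obtain n \<gamma> where g: "braid_slices n \<gamma>" "tangle_eq [] w (nested_caps n @ \<gamma> @ nested_cups n 0) []"
    using alexander[OF w(1,2)] by blast
  have "marks (nested_caps n) = 0" "marks (nested_cups n 0) = 0"
    by (auto simp: marks_def nested_caps_def nested_cups_def filter_empty_conv)
  then have "marks \<gamma> = 1" using marks_tangle_eq[OF g(2)] w(3) by simp
  then obtain u j v where \<gamma>: "\<gamma> = u @ MCross j None # v" "marks u = 0" "marks v = 0"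
    using single_mark by blast
  have u: "braid_slices n u" and v: "braid_slices n v" and j: "Suc j < n" using g(1) by (auto simp: braid_slices_def \<gamma>)
  let ?\<alpha> = "map letter_of u" and ?\<beta> = "map letter_of v"
  have iso: "isotopic (resolution m w) (resolution m (nested_caps n @ \<gamma> @ nested_cups n 0))" for m
    using isotopic_resolution[OF g(2), of "[]" "[]" m] by simp
  have res: "resolution m (nested_caps n @ \<gamma> @ nested_cups n 0) =
      map (\<lambda>i. Cap i True) [0..<n] @ (map letter_crossing ?\<alpha> @ resolve m (MCross j None) @ map letter_crossing ?\<beta>)
        @ map Cup (rev [0..<n])" for m
    unfolding resolution_closure \<gamma>(1) using resolution_braid_slices[OF u \<gamma>(2)] resolution_braid_slices[OF v \<gamma>(3)] by simp
  have link: "link_of D = link_of (resolution m (nested_caps n @ \<gamma> @ nested_cups n 0))" if "isotopic D (resolution m w)" for D m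
    using isotopic_trans[OF that iso] by (rule link_of_eq)
  show ?thesis
  proof (rule that)
    show "1 \<le> Suc j" "Suc j < n" using j by auto
    show "?\<alpha> \<in> braid_words n" "?\<beta> \<in> braid_words n" using u v by (auto intro: letters_in_braid_words)
    show "\<exists>r. (braid_perm (?\<beta> @ ?\<alpha>) ^^ r) (Suc j) = Suc (Suc j)"
      using closure_colouring[of n u j v] g \<gamma> colourable_tangle_eq[OF g(2), of "[]"] w(4) by auto
    show "Lp = link_of (braid_closure n (?\<alpha> @ Sig (Suc j) # ?\<beta>))"
      unfolding L link[OF w(5)] res by (simp add: braid_closure_def)
    show "Lm = link_of (braid_closure n (?\<alpha> @ Sig_inv (Suc j) # ?\<beta>))"
      unfolding L link[OF w(6)] res by (simp add: braid_closure_def)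
    show "L0 = link_of (braid_closure n (?\<alpha> @ ?\<beta>))"
      unfolding L link[OF w(7)] res by (simp add: braid_closure_def)
  qed
qed

section \<open>Calculating modulo the Yokonuma--Hecke relations\<close>

lemma update_add_single: "a \<notin> Poly_Mapping.keys f \<Longrightarrow> Poly_Mapping.update a b f = f + Poly_Mapping.single a b"
  by (rule poly_mapping_eqI) (auto simp: lookup_add lookup_update lookup_single when_def in_keys_iff)

lemma scalar_central: "scalar c * p = p * scalar c"
proof (induction p rule: update_induct)
  case (update f a b)
  then show ?case
    by (simp add: update_add_single distrib_left distrib_right scalar_def mult_single mult.commute)
qed simp

lemma scalar_left_commute: "p * (scalar c * r) = scalar c * (p * r)"
  unfolding mult.assoc[symmetric] scalar_central[of c p] by (rule HOL.refl)

lemma scalar_simps: "scalar 0 = 0" "scalar 1 = 1"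
  by (simp_all add: scalar_def)

context
  fixes n :: nat
begin

text \<open>
  Calculations are carried out with elements of the free algebra, where the ring operations of the type are
  available, and not with their classes.
\<close>

abbreviation Free where "Free \<equiv> carrier (yh_free_ring n)"

lemma Free_iff: "p \<in> Free \<longleftrightarrow> (\<forall>w\<in>Poly_Mapping.keys p. set (letters w) \<subseteq> yh_gens n)"
  by (simp add: yh_free_ring_def)

lemma Free_simps [simp]: "x \<otimes>\<^bsub>yh_free_ring n\<^esub> y = x * y" "x \<oplus>\<^bsub>yh_free_ring n\<^esub> y = x + y"
   "\<one>\<^bsub>yh_free_ring n\<^esub> = 1" "\<zero>\<^bsub>yh_free_ring n\<^esub> = 0"
  by (simp_all add: yh_free_ring_def)

lemma Free_add: "p \<in> Free \<Longrightarrow> p' \<in> Free \<Longrightarrow> p + p' \<in> Free"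
  using keys_add[of p p'] by (auto simp: Free_iff)

lemma Free_minus: "p \<in> Free \<Longrightarrow> - p \<in> Free"
  by (auto simp: Free_iff in_keys_iff)

lemma Free_diff: "p \<in> Free \<Longrightarrow> p' \<in> Free \<Longrightarrow> p - p' \<in> Free"
  using Free_add[of p "- p'"] Free_minus[of p'] by simp

lemma Free_mult: "p \<in> Free \<Longrightarrow> p' \<in> Free \<Longrightarrow> p * p' \<in> Free"
  using keys_mult[of p p'] unfolding Free_iff by (fastforce simp: plus_free_monoid_def)

lemma Free_scalar: "scalar c \<in> Free"
  by (simp add: Free_iff scalar_def zero_free_monoid_def)

lemma Free_0: "0 \<in> Free" and Free_1: "1 \<in> Free"
  using Free_scalar[of 0] Free_scalar[of 1] by (simp_all add: scalar_simps)

lemma Free_power: "p \<in> Free \<Longrightarrow> p ^ k \<in> Free"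
  by (induction k) (auto intro: Free_mult Free_1)

lemma Free_sum: "(\<And>x. x \<in> U \<Longrightarrow> f x \<in> Free) \<Longrightarrow> sum f U \<in> Free"
  by (induction U rule: infinite_finite_induct) (auto intro: Free_0 Free_add)

lemma Free_g: "1 \<le> i \<Longrightarrow> i < n \<Longrightarrow> gen_g i \<in> Free"
  by (auto simp: Free_iff gen_g_def yh_gens_def)

lemma Free_t: "1 \<le> j \<Longrightarrow> j \<le> n \<Longrightarrow> gen_t j \<in> Free"
  by (auto simp: Free_iff gen_t_def yh_gens_def)

lemma Free_e: "1 \<le> i \<Longrightarrow> i < n \<Longrightarrow> idem_e d i \<in> Free"
  unfolding idem_e_def by (intro Free_mult Free_scalar Free_sum Free_power Free_t) auto

lemmas Free_intros = Free_add Free_diff Free_mult Free_scalar Free_0 Free_1 Free_power Free_sum Free_g Free_t Free_e Free_g[simplified] Free_t[simplified]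

lemma ring_Free: "ring (yh_free_ring n)"
proof (rule ringI)
  show "abelian_group (yh_free_ring n)"
  proof (rule abelian_groupI)
    show "\<exists>y\<in>Free. y \<oplus>\<^bsub>yh_free_ring n\<^esub> x = \<zero>\<^bsub>yh_free_ring n\<^esub>" if "x \<in> Free" for x
      using Free_minus[OF that] by (intro bexI[of _ "- x"]) auto
  qed (auto intro: Free_intros simp: algebra_simps)
  show "Group.monoid (yh_free_ring n)"
    by (rule monoidI) (auto intro: Free_intros simp: algebra_simps)
qed (auto simp: algebra_simps)

end

context
  fixes d n :: nat and q :: complex
  assumes d: "d \<ge> 1"
begin

abbreviation FreeR where "FreeR \<equiv> yh_free_ring n"
abbreviation Rel where "Rel \<equiv> yh_ideal d q n"
abbreviation Yok where "Yok \<equiv> YH d q n"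
abbreviation cls where "cls \<equiv> yh_class d q n"

lemma relators_Free: "yh_relators d q n \<subseteq> Free n"
proof
  fix x assume "x \<in> yh_relators d q n"
  then show "x \<in> Free n"
  proof cases
    case (tg i j)
    have "1 \<le> transpose i (Suc i) j \<and> transpose i (Suc i) j \<le> n"
      using tg by (auto simp: transpose_def)
    then show ?thesis unfolding tg(1) using tg by (intro Free_intros) auto
  qed (auto intro!: Free_intros)
qed

lemma ideal_Rel: "ideal Rel FreeR"
  unfolding yh_ideal_def by (rule ring.genideal_ideal[OF ring_Free relators_Free])

lemma ring_Yok: "ring Yok"
  unfolding YH_def by (rule ideal.quotient_is_ring[OF ideal_Rel])

lemma cls_hom: "cls \<in> ring_hom FreeR Yok"
proof -
  have "cls = (+>\<^bsub>FreeR\<^esub>) Rel" by (auto simp: yh_class_def)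
  then show ?thesis unfolding YH_def using ideal.rcos_ring_hom[OF ideal_Rel] by simp
qed

lemma cls_closed: "p \<in> Free n \<Longrightarrow> cls p \<in> carrier Yok"
  by (rule ring_hom_closed[OF cls_hom])

lemma cls_mult: "p \<in> Free n \<Longrightarrow> p' \<in> Free n \<Longrightarrow> cls (p * p') = cls p \<otimes>\<^bsub>Yok\<^esub> cls p'"
  using ring_hom_mult[OF cls_hom, of p p'] by simp

lemma cls_add: "p \<in> Free n \<Longrightarrow> p' \<in> Free n \<Longrightarrow> cls (p + p') = cls p \<oplus>\<^bsub>Yok\<^esub> cls p'"
  using ring_hom_add[OF cls_hom, of p p'] by simp

lemma cls_one: "cls 1 = \<one>\<^bsub>Yok\<^esub>"
  using ring_hom_one[OF cls_hom] by simp

definition eqv :: "yh_free \<Rightarrow> yh_free \<Rightarrow> bool" (infix "\<approx>" 50) where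
  "p \<approx> p' \<longleftrightarrow> p \<in> Free n \<and> p' \<in> Free n \<and> cls p = cls p'"

lemma eqv_refl: "p \<in> Free n \<Longrightarrow> p \<approx> p"
  and eqv_sym: "p \<approx> p' \<Longrightarrow> p' \<approx> p"
  and eqv_trans [trans]: "p \<approx> p' \<Longrightarrow> p' \<approx> p'' \<Longrightarrow> p \<approx> p''"
  and eqv_A: "p \<approx> p' \<Longrightarrow> p \<in> Free n" "p \<approx> p' \<Longrightarrow> p' \<in> Free n"
  by (auto simp: eqv_def)

lemma eqv_add: "p \<approx> p' \<Longrightarrow> r \<approx> r' \<Longrightarrow> p + r \<approx> p' + r'"
  by (auto simp: eqv_def cls_add intro: Free_intros)

lemma eqv_mult: "p \<approx> p' \<Longrightarrow> r \<approx> r' \<Longrightarrow> p * r \<approx> p' * r'"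
  by (auto simp: eqv_def cls_mult intro: Free_intros)

lemma eqv_left: "r \<approx> r' \<Longrightarrow> p \<in> Free n \<Longrightarrow> p * r \<approx> p * r'"
  by (rule eqv_mult[OF eqv_refl])

lemma eqv_right: "r \<approx> r' \<Longrightarrow> p \<in> Free n \<Longrightarrow> r * p \<approx> r' * p"
  by (rule eqv_mult[OF _ eqv_refl])

lemma eqv_sum: "(\<And>x. x \<in> U \<Longrightarrow> f x \<approx> g x) \<Longrightarrow> sum f U \<approx> sum g U"
  by (induction U rule: infinite_finite_induct) (auto intro: eqv_add eqv_refl Free_0)

lemma eqv_relator:
  assumes "p - p' \<in> yh_relators d q n" "p \<in> Free n" "p' \<in> Free n"
  shows "p \<approx> p'"
proof -
  interpret ideal Rel FreeR by (rule ideal_Rel)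
  have "p - p' \<in> Rel"
    using assms(1) ring.genideal_self[OF ring_Free relators_Free] by (auto simp: yh_ideal_def)
  then have "p \<in> Rel +>\<^bsub>FreeR\<^esub> p'"
    by (force simp: a_r_coset_def r_coset_def)
  then have "Rel +>\<^bsub>FreeR\<^esub> p' = Rel +>\<^bsub>FreeR\<^esub> p"
    by (rule a_repr_independence'[OF _ assms(3)])
  then show ?thesis using assms by (simp add: eqv_def yh_class_def)
qed

lemma t_commute: "1 \<le> i \<Longrightarrow> i \<le> n \<Longrightarrow> 1 \<le> j \<Longrightarrow> j \<le> n \<Longrightarrow> gen_t i * gen_t j \<approx> gen_t j * gen_t i"
  by (rule eqv_relator[OF yh_relators.tt]) (auto intro: Free_intros)

lemma t_power_d: "1 \<le> j \<Longrightarrow> j \<le> n \<Longrightarrow> gen_t j ^ d \<approx> 1"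
  by (rule eqv_relator[OF yh_relators.tpower]) (auto intro: Free_intros)

abbreviation sw where "sw i \<equiv> transpose i (Suc i)"

lemma sw_range: "1 \<le> i \<Longrightarrow> i < n \<Longrightarrow> 1 \<le> j \<Longrightarrow> j \<le> n \<Longrightarrow> 1 \<le> sw i j \<and> sw i j \<le> n"
  by (auto simp: transpose_def)

lemma gen_t_gen_g: "1 \<le> i \<Longrightarrow> i < n \<Longrightarrow> 1 \<le> j \<Longrightarrow> j \<le> n \<Longrightarrow> gen_t j * gen_g i \<approx> gen_g i * gen_t (sw i j)"
  using sw_range[of i j] by (intro eqv_relator[OF yh_relators.tg]) (auto intro!: Free_intros)

lemma gen_g_square: "1 \<le> i \<Longrightarrow> i < n \<Longrightarrow>
   gen_g i * gen_g i \<approx> 1 + scalar (q - inverse q) * (idem_e d i * gen_g i)"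
  by (rule eqv_relator[OF yh_relators.quadratic]) (auto intro!: Free_intros)

lemma commute_power:
  assumes "x * y \<approx> y * x" "x \<in> Free n" "y \<in> Free n"
  shows "x ^ k * y \<approx> y * x ^ k"
proof (induction k)
  case 0
  then show ?case using assms by (auto intro: eqv_refl)
next
  case (Suc k)
  have "x * (x ^ k * y) \<approx> x * (y * x ^ k)" by (rule eqv_left[OF Suc assms(2)])
  also have "\<dots> = (x * y) * x ^ k" by (simp add: mult.assoc)
  also have "\<dots> \<approx> (y * x) * x ^ k" by (intro eqv_right assms Free_power)
  finally show ?case by (simp add: mult.assoc)
qed

lemma t_power_commute:
  assumes "1 \<le> i" "i \<le> n" "1 \<le> j" "j \<le> n"
  shows "gen_t i ^ a * gen_t j ^ b \<approx> gen_t j ^ b * gen_t i ^ a"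
  by (intro commute_power eqv_sym[OF commute_power] t_commute Free_intros assms)

lemma t_power_g:
  assumes "1 \<le> i" "i < n" "1 \<le> j" "j \<le> n"
  shows "gen_t j ^ a * gen_g i \<approx> gen_g i * gen_t (sw i j) ^ a"
proof (induction a)
  case 0
  then show ?case using assms by (auto intro: eqv_refl Free_intros)
next
  case (Suc a)
  note s = sw_range[OF assms]
  have "gen_t j * (gen_t j ^ a * gen_g i) \<approx> gen_t j * (gen_g i * gen_t (sw i j) ^ a)"
    by (intro eqv_left[OF Suc] Free_intros assms)
  also have "\<dots> = (gen_t j * gen_g i) * gen_t (sw i j) ^ a" by (simp add: mult.assoc)
  also have "\<dots> \<approx> (gen_g i * gen_t (sw i j)) * gen_t (sw i j) ^ a"
    using s by (intro eqv_right[OF gen_t_gen_g] Free_intros assms) auto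
  finally show ?case by (simp add: mult.assoc)
qed

text \<open>
  Exchanging the two generators reverses the order of summation; the summands for \<open>s = 0\<close> and \<open>s = d\<close> agree because
  both are \<open>1\<close>.
\<close>

lemma idem_flip:
  assumes "1 \<le> i" "i < n"
  shows "(\<Sum>s<d. gen_t (Suc i) ^ s * gen_t i ^ (d - s)) \<approx> (\<Sum>s<d. gen_t i ^ s * gen_t (Suc i) ^ (d - s))"
proof -
  have split: "sum f {..<d} = f 0 + sum f {1..<d}" for f :: "nat \<Rightarrow> yh_free"
    using d sum.atLeast_Suc_lessThan[of 0 d f] by (simp add: atLeast0LessThan)
  have "(\<Sum>s\<in>{1..<d}. gen_t (Suc i) ^ s * gen_t i ^ (d - s)) \<approx> (\<Sum>s\<in>{1..<d}. gen_t i ^ (d - s) * gen_t (Suc i) ^ s)"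
    using assms by (intro eqv_sum t_power_commute) auto
  also have "(\<Sum>s\<in>{1..<d}. gen_t i ^ (d - s) * gen_t (Suc i) ^ s) = (\<Sum>s\<in>{1..<d}. gen_t i ^ s * gen_t (Suc i) ^ (d - s))"
    by (rule sum.reindex_bij_witness[of _ "\<lambda>s. d - s" "\<lambda>s. d - s"]) auto
  finally have 1: "(\<Sum>s\<in>{1..<d}. gen_t (Suc i) ^ s * gen_t i ^ (d - s)) \<approx> (\<Sum>s\<in>{1..<d}. gen_t i ^ s * gen_t (Suc i) ^ (d - s))" .
  have "gen_t i ^ d \<approx> 1" "gen_t (Suc i) ^ d \<approx> 1" using assms by (auto intro: t_power_d)
  then have 0: "gen_t i ^ d \<approx> gen_t (Suc i) ^ d" by (blast intro: eqv_trans eqv_sym)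
  show ?thesis unfolding split by (rule eqv_add[OF _ 1]) (simp add: 0)
qed

lemma idem_gen_g:
  assumes "1 \<le> i" "i < n"
  shows "idem_e d i * gen_g i \<approx> gen_g i * idem_e d i"
proof -
  let ?E = "\<Sum>s<d. gen_t i ^ s * gen_t (Suc i) ^ (d - s)"
  have i: "1 \<le> i" "i \<le> n" "1 \<le> Suc i" "Suc i \<le> n" using assms by auto
  have "?E * gen_g i \<approx> gen_g i * (\<Sum>s<d. gen_t (Suc i) ^ s * gen_t i ^ (d - s))"
    unfolding sum_distrib_left sum_distrib_right
  proof (rule eqv_sum)
    fix s
    have "gen_t i ^ s * (gen_t (Suc i) ^ (d - s) * gen_g i) \<approx> gen_t i ^ s * (gen_g i * gen_t i ^ (d - s))"
      using t_power_g[OF assms i(3,4), of "d - s"] by (intro eqv_left Free_intros i) simp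
    also have "\<dots> = (gen_t i ^ s * gen_g i) * gen_t i ^ (d - s)" by (simp add: mult.assoc)
    also have "\<dots> \<approx> (gen_g i * gen_t (Suc i) ^ s) * gen_t i ^ (d - s)"
      using t_power_g[OF assms i(1,2), of s] by (intro eqv_right Free_intros i) simp
    finally show "gen_t i ^ s * gen_t (Suc i) ^ (d - s) * gen_g i \<approx> gen_g i * (gen_t (Suc i) ^ s * gen_t i ^ (d - s))"
      by (simp add: mult.assoc)
  qed
  also have "\<dots> \<approx> gen_g i * ?E" by (rule eqv_left[OF idem_flip[OF assms] Free_g[OF assms]])
  finally have "scalar (1 / of_nat d) * (?E * gen_g i) \<approx> scalar (1 / of_nat d) * (gen_g i * ?E)"
    by (rule eqv_left[OF _ Free_scalar])
  also have "\<dots> = gen_g i * idem_e d i"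
    unfolding idem_e_def scalar_left_commute by (rule HOL.refl)
  finally show ?thesis by (simp add: idem_e_def mult.assoc)
qed

text \<open>
  The inverse of \<open>g\<^sub>i\<close> according to the quadratic relation.  It is an inverse on both sides because \<open>e\<^sub>i\<close>
  commutes with \<open>g\<^sub>i\<close>.
\<close>

definition ginv :: "nat \<Rightarrow> yh_free" where
  "ginv i = gen_g i - scalar (q - inverse q) * idem_e d i"

lemma Free_ginv: "1 \<le> i \<Longrightarrow> i < n \<Longrightarrow> ginv i \<in> Free n"
  unfolding ginv_def by (intro Free_intros)

lemma gen_g_ginv:
  assumes "1 \<le> i" "i < n"
  shows "ginv i * gen_g i \<approx> 1" "gen_g i * ginv i \<approx> 1"
proof -
  let ?c = "scalar (q - inverse q)"
  have m: "- (?c * (idem_e d i * gen_g i)) \<in> Free n" by (intro Free_minus Free_intros assms)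
  have "ginv i * gen_g i = gen_g i * gen_g i + - (?c * (idem_e d i * gen_g i))"
    by (simp add: ginv_def algebra_simps)
  also have "\<dots> \<approx> (1 + ?c * (idem_e d i * gen_g i)) + - (?c * (idem_e d i * gen_g i))"
    by (intro eqv_add gen_g_square eqv_refl m assms)
  finally show 1: "ginv i * gen_g i \<approx> 1" by simp
  have "?c * (idem_e d i * gen_g i) \<approx> ?c * (gen_g i * idem_e d i)"
    by (rule eqv_left[OF idem_gen_g[OF assms] Free_scalar])
  then have e: "scalar (-1) * (?c * (gen_g i * idem_e d i)) \<approx> scalar (-1) * (?c * (idem_e d i * gen_g i))"
    by (rule eqv_left[OF eqv_sym Free_scalar])
  have neg: "scalar (-1) * x = - x" for x by (simp add: scalar_def single_uminus)
  have "gen_g i * ginv i = gen_g i * gen_g i + scalar (-1) * (?c * (gen_g i * idem_e d i))"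
    unfolding neg by (simp add: ginv_def right_diff_distrib scalar_left_commute)
  also have "\<dots> \<approx> (1 + ?c * (idem_e d i * gen_g i)) + scalar (-1) * (?c * (idem_e d i * gen_g i))"
    by (intro eqv_add gen_g_square e assms)
  finally show "gen_g i * ginv i \<approx> 1" unfolding neg by simp
qed

lemma inv_gen_g: "1 \<le> i \<Longrightarrow> i < n \<Longrightarrow> inv\<^bsub>Yok\<^esub> (cls (gen_g i)) = cls (ginv i)"
proof -
  assume i: "1 \<le> i" "i < n"
  interpret Yok: ring Yok by (rule ring_Yok)
  have "cls (gen_g i) \<otimes>\<^bsub>Yok\<^esub> cls (ginv i) = \<one>\<^bsub>Yok\<^esub>" "cls (ginv i) \<otimes>\<^bsub>Yok\<^esub> cls (gen_g i) = \<one>\<^bsub>Yok\<^esub>"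
    using gen_g_ginv[OF i] cls_mult[OF Free_g[OF i] Free_ginv[OF i]] cls_mult[OF Free_ginv[OF i] Free_g[OF i]]
    by (simp_all add: eqv_def cls_one)
  then show ?thesis
    by (intro Yok.inv_char cls_closed Free_g Free_ginv i)
qed

text \<open>
  Obtained from \<open>gen_t_gen_g\<close> by multiplying with the inverse from both sides.
\<close>

lemma gen_t_ginv:
  assumes "1 \<le> i" "i < n" "1 \<le> j" "j \<le> n"
  shows "gen_t j * ginv i \<approx> ginv i * gen_t (sw i j)"
proof -
  let ?k = "sw i j"
  have k: "1 \<le> ?k" "?k \<le> n" using sw_range[OF assms] by auto
  note Free = Free_intros Free_ginv assms k
  have "gen_t j * ginv i = 1 * (gen_t j * ginv i)" by simp
  also have "\<dots> \<approx> (ginv i * gen_g i) * (gen_t j * ginv i)"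
    by (intro eqv_right[OF eqv_sym[OF gen_g_ginv(1)]] Free)
  also have "\<dots> = ginv i * ((gen_g i * gen_t j) * ginv i)" by (simp add: mult.assoc)
  also have "\<dots> \<approx> ginv i * ((gen_t ?k * gen_g i) * ginv i)"
    using eqv_sym[OF gen_t_gen_g[OF assms(1,2) k]] by (intro eqv_left eqv_right Free) simp
  also have "\<dots> = (ginv i * gen_t ?k) * (gen_g i * ginv i)" by (simp add: mult.assoc)
  also have "\<dots> \<approx> (ginv i * gen_t ?k) * 1"
    by (intro eqv_left[OF gen_g_ginv(2)] Free)
  finally show ?thesis by simp
qed

primrec letter_poly :: "braid_letter \<Rightarrow> yh_free" where
  "letter_poly (Sig i) = gen_g i"
| "letter_poly (Sig_inv i) = ginv i"

abbreviation word_poly :: "braid_letter list \<Rightarrow> yh_free" where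
  "word_poly \<alpha> \<equiv> prod_list (map letter_poly \<alpha>)"

lemma Free_letter: "1 \<le> letter_index l \<Longrightarrow> letter_index l < n \<Longrightarrow> letter_poly l \<in> Free n"
  by (cases l) (auto intro: Free_intros Free_ginv)

lemma Free_word: "\<alpha> \<in> braid_words n \<Longrightarrow> word_poly \<alpha> \<in> Free n"
  by (induction \<alpha>) (auto simp: braid_words_def intro!: Free_intros Free_letter)

lemma yh_braid_word: "\<alpha> \<in> braid_words n \<Longrightarrow> yh_braid d q n \<alpha> = cls (word_poly \<alpha>)"
proof (induction \<alpha>)
  case Nil
  then show ?case by (simp add: yh_braid_def cls_one)
next
  case (Cons l \<alpha>)
  then have l: "1 \<le> letter_index l" "letter_index l < n" and a: "\<alpha> \<in> braid_words n" by (auto simp: braid_words_def)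
  have "yh_letter d q n l = cls (letter_poly l)" using l by (cases l) (auto simp: yh_letter_def inv_gen_g)
  then show ?case using Cons.IH[OF a] cls_mult[OF Free_letter[OF l] Free_word[OF a]] by (simp add: yh_braid_def)
qed

text \<open>
  A framing generator is pushed along its strand through the whole braid.
\<close>

lemma t_word:
  "\<alpha> \<in> braid_words n \<Longrightarrow> 1 \<le> j \<Longrightarrow> j \<le> n \<Longrightarrow>
    1 \<le> braid_perm \<alpha> j \<and> braid_perm \<alpha> j \<le> n \<and> gen_t j * word_poly \<alpha> \<approx> word_poly \<alpha> * gen_t (braid_perm \<alpha> j)"
proof (induction \<alpha> arbitrary: j)
  case Nil
  then show ?case by (auto intro: eqv_refl Free_intros)
next
  case (Cons l \<alpha>)
  then have l: "1 \<le> letter_index l" "letter_index l < n" and a: "\<alpha> \<in> braid_words n" by (auto simp: braid_words_def)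
  let ?k = "sw (letter_index l) j"
  have k: "1 \<le> ?k" "?k \<le> n" using sw_range[OF l Cons.prems(2,3)] by auto
  note IH = Cons.IH[OF a k]
  have "gen_t j * letter_poly l \<approx> letter_poly l * gen_t ?k"
    using l Cons.prems by (cases l) (auto intro: gen_t_gen_g gen_t_ginv)
  then have "(gen_t j * letter_poly l) * word_poly \<alpha> \<approx> (letter_poly l * gen_t ?k) * word_poly \<alpha>"
    by (rule eqv_right[OF _ Free_word[OF a]])
  also have "\<dots> = letter_poly l * (gen_t ?k * word_poly \<alpha>)" by (simp add: mult.assoc)
  also have "\<dots> \<approx> letter_poly l * (word_poly \<alpha> * gen_t (braid_perm \<alpha> ?k))"
    using IH by (intro eqv_left[OF _ Free_letter[OF l]]) simp
  finally show ?case using IH by (simp add: mult.assoc)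
qed

section \<open>The trace\<close>

context
  fixes tr :: "nat \<Rightarrow> yh_free set \<Rightarrow> complex poly"
  assumes tr: "is_trace d q tr"
begin

abbreviation \<tau> where "\<tau> p \<equiv> tr n (cls p)"

lemma tau_eqv: "p \<approx> p' \<Longrightarrow> \<tau> p = \<tau> p'"
  by (simp add: eqv_def)

lemma tau_add: "p \<in> Free n \<Longrightarrow> p' \<in> Free n \<Longrightarrow> \<tau> (p + p') = \<tau> p + \<tau> p'"
proof -
  assume p: "p \<in> Free n" "p' \<in> Free n"
  have "tr n (cls p \<oplus>\<^bsub>Yok\<^esub> cls p') = \<tau> p + \<tau> p'"
    using tr cls_closed[OF p(1)] cls_closed[OF p(2)] unfolding is_trace_def by blast
  then show ?thesis by (simp add: cls_add p)
qed

lemma tau_scalar: "p \<in> Free n \<Longrightarrow> \<tau> (scalar c * p) = smult c (\<tau> p)"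
proof -
  assume p: "p \<in> Free n"
  have "tr n (cls (scalar c) \<otimes>\<^bsub>Yok\<^esub> cls p) = smult c (\<tau> p)"
    using tr cls_closed[OF p] unfolding is_trace_def by blast
  then show ?thesis by (simp add: cls_mult p Free_scalar)
qed

lemma tau_commute: "p \<in> Free n \<Longrightarrow> p' \<in> Free n \<Longrightarrow> \<tau> (p * p') = \<tau> (p' * p)"
proof -
  assume p: "p \<in> Free n" "p' \<in> Free n"
  have "tr n (cls p \<otimes>\<^bsub>Yok\<^esub> cls p') = tr n (cls p' \<otimes>\<^bsub>Yok\<^esub> cls p)"
    using tr cls_closed[OF p(1)] cls_closed[OF p(2)] unfolding is_trace_def by blast
  then show ?thesis by (simp only: cls_mult p)
qed

lemma tau_sum: "(\<And>x. x \<in> U \<Longrightarrow> f x \<in> Free n) \<Longrightarrow> \<tau> (sum f U) = (\<Sum>x\<in>U. \<tau> (f x))"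
proof -
  have 0: "\<tau> 0 = 0" using tau_scalar[OF Free_0, of 0] by simp
  show "(\<And>x. x \<in> U \<Longrightarrow> f x \<in> Free n) \<Longrightarrow> ?thesis"
    by (induction U rule: infinite_finite_induct) (auto simp: 0 tau_add Free_sum)
qed

text \<open>
  The generator leaves the braid at the top and, by the trace property, enters again at the bottom.
\<close>

lemma tau_slide:
  assumes "\<gamma> \<in> braid_words n" "1 \<le> j" "j \<le> n" "x \<in> Free n" "gen_t j * x \<approx> x * gen_t j"
  shows "\<tau> (word_poly \<gamma> * (gen_t (braid_perm \<gamma> j) * x)) = \<tau> (word_poly \<gamma> * (gen_t j * x))"
proof -
  note w = t_word[OF assms(1-3)]
  note Free = Free_intros Free_word assms
  have "word_poly \<gamma> * gen_t (braid_perm \<gamma> j) * x \<approx> gen_t j * word_poly \<gamma> * x"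
    using w by (intro eqv_right[OF eqv_sym] Free) simp
  then have "\<tau> (word_poly \<gamma> * (gen_t (braid_perm \<gamma> j) * x)) = \<tau> (gen_t j * (word_poly \<gamma> * x))"
    by (simp add: tau_eqv mult.assoc)
  also have "\<dots> = \<tau> ((word_poly \<gamma> * x) * gen_t j)" by (intro tau_commute Free)
  also have "\<dots> = \<tau> (word_poly \<gamma> * (x * gen_t j))" by (simp add: mult.assoc)
  also have "\<dots> = \<tau> (word_poly \<gamma> * (gen_t j * x))"
    by (intro tau_eqv eqv_left[OF eqv_sym[OF assms(5)]] Free)
  finally show ?thesis .
qed

lemma tau_slide_orbit:
  assumes "\<gamma> \<in> braid_words n" "1 \<le> j" "j \<le> n" "x \<in> Free n" "\<And>k. 1 \<le> k \<Longrightarrow> k \<le> n \<Longrightarrow> gen_t k * x \<approx> x * gen_t k"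
  shows "1 \<le> (braid_perm \<gamma> ^^ r) j \<and> (braid_perm \<gamma> ^^ r) j \<le> n \<and>
     \<tau> (word_poly \<gamma> * (gen_t ((braid_perm \<gamma> ^^ r) j) * x)) = \<tau> (word_poly \<gamma> * (gen_t j * x))"
proof (induction r)
  case (Suc r)
  then show ?case
    using t_word[OF assms(1), of "(braid_perm \<gamma> ^^ r) j"] tau_slide[OF assms(1) _ _ assms(4) assms(5), of "(braid_perm \<gamma> ^^ r) j"]
    by simp
qed (use assms in auto)

text \<open>
  The factors \<open>t\<^sub>k\<close> are turned into \<open>t\<^sub>j\<close> one at a time, the remaining powers playing the part of \<open>x\<close> in
  \<open>tau_slide_orbit\<close>.
\<close>

lemma tau_slide_power:
  assumes "\<gamma> \<in> braid_words n" "1 \<le> j" "j \<le> n" "(braid_perm \<gamma> ^^ r) j = k"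
  shows "\<tau> (word_poly \<gamma> * (gen_t j ^ a * gen_t k ^ b)) = \<tau> (word_poly \<gamma> * gen_t j ^ (a + b))"
proof (induction b arbitrary: a)
  case (Suc b)
  have "gen_t l * 1 \<approx> 1 * gen_t l" if "1 \<le> l" "l \<le> n" for l
    using that by (auto intro: eqv_refl Free_intros)
  from tau_slide_orbit[OF assms(1-3) Free_1 this, of r] assms(4)
  have k: "1 \<le> k" "k \<le> n" by simp_all
  note Free = Free_intros Free_word assms(1-3) k
  let ?x = "gen_t j ^ a * gen_t k ^ b"
  have c: "gen_t l * ?x \<approx> ?x * gen_t l" if l: "1 \<le> l" "l \<le> n" for l
  proof -
    have "(gen_t l * gen_t j ^ a) * gen_t k ^ b \<approx> (gen_t j ^ a * gen_t l) * gen_t k ^ b"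
      using t_power_commute[OF l assms(2,3), of 1 a] by (intro eqv_right Free) simp
    also have "\<dots> = gen_t j ^ a * (gen_t l * gen_t k ^ b)" by (simp add: mult.assoc)
    also have "\<dots> \<approx> gen_t j ^ a * (gen_t k ^ b * gen_t l)"
      using t_power_commute[OF l k, of 1 b] by (intro eqv_left Free) simp
    finally show ?thesis by (simp add: mult.assoc)
  qed
  have "word_poly \<gamma> * (gen_t j ^ a * gen_t k ^ Suc b) = word_poly \<gamma> * (?x * gen_t k)"
    by (simp add: mult.assoc power_commutes)
  also have "\<tau> \<dots> = \<tau> (word_poly \<gamma> * (gen_t k * ?x))"
    by (intro tau_eqv eqv_left[OF eqv_sym[OF c]] Free)
  also have "\<dots> = \<tau> (word_poly \<gamma> * (gen_t j * ?x))"
    using tau_slide_orbit[OF assms(1-3) _ c, of r] assms(4) Free_mult[OF Free_power[OF Free_t] Free_power[OF Free_t], of j n k a b] k assms by simp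
  also have "\<dots> = \<tau> (word_poly \<gamma> * (gen_t j ^ Suc a * gen_t k ^ b))" by (simp add: mult.assoc)
  also have "\<dots> = \<tau> (word_poly \<gamma> * gen_t j ^ (a + Suc b))" using Suc[of "Suc a"] by simp
  finally show ?case .
qed simp

text \<open>
  All \<open>d\<close> summands of \<open>e\<^sub>i\<close> contribute \<open>t\<^sub>i\<^sup>d = 1\<close>.
\<close>

lemma tau_idem:
  assumes "\<gamma> \<in> braid_words n" "1 \<le> i" "i < n" "(braid_perm \<gamma> ^^ r) i = Suc i"
  shows "\<tau> (word_poly \<gamma> * idem_e d i) = \<tau> (word_poly \<gamma>)"
proof -
  note Free = Free_intros Free_word assms(1-3)
  have m: "word_poly \<gamma> * (gen_t i ^ s * gen_t (Suc i) ^ (d - s)) \<in> Free n" for s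
    using assms by (intro Free_intros Free_word) auto
  have "word_poly \<gamma> * idem_e d i = scalar (1 / of_nat d) * (\<Sum>s<d. word_poly \<gamma> * (gen_t i ^ s * gen_t (Suc i) ^ (d - s)))"
    unfolding idem_e_def sum_distrib_left[symmetric] scalar_left_commute by (rule HOL.refl)
  also have "\<tau> \<dots> = smult (1 / of_nat d) (\<Sum>s<d. \<tau> (word_poly \<gamma> * (gen_t i ^ s * gen_t (Suc i) ^ (d - s))))"
    using m by (simp add: tau_scalar tau_sum Free_sum)
  also have "\<dots> = smult (1 / of_nat d) (\<Sum>s<d. \<tau> (word_poly \<gamma>))"
  proof (intro arg_cong2[of _ _ _ _ smult] HOL.refl sum.cong)
    fix s assume "s \<in> {..<d}"
    then have "\<tau> (word_poly \<gamma> * (gen_t i ^ s * gen_t (Suc i) ^ (d - s))) = \<tau> (word_poly \<gamma> * gen_t i ^ d)"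
      using tau_slide_power[OF assms(1,2) _ assms(4), of s "d - s"] assms(3) by simp
    also have "\<dots> = \<tau> (word_poly \<gamma> * 1)"
      using assms by (intro tau_eqv eqv_left[OF t_power_d Free_word]) auto
    finally show "\<tau> (word_poly \<gamma> * (gen_t i ^ s * gen_t (Suc i) ^ (d - s))) = \<tau> (word_poly \<gamma>)" by simp
  qed
  also have "\<dots> = \<tau> (word_poly \<gamma>)" using d by (simp add: of_nat_poly)
  finally show ?thesis .
qed

lemma tau_skein:
  assumes "\<alpha> \<in> braid_words n" "\<beta> \<in> braid_words n" "1 \<le> i" "i < n" "(braid_perm (\<beta> @ \<alpha>) ^^ r) i = Suc i"
  shows "\<tau> (word_poly (\<alpha> @ Sig i # \<beta>)) = \<tau> (word_poly (\<alpha> @ Sig_inv i # \<beta>)) + smult (q - inverse q) (\<tau> (word_poly (\<alpha> @ \<beta>)))"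
proof -
  let ?a = "word_poly \<alpha>" and ?b = "word_poly \<beta>" and ?c = "q - inverse q"
  note Free = Free_intros Free_word Free_ginv assms(1-4)
  have ba: "\<beta> @ \<alpha> \<in> braid_words n" using assms by (auto simp: braid_words_def)
  have "word_poly (\<alpha> @ Sig i # \<beta>) = word_poly (\<alpha> @ Sig_inv i # \<beta>) + ?a * (scalar ?c * idem_e d i * ?b)"
    by (simp add: ginv_def algebra_simps)
  also have "?a * (scalar ?c * idem_e d i * ?b) = scalar ?c * (?a * idem_e d i * ?b)"
    by (simp add: mult.assoc scalar_left_commute)
  also have "\<tau> (word_poly (\<alpha> @ Sig_inv i # \<beta>) + scalar ?c * (?a * idem_e d i * ?b)) =
     \<tau> (word_poly (\<alpha> @ Sig_inv i # \<beta>)) + smult ?c (\<tau> (?a * idem_e d i * ?b))"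
  proof -
    have "?a * idem_e d i * ?b \<in> Free n" by (intro Free)
    moreover have "word_poly (\<alpha> @ Sig_inv i # \<beta>) \<in> Free n" by (simp, intro Free)
    ultimately show ?thesis by (simp only: tau_add tau_scalar Free_mult Free_scalar)
  qed
  also have "\<tau> (?a * idem_e d i * ?b) = \<tau> (?b * (?a * idem_e d i))"
    by (intro tau_commute Free)
  also have "\<dots> = \<tau> (word_poly (\<beta> @ \<alpha>) * idem_e d i)" by (simp add: mult.assoc)
  also have "\<dots> = \<tau> (word_poly (\<beta> @ \<alpha>))" by (rule tau_idem[OF ba assms(3,4,5)])
  also have "\<dots> = \<tau> (word_poly (\<alpha> @ \<beta>))" using tau_commute[OF Free_word[OF assms(1)] Free_word[OF assms(2)]] by simp
  finally show ?thesis .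
qed

end

end

lemma trace_skein:
  assumes "d \<ge> 1" "is_trace d q tr" "\<alpha> \<in> braid_words n" "\<beta> \<in> braid_words n" "1 \<le> i" "i < n"
    and "\<exists>r. (braid_perm (\<beta> @ \<alpha>) ^^ r) i = Suc i"
  shows "tr n (yh_braid d q n (\<alpha> @ Sig i # \<beta>)) =
    tr n (yh_braid d q n (\<alpha> @ Sig_inv i # \<beta>)) + smult (q - inverse q) (tr n (yh_braid d q n (\<alpha> @ \<beta>)))"
proof -
  have "\<alpha> @ Sig i # \<beta> \<in> braid_words n" "\<alpha> @ Sig_inv i # \<beta> \<in> braid_words n" "\<alpha> @ \<beta> \<in> braid_words n"
    using assms(3-6) by (auto simp: braid_words_def)
  then show ?thesis using tau_skein[OF assms(1-6)] assms(7) by (auto simp: yh_braid_word[OF assms(1)])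
qed

lemma of_poly_add: "of_poly (p + r) = of_poly p + of_poly r"
  by (simp add: of_poly_def flip: to_ac_add)

lemma of_poly_mult: "of_poly (p * r) = of_poly p * of_poly r"
  by (simp add: of_poly_def flip: to_ac_mult)

lemma of_poly_smult: "of_poly (smult c p) = of_poly [:c:] * of_poly p"
  by (simp flip: of_poly_mult)

lemma of_poly_eq_iff: "of_poly p = of_poly r \<longleftrightarrow> p = r"
  by (simp add: of_poly_def eq_fract)

text \<open>
  The element \<open>z\<close> is transcendental and hence different from the constant \<open>(q - q\<^sup>-\<^sup>1)/d\<close>.
\<close>

lemma lambda_D_nonzero: "lambda_D d q \<noteq> 0"
proof -
  have "of_poly 0 = (0 :: coeff_field)" by (simp add: of_poly_def flip: Zero_fract_def)
  then have "zvar \<noteq> 0" using of_poly_eq_iff[of "[:0, 1:]" 0] by (simp add: zvar_def)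
  then show ?thesis by (simp add: lambda_D_def) (simp add: zvar_def of_poly_eq_iff)
qed

theorem theorem4:
  fixes d :: nat and q :: complex
    and tr :: "nat \<Rightarrow> yh_free set \<Rightarrow> complex poly"
    and sqrt_lambda :: coeff_field
    and \<Theta> :: "link \<Rightarrow> coeff_field"
    and Lp Lm L0 :: link
  assumes "d \<ge> 1"
    and "q \<noteq> 0"
    and "is_trace d q tr"
    and "sqrt_lambda ^ 2 = lambda_D d q"
    and "is_Theta d q tr sqrt_lambda \<Theta>"
    and "conway_triple_distinct_components Lp Lm L0"
  shows "1 / sqrt_lambda * \<Theta> Lp - sqrt_lambda * \<Theta> Lm = of_poly [:q - inverse q:] * \<Theta> L0"
proof -
  let ?r = sqrt_lambda
  obtain n i \<alpha> \<beta> where i: "1 \<le> i" "i < n" and w: "\<alpha> \<in> braid_words n" "\<beta> \<in> braid_words n"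
    and orbit: "\<exists>r. (braid_perm (\<beta> @ \<alpha>) ^^ r) i = Suc i"
    and L: "Lp = link_of (braid_closure n (\<alpha> @ Sig i # \<beta>))"
    "Lm = link_of (braid_closure n (\<alpha> @ Sig_inv i # \<beta>))"
    "L0 = link_of (braid_closure n (\<alpha> @ \<beta>))"
    by (rule conway_triple_braids[OF assms(6)])
  have r: "?r \<noteq> 0" using assms(4) lambda_D_nonzero[of d q] by auto
  let ?t = "\<lambda>\<gamma>. of_poly (tr n (yh_braid d q n \<gamma>))"
  have skein: "?t (\<alpha> @ Sig i # \<beta>) = ?t (\<alpha> @ Sig_inv i # \<beta>) + of_poly [:q - inverse q:] * ?t (\<alpha> @ \<beta>)"
    using trace_skein[OF assms(1,3) w i orbit] by (simp only: of_poly_add of_poly_smult)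
  define k where "k = Lambda_D ?r ^ (n - 1) * ?r powi exponent_sum (\<alpha> @ \<beta>)"
  have \<Theta>: "\<Theta> (link_of (braid_closure n \<gamma>)) = Lambda_D ?r ^ (n - 1) * ?r powi exponent_sum \<gamma> * ?t \<gamma>"
    if "\<gamma> \<in> braid_words n" for \<gamma>
    using assms(5) that i by (simp add: is_Theta_def)
  have "exponent_sum (\<alpha> @ Sig i # \<beta>) = exponent_sum (\<alpha> @ \<beta>) + 1"
    "exponent_sum (\<alpha> @ Sig_inv i # \<beta>) = exponent_sum (\<alpha> @ \<beta>) - 1"
    by (simp_all add: exponent_sum_def)
  moreover have "\<alpha> @ Sig i # \<beta> \<in> braid_words n" "\<alpha> @ Sig_inv i # \<beta> \<in> braid_words n" "\<alpha> @ \<beta> \<in> braid_words n"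
    using w i by (auto simp: braid_words_def)
  ultimately have "\<Theta> Lp = k * ?r * ?t (\<alpha> @ Sig i # \<beta>)" "\<Theta> Lm = k / ?r * ?t (\<alpha> @ Sig_inv i # \<beta>)"
    "\<Theta> L0 = k * ?t (\<alpha> @ \<beta>)"
    using r by (simp_all add: L \<Theta> k_def power_int_add power_int_diff)
  then show ?thesis using r by (simp add: skein algebra_simps)
qed

end
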